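(* Let $n\ge1$. For all $k\in\{0,1,\dots,n\}$, all $f:\{-1,1\}^n\to[-1,1]$, and all $p\in[1,2)$, $$\big\||\nabla^kf|\big\|_{L^p}^{p}\ \ge\ C(p)^k\,W^{\ge k}(f)\left[1+\frac{1}{2k}\ln\Big(\frac{1}{W^{\ge k}(f)}\Big)\right]^{\frac{kp}{2}},$$ where $$C(p)=\Big(M(p)^{-\frac2p}+\frac{p}{2e(2-p)}\Big)^{-\frac p2},\qquad M(p):=p\,2^{-\frac p2}\max_{x\ge0}\frac{1-e^{-x}}{x^{p/2}}.$$ Moreover there is an absolute constant $c>0$ with $C(p)\ge c\,(2-p)$ for all $p\in[1,2)$.
   Context: The cube $\{-1,1\}^n$ carries the uniform probability measure; $L^p$ norms and the $L^2$ inner product are with respect to it. For $f:\{-1,1\}^n\to\mathbb R$ and $i\in[n]=\{1,\dots,n\}$, $D_i f(x)=\frac{1}{2}\big(f(x^{(i\mapsto 1)})-f(x^{(i\mapsto -1)})\big)$, where $x^{(i\mapsto\pm1)}$ is $x$ with its $i$-th coordinate replaced by $\pm1$. For $J\subseteq[n]$, $D_J:=\prod_{i\in J}D_i$, with $D_\varnothing$ the identity. For $0\le k\le n$, $\nabla^k f:=(D_Jf)_{|J|=k}$ and $|\nabla^k f|^2:=\sum_{|J|=k}|D_Jf|^2$ (pointwise). $f^{\ge k}$ is the component of $f$ orthogonal in $L^2$ to the null space of $\nabla^k$, and $W^{\ge k}(f):=\|f^{\ge k}\|_{L^2}^2$; equivalently $W^{\ge k}(f)=\sum_{|S|\ge k}\widehat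 f(S)^2$ with $\widehat f(S)=\mathbb E[f\chi_S]$, $\chi_S(x)=\prod_{i\in S}x_i$. Conventions: the right-hand side is $0$ if $W^{\ge k}(f)=0$; for $k=0$ the bracket raised to the power $0$ equals $1$. *)

theory Defs
  imports "HOL-Analysis.Analysis"
begin

text \<open>Points of the cube are functions on the index set \<open>{1..n}\<close>, extended by \<open>undefined\<close>.
  Functions on the cube are functions on \<^typ>\<open>nat \<Rightarrow> real\<close> whose values outside the cube are
  irrelevant to everything below.\<close>

definition cube :: "nat \<Rightarrow> (nat \<Rightarrow> real) set" where
  "cube n = {1..n} \<rightarrow>\<^sub>E {-1, 1}"

abbreviation cube_measure :: "nat \<Rightarrow> (nat \<Rightarrow> real) measure" where
  "cube_measure n \<equiv> uniform_count_measure (cube n)"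

definition cube_norm :: "nat \<Rightarrow> real \<Rightarrow> ((nat \<Rightarrow> real) \<Rightarrow> real) \<Rightarrow> real" where
  "cube_norm n p g = (LINT x|cube_measure n. \<bar>g x\<bar> powr p) powr (1 / p)"

definition cube_inner ::
  "nat \<Rightarrow> ((nat \<Rightarrow> real) \<Rightarrow> real) \<Rightarrow> ((nat \<Rightarrow> real) \<Rightarrow> real) \<Rightarrow> real" where
  "cube_inner n g h = (LINT x|cube_measure n. g x * h x)"

definition D :: "nat \<Rightarrow> ((nat \<Rightarrow> real) \<Rightarrow> real) \<Rightarrow> (nat \<Rightarrow> real) \<Rightarrow> real" where
  "D i f x = (f (x(i := 1)) - f (x(i := -1))) / 2"

text \<open>The product of the commuting operators \<open>D i\<close> over \<open>i \<in> J\<close>.\<close>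

definition D_set :: "nat set \<Rightarrow> ((nat \<Rightarrow> real) \<Rightarrow> real) \<Rightarrow> (nat \<Rightarrow> real) \<Rightarrow> real" where
  "D_set J f = Finite_Set.fold D f J"

lemma D_commute: "D i (D j f) = D j (D i f)"
  by (cases "i = j") (auto simp: D_def fun_eq_iff fun_upd_twist field_simps)

interpretation D_fold: comp_fun_commute D
  by standard (simp add: fun_eq_iff D_commute)

lemma D_set_empty [simp]: "D_set {} f = f"
  by (simp add: D_set_def)

lemma D_set_insert [simp]:
  "finite J \<Longrightarrow> i \<notin> J \<Longrightarrow> D_set (insert i J) f = D i (D_set J f)"
  by (simp add: D_set_def)

definition grad_abs :: "nat \<Rightarrow> nat \<Rightarrow> ((nat \<Rightarrow> real) \<Rightarrow> real) \<Rightarrow> (nat \<Rightarrow> real) \<Rightarrow> real" where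
  "grad_abs n k f x = sqrt (\<Sum>J | J \<subseteq> {1..n} \<and> card J = k. (D_set J f x)\<^sup>2)"

definition grad_null :: "nat \<Rightarrow> nat \<Rightarrow> ((nat \<Rightarrow> real) \<Rightarrow> real) set" where
  "grad_null n k = {h. \<forall>J\<subseteq>{1..n}. card J = k \<longrightarrow> (\<forall>x\<in>cube n. D_set J h x = 0)}"

text \<open>The component of \<open>f\<close> orthogonal to \<open>grad_null n k\<close>: \<open>f = (f - g) + g\<close> with \<open>f - g\<close> in the
  null space and \<open>g\<close> orthogonal to it. Requiring \<open>g\<close> to be extensional makes it unique.\<close>

definition upper_part :: "nat \<Rightarrow> nat \<Rightarrow> ((nat \<Rightarrow> real) \<Rightarrow> real) \<Rightarrow> (nat \<Rightarrow> real) \<Rightarrow> real" where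
  "upper_part n k f =
     (THE g. g \<in> extensional (cube n) \<and> (\<lambda>x. f x - g x) \<in> grad_null n k
        \<and> (\<forall>h\<in>grad_null n k. cube_inner n g h = 0))"

definition W :: "nat \<Rightarrow> nat \<Rightarrow> ((nat \<Rightarrow> real) \<Rightarrow> real) \<Rightarrow> real" where
  "W n k f = (cube_norm n 2 (upper_part n k f))\<^sup>2"

text \<open>At \<open>x = 0\<close> the quotient below is \<open>0 / 0 = 0\<close>, which for \<open>p < 2\<close> is its limit there, so the
  maximum over \<open>x \<ge> 0\<close> exists.\<close>

definition M :: "real \<Rightarrow> real" where
  "M p = p * 2 powr (- p / 2) * (GREATEST y. \<exists>x\<ge>0. y = (1 - exp (- x)) / x powr (p / 2))"

definition C :: "real \<Rightarrow> real" where
  "C p = (M p powr (- 2 / p) + p / (2 * exp 1 * (2 - p))) powr (- p / 2)"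

end

theory Submission
  imports Defs
begin

text \<open>
  Fix \<open>k \<ge> 1\<close> and \<open>p \<in> [1, 2)\<close>, and put \<open>\<alpha> = 1 - p/2\<close>, \<open>\<gamma> = p/2\<close>, \<open>a = 2\<alpha>/\<gamma>\<close>. For a given \<open>f\<close> let
  \<open>A\<close> be the \<open>p\<close>-th moment of \<open>|\<nabla>\<^sup>k f|\<close>, let \<open>w\<close> be its upper weight \<open>W n k f\<close>, which is assumed
  positive, and put \<open>R = (A/w) powr (1/(k\<gamma>))\<close> and \<open>\<zeta> = ln(1/w)/(2k)\<close>. Since \<open>A = w R powr (k\<gamma>)\<close>, the
  inequality says that \<open>1 + \<zeta> \<le> R (M(p) powr (-1/\<gamma>) + 1/(e a))\<close>. It is proved with \<open>m powr (-1/\<gamma>)\<close>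
  in place of \<open>M(p) powr (-1/\<gamma>)\<close>, where \<open>m = \<gamma> (2\<alpha>) powr \<alpha>\<close>; this is stronger because \<open>m \<ge> M(p)\<close>
  (\<open>M_bounds\<close>).

  All information about \<open>f\<close> is carried by one function of a time \<open>t\<close>, the energy
  \<open>V(t) = \<Sum>\<^sub>S (|S| choose k) e powr (-t|S|) (fourier f S)\<^sup>2\<close>, which is the inner product of \<open>\<nabla>\<^sup>k f\<close>
  with \<open>\<nabla>\<^sup>k P\<^sub>t f\<close>, where \<open>P\<^sub>t\<close> is the noise semigroup. Its normalised root
  \<open>q(t) = (V(t)/w) powr (1/k)\<close> satisfies three constraints.

  \<^item> Because \<open>|f| \<le> 1\<close>, Bessel's inequality for the derivatives of the noise kernel gives the pointwise bound
    \<open>|\<nabla>\<^sup>k P\<^sub>t f|\<^sup>2 \<le> (e powr (2t) - 1) powr (-k)\<close>. Interpolating between this and the \<open>p\<close>-th moment gives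
    \<open>q(t) \<le> R powr \<gamma> (2t) powr (-\<alpha>)\<close> (\<open>energy_le_moment\<close>), so \<open>q\<close> has little mass near \<open>0\<close>.
  \<^item> The logarithmic Sobolev inequality for the function \<open>|\<nabla>\<^sup>k P\<^bsub>t/2\<^esub> f|\<close> bounds its \<open>p\<close>-th
    moment from below by its second moment (\<open>moment_lower_bound\<close>, \<open>moment_ge_energy\<close>). In terms of \<open>q\<close>
    this is the differential inequality \<open>a (1 + \<zeta>) - ln R \<le> - a q'/q - ln q - t\<close>: if \<open>\<zeta>\<close> is large,
    then \<open>q\<close> decays fast, so it has little mass far from \<open>0\<close>.
  \<^item> Since \<open>d choose k \<ge> (d/k) powr k\<close>, comparison of power means gives total mass
    \<open>\<integral> q \<ge> 1\<close> (\<open>power_mean_profile\<close>). This is the step that makes every \<open>k\<close> behave like \<open>k = 1\<close>.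

  The conflict between these constraints is a statement about functions of one real variable,
  \<open>spectral_profile_bound\<close>. There the mass of \<open>q\<close> up to a well-chosen time \<open>s\<close> is bounded by the first
  constraint; after \<open>s\<close> the extremal solution of the differential inequality is
  \<open>exp (b exp (-\<tau>/a) - \<tau>)\<close> up to constants, whose integral is a Kummer function of \<open>b\<close>. An explicit bound
  on that function (\<open>kummer_at_bound_le\<close>) turns total mass at least \<open>1\<close> into an upper bound on \<open>\<zeta>\<close>, and
  the remaining inequality \<open>ln_le_of_gain\<close> is where \<open>1/(e a)\<close> appears, from tangents of the logarithm.

  For \<open>k = 0\<close> the claim is \<open>E f\<^sup>2 \<le> E |f| powr p\<close>, and the lower bound on \<open>C(p)\<close> only needs a positive
  lower bound on \<open>M(p)\<close>.
\<close>

section \<open>Elementary inequalities\<close>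

lemma nonneg_of_deriv_nonneg:
  fixes F F' :: "real \<Rightarrow> real"
  assumes "F 0 \<ge> 0" "x \<ge> 0"
    and "\<And>t. 0 \<le> t \<Longrightarrow> t \<le> x \<Longrightarrow> (F has_real_derivative F' t) (at t)"
    and "\<And>t. 0 \<le> t \<Longrightarrow> t \<le> x \<Longrightarrow> F' t \<ge> 0"
  shows "F x \<ge> 0"
proof -
  have "F 0 \<le> F x"
    by (rule DERIV_nonneg_imp_nondecreasing[OF assms(2)]) (use assms in blast)
  with assms(1) show ?thesis by simp
qed

text \<open>This and the next bound are Pade approximants of the logarithm at \<open>0\<close>, of orders \<open>(1,1)\<close> and
  \<open>(2,2)\<close>. The derivative of the difference of the two sides is an even power of \<open>u\<close> divided by a positive
  polynomial.\<close>

lemma ln_add_one_ge_pade11: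
  fixes u :: real assumes "u \<ge> 0"
  shows "ln (1 + u) \<ge> 2 * u / (2 + u)"
proof -
  have "ln (1 + u) - 2 * u / (2 + u) \<ge> 0"
  proof (rule nonneg_of_deriv_nonneg[where x = u and F = "\<lambda>u. ln (1 + u) - 2 * u / (2 + u)"
      and F' = "\<lambda>t. t^2 / ((1+t) * (2+t)^2)"])
    fix t :: real assume "0 \<le> t"
    then show "((\<lambda>u. ln (1 + u) - 2 * u / (2 + u)) has_real_derivative t^2 / ((1+t) * (2+t)^2)) (at t)"
      by (auto intro!: derivative_eq_intros) (simp add: divide_simps, simp add: algebra_simps power2_eq_square)
  qed (use assms in auto)
  then show ?thesis by simp
qed

lemma ln_add_one_ge_pade22:
  fixes u :: real assumes "u \<ge> 0"
  shows "ln (1 + u) \<ge> 3 * u * (u + 2) / (u\<^sup>2 + 6 * u + 6)"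
proof -
  have "ln (1 + u) - 3 * u * (u + 2) / (u\<^sup>2 + 6 * u + 6) \<ge> 0"
  proof (rule nonneg_of_deriv_nonneg[where x = u and F = "\<lambda>u. ln (1 + u) - 3 * u * (u + 2) / (u\<^sup>2 + 6 * u + 6)"
      and F' = "\<lambda>t. t^4 / ((1+t) * (t\<^sup>2 + 6 * t + 6)^2)"])
    fix t :: real assume "0 \<le> t"
    then have "t\<^sup>2 + 6 * t + 6 > 0" by (smt (verit) zero_le_power2)
    then show "((\<lambda>u. ln (1 + u) - 3 * u * (u + 2) / (u\<^sup>2 + 6 * u + 6)) has_real_derivative
        t^4 / ((1+t) * (t\<^sup>2 + 6 * t + 6)^2)) (at t)"
      using \<open>0 \<le> t\<close>
      by (auto intro!: derivative_eq_intros) (simp add: divide_simps, simp add: algebra_simps power2_eq_square power4_eq_xxxx)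
  qed (use assms in auto)
  then show ?thesis by simp
qed

lemma exp_ge_Taylor:
  fixes x :: real
  assumes "x \<ge> 0 \<or> even n"
  shows "exp x \<ge> (\<Sum>m<n. x ^ m / fact m)"
proof -
  obtain t where "exp x = (\<Sum>m<n. x ^ m / fact m) + exp t / fact n * x ^ n"
    using Maclaurin_exp_le by blast
  moreover have "exp t / fact n * x ^ n \<ge> 0"
    using assms by (auto intro!: mult_nonneg_nonneg simp: zero_le_even_power)
  ultimately show ?thesis by simp
qed

lemma exp_cosh_gap:
  fixes g :: real
  shows "exp g + exp (- g) - 1 - 2 * g \<ge> 0"
proof (cases "g \<ge> 0")
  case True
  have "exp g \<ge> (\<Sum>m<6. g^m / fact m)" "exp (-g) \<ge> (\<Sum>m<6. (-g)^m / fact m)"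
    by (rule exp_ge_Taylor; use True in simp)+
  then have "exp g + exp (-g) \<ge> 2 + g^2 + g^4/12"
    by (simp add: numeral_eq_Suc fact_numeral)
  moreover have "g^2 + g^4/12 + 1 - 2*g = (g - 1)^2 + g^4/12"
    by (simp add: power2_eq_square algebra_simps)
  moreover have "(g - 1)^2 + g^4/12 \<ge> 0" by simp
  ultimately show ?thesis by linarith
next
  case False
  then have "exp (-g) \<ge> 1 - g" using exp_ge_add_one_self[of "-g"] by simp
  with False show ?thesis by (smt (verit) exp_gt_zero)
qed

text \<open>Together with \<open>exp_cosh_gap\<close> this is one of the two endpoint cases, \<open>\<alpha> = 0\<close> and \<open>\<alpha> = 1/2\<close>, of
  \<open>star_ineq\<close>. The left-hand side has a minimum of about \<open>0.1\<close>, so Taylor polynomials of degree 7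
  suffice.\<close>

lemma exp_half_gap:
  fixes g :: real
  assumes "0 \<le> g" "g \<le> 9/5"
  shows "exp g * (1 - g/4) + 3/4 * exp (- g) - 1/5 - 7/4 * g \<ge> 0"
proof -
  have a: "exp g \<ge> (\<Sum>m<8. g^m / fact m)" and b: "exp (-g) \<ge> (\<Sum>m<8. (-g)^m / fact m)"
    by (rule exp_ge_Taylor; use assms in simp)+
  have a': "exp g \<ge> 1 + g + g^2/2 + g^3/6 + g^4/24 + g^5/120 + g^6/720 + g^7/5040" (is "_ \<ge> ?T")
    using a by (simp add: numeral_eq_Suc fact_numeral)
  have b': "exp (-g) \<ge> 1 - g + g^2/2 - g^3/6 + g^4/24 - g^5/120 + g^6/720 - g^7/5040" (is "_ \<ge> ?S")
    using b by (simp add: numeral_eq_Suc fact_numeral)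
  have "exp g * (1 - g/4) \<ge> ?T * (1 - g/4)"
    using a' assms by (intro mult_right_mono) auto
  then have 1: "exp g * (1 - g/4) + 3/4 * exp (- g) - 1/5 - 7/4 * g
      \<ge> ?T * (1 - g/4) + 3/4 * ?S - 1/5 - 7/4 * g"
    using b' by (intro add_mono diff_mono mult_left_mono) auto
  \<comment> \<open>Everything from \<open>g^4\<close> on is collected in the last factor, which stays above \<open>15/1000\<close>; the polynomial
    of degree 4 that remains is then a sum of squares and a positive constant.\<close>
  have eq: "?T * (1 - g/4) + 3/4 * ?S - 1/5 - 7/4 * g
     = (31/20 - 7/4*g + 5/8*g^2 - g^3/12) + g^4 * (1/32 - g/120 + g^2/2880 - g^3 * (1/2880 - 1/20160) - g^4/20160)"
    by (simp add: field_simps power_numeral_reduce)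
  have g2: "g^2 \<le> (9/5)^2" "g^3 \<le> (9/5)^3" "g^4 \<le> (9/5)^4"
    using assms by (intro power_mono; simp)+
  have "1/32 - g/120 + g^2/2880 - g^3 * (1/2880 - 1/20160) - g^4/20160 \<ge> 15/1000"
  proof -
    have "g^2 * (1/2880 - g * (1/2880 - 1/20160) - g^2/20160) \<ge> g^2 * (- 36/100000)"
      using assms g2 by (intro mult_left_mono) (auto simp: power_numeral_reduce)
    moreover have "g^2 * (- 36/100000) \<ge> - 12/10000" using g2 by (simp add: power_numeral_reduce)
    ultimately have "g^2/2880 - g^3 * (1/2880 - 1/20160) - g^4/20160 \<ge> - 12/10000"
      by (simp add: algebra_simps power_numeral_reduce)
    then show ?thesis using assms by linarith
  qed
  then have "g^4 * (1/32 - g/120 + g^2/2880 - g^3 * (1/2880 - 1/20160) - g^4/20160) \<ge> g^4 * (15/1000)"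
    by (intro mult_left_mono) auto
  moreover have "(31/20 - 7/4*g + 5/8*g^2 - g^3/12) + g^4 * (15/1000)
      = 15/1000 * (g^2 - 25/9 * g)^2 + 55/108 * (g - 189/110)^2 + (31/20 - 49/64 * (108/55))"
    by (simp add: field_simps power_numeral_reduce)
  moreover have "15/1000 * (g^2 - 25/9 * g)^2 + 55/108 * (g - 189/110)^2 + (31/20 - 49/64 * (108/55)) \<ge> 0"
    by (intro add_nonneg_nonneg mult_nonneg_nonneg zero_le_power2) auto
  ultimately show ?thesis using 1 eq by linarith
qed

section \<open>The scalar inequality that produces the constant\<close>

text \<open>The correction term in \<open>kummer_arg_bound\<close>. Its denominator is chosen so that the inequality which makes
  that function a supersolution becomes affine in \<open>\<alpha>\<close> (\<open>gain_supersolution\<close>).\<close>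

definition gain :: "real \<Rightarrow> real \<Rightarrow> real" where
  "gain \<alpha> g = 2 * (exp g - 1 - g) / (2 + \<alpha> * (exp g - 1))"

text \<open>With \<open>u = exp g - 1\<close> and after multiplication by \<open>1 + \<alpha>u/2\<close>, the difference of the two sides is an
  affine function of \<open>\<alpha>\<close> plus the nonnegative term \<open>11/20 \<alpha>\<^sup>2 u\<close>, so it suffices to look at
  \<open>\<alpha> = 0\<close> and \<open>\<alpha> = 1/2\<close>.\<close>

lemma star_ineq:
  fixes \<alpha> g :: real
  assumes \<alpha>: "0 < \<alpha>" "\<alpha> \<le> 1/2" and g: "0 \<le> g" "g \<le> 9/5"
  shows "g \<le> exp (- g) + gain \<alpha> g + 11/10 * \<alpha>"
proof -
  define u where "u = exp g - 1"
  define c where "c = g - exp (- g)"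
  define E where "E = u - g"
  have u: "u \<ge> 0" using g by (simp add: u_def)
  have w: "1 + \<alpha> * u / 2 > 0" using u \<alpha> by (simp add: add_pos_nonneg)
  have a0: "E - c \<ge> 0" using exp_cosh_gap[of g] by (simp add: E_def c_def u_def)
  have cu: "c * u = g * exp g - g - 1 + exp (- g)"
    by (simp add: c_def u_def algebra_simps flip: exp_add)
  have a1: "E - c + 11/20 - c * u / 4 \<ge> 0"
    using exp_half_gap[OF g] unfolding cu by (simp add: E_def c_def u_def field_simps)
  have "(1 - 2*\<alpha>) * (E - c) + 2*\<alpha> * (E - c + 11/20 - c * u / 4) \<ge> 0"
    using a0 a1 \<alpha> by (intro add_nonneg_nonneg mult_nonneg_nonneg) auto
  moreover have "E + (11/10*\<alpha> - c) * (1 + \<alpha> * u/2)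
     = (1 - 2*\<alpha>) * (E - c) + 2*\<alpha> * (E - c + 11/20 - c * u / 4) + 11/20 * \<alpha>^2 * u"
    by (simp add: field_simps power2_eq_square)
  moreover have "11/20 * \<alpha>^2 * u \<ge> 0" using u by simp
  ultimately have "E + (11/10*\<alpha> - c) * (1 + \<alpha> * u/2) \<ge> 0" by linarith
  then have "(E + (11/10*\<alpha> - c) * (1 + \<alpha> * u/2)) / (1 + \<alpha> * u/2) \<ge> 0" using w by simp
  moreover have "(E + (11/10*\<alpha> - c) * (1 + \<alpha> * u/2)) / (1 + \<alpha> * u/2) = E / (1 + \<alpha> * u/2) + (11/10*\<alpha> - c)"
    using w by (simp add: field_simps)
  moreover have "E / (1 + \<alpha> * u/2) = gain \<alpha> g"
    using w by (simp add: gain_def E_def u_def divide_simps)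
  ultimately show ?thesis by (simp add: c_def)
qed

text \<open>The left-hand side is \<open>n + ln (1 - \<alpha>)\<close> for the number \<open>n\<close> of \<open>ln_le_of_gain\<close>.\<close>

lemma rate_shift_ge:
  fixes \<alpha> :: real
  assumes \<alpha>: "0 < \<alpha>" "\<alpha> \<le> 1/2"
  shows "\<alpha> / (1 - \<alpha>) * ln (1 / (2 * \<alpha> * (1 - \<alpha>))) \<ge> 11/10 * \<alpha>"
proof -
  define y where "y = 2 * \<alpha> * (1 - \<alpha>)"
  have y: "y > 0" "y \<le> 1"
    using \<alpha> mult_le_one[of "2 * \<alpha>" "1 - \<alpha>"] by (simp_all add: y_def mult_pos_pos)
  have "ln (1 / y) \<ge> 2 * (1 - y) / (1 + y)"
  proof -
    have "1 + (1 - y)/y = 1/y" "2 * ((1 - y)/y) / (2 + (1 - y)/y) = 2 * (1 - y) / (1 + y)"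
      using y by (simp_all add: divide_simps)
    moreover have "ln (1 + (1 - y)/y) \<ge> 2 * ((1 - y)/y) / (2 + (1 - y)/y)"
      by (rule ln_add_one_ge_pade11) (use y in simp)
    ultimately show ?thesis by (simp only:)
  qed
  moreover have "2 * (1 - y) / (1 + y) \<ge> 11/10 * (1 - \<alpha>)"
  proof -
    have "2 * (1 - y) - 11/10 * (1 - \<alpha>) * (1 + y)
        = 73/10 * (\<alpha> - 51/146)^2 + (9/10 - 51/10 * (51/292)) + 22/10 * \<alpha>^2 * (1/2 - \<alpha>)"
      by (simp add: y_def field_simps power2_eq_square power_numeral_reduce)
    moreover have "\<dots> \<ge> 0" using \<alpha> by (intro add_nonneg_nonneg mult_nonneg_nonneg zero_le_power2) auto
    ultimately show ?thesis using y by (simp add: field_simps)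
  qed
  ultimately have "ln (1 / y) \<ge> 11/10 * (1 - \<alpha>)" by linarith
  then have "\<alpha> / (1 - \<alpha>) * ln (1/y) \<ge> \<alpha> / (1 - \<alpha>) * (11/10 * (1 - \<alpha>))"
    using \<alpha> by (intro mult_left_mono) auto
  moreover have "\<alpha> / (1 - \<alpha>) * (11/10 * (1 - \<alpha>)) = 11/10 * \<alpha>" using \<alpha> by (simp add: divide_simps)
  ultimately show ?thesis by (simp only: y_def)
qed

lemma neg_ln_one_minus_le:
  fixes \<alpha> :: real
  assumes \<alpha>: "0 \<le> \<alpha>" "\<alpha> \<le> 1/2"
  shows "- ln (1 - \<alpha>) \<le> 7/5 * \<alpha>"
proof -
  have "ln ((1 - 2*\<alpha>) *\<^sub>R 1 + (2*\<alpha>) *\<^sub>R (1/2)) \<ge> (1 - 2*\<alpha>) * ln 1 + (2*\<alpha>) * ln (1/2::real)"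
    by (rule concave_onD[OF ln_concave]) (use \<alpha> in auto)
  then have "ln (1 - \<alpha>) \<ge> - 2 * \<alpha> * ln 2" by (simp add: ln_div algebra_simps)
  moreover have "2 * \<alpha> * ln 2 \<le> 2 * \<alpha> * (25/36)"
    using \<alpha> ln2_le_25_over_36 by (intro mult_left_mono) auto
  ultimately show ?thesis using \<alpha> by linarith
qed

lemma gain_ge_of_large:
  fixes \<alpha> g :: real
  assumes \<alpha>: "0 < \<alpha>" "\<alpha> \<le> 1/2" and g: "g \<ge> 9/5"
  shows "gain \<alpha> g \<ge> 7/5"
proof -
  define u where "u = exp g - 1"
  define h where "h = g - 9/5"
  have h: "h \<ge> 0" and gh: "g = h + 9/5" using g by (auto simp: h_def)
  have u: "u \<ge> 0" using g by (simp add: u_def)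
  have "exp g \<ge> (\<Sum>m<6. g^m / fact m)" by (rule exp_ge_Taylor) (use g in simp)
  then have "u \<ge> g + g^2/2 + g^3/6 + g^4/24 + g^5/120" by (simp add: u_def numeral_eq_Suc fact_numeral)
  moreover have "(9/5)^5 \<le> g^5" "(9/5)^4 \<le> g^4" "(9/5)^3 \<le> g^3"
    by (intro power_mono; use g in simp)+
  then have "59049/3125 \<le> g^5" "6561/625 \<le> g^4" "729/125 \<le> g^3" by (simp_all add: power_divide)
  moreover have "9/5 * g \<le> g^2" using g by (simp add: power2_eq_square)
  ultimately have "13/5 * u - 4 * g - 28/5 \<ge> 0" using g by linarith
  moreover have "\<alpha> * u \<le> 1/2 * u" using \<alpha> u by (intro mult_right_mono) auto
  moreover have "2 * (u - g) - 7/5 * (2 + \<alpha> * u) = (13/5 * u - 4 * g - 28/5) / 2 + 7/5 * (1/2 * u - \<alpha> * u)"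
    by (simp add: field_simps)
  ultimately have "2 * (u - g) \<ge> 7/5 * (2 + \<alpha> * u)" by (smt (verit) divide_nonneg_pos mult_nonneg_nonneg)
  moreover have "2 + \<alpha> * u > 0" using \<alpha> u by (simp add: add_pos_nonneg)
  ultimately show ?thesis by (simp add: gain_def u_def field_simps)
qed

text \<open>This is the last step of the optimisation and the only one that sees the summand \<open>1/(e a)\<close> of the
  constant. For large \<open>g\<close> it is \<open>ln R \<le> R/e\<close>, because then \<open>gain\<close> already exceeds
  \<open>- ln (1 - \<alpha>) / \<alpha>\<close>. For small \<open>g\<close>, \<open>ln\<close> is replaced by its tangent of slope
  \<open>1/(e (1 - \<alpha>))\<close> instead of \<open>1/e\<close>; with this slope all terms become linear and \<open>star_ineq\<close> remains.\<close>

lemma ln_le_of_gain: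
  fixes \<alpha> R n g :: real
  assumes \<alpha>: "0 < \<alpha>" "\<alpha> \<le> 1/2" and R: "R > 0"
    and n: "n = (- ln (1 - \<alpha>) - \<alpha> * ln (2 * \<alpha>)) / (1 - \<alpha>)"
    and g: "g = ln R + n" "g \<ge> 0"
  shows "ln R - ln (1 - \<alpha>) - \<alpha> * exp (- g) - \<alpha> * gain \<alpha> g \<le> R / exp 1"
proof (cases "g \<le> 9/5")
  case False
  have "ln (R / exp 1) \<le> R / exp 1 - 1" using R by (intro ln_le_minus_one) simp
  then have "ln R \<le> R / exp 1" using R by (simp add: ln_div)
  moreover have "\<alpha> * gain \<alpha> g \<ge> \<alpha> * (7/5)" using False \<alpha> by (intro mult_left_mono gain_ge_of_large) auto
  moreover have "\<alpha> * exp (- g) \<ge> 0" using \<alpha> by simp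
  ultimately show ?thesis using neg_ln_one_minus_le[of \<alpha>] \<alpha> by linarith
next
  case True
  define L where "L = - ln (1 - \<alpha>)"
  have eL: "exp (- L) = 1 - \<alpha>" using \<alpha> by (simp add: L_def)
  have "R / exp 1 = exp (ln R - 1)" using R by (simp add: exp_diff)
  also have "\<dots> = exp (- L) * exp (L + ln R - 1)" by (simp flip: exp_add)
  also have "\<dots> \<ge> (1 - \<alpha>) * (1 + (L + ln R - 1))"
    unfolding eL using \<alpha> exp_ge_add_one_self[of "L + ln R - 1"]
    by (intro mult_left_mono) (simp_all only: diff_ge_0_iff_ge add_diff_eq)
  finally have 1: "R / exp 1 \<ge> (1 - \<alpha>) * (L + ln R)" by simp
  have "n - L = \<alpha> / (1 - \<alpha>) * ln (1 / (2 * \<alpha> * (1 - \<alpha>)))"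
  proof -
    have "ln (1 / (2 * \<alpha> * (1 - \<alpha>))) = - ln (2 * \<alpha>) - ln (1 - \<alpha>)"
      using \<alpha> by (simp add: ln_div ln_mult)
    then show ?thesis using \<alpha> by (simp add: n L_def divide_simps) (simp add: algebra_simps)
  qed
  then have "n - L \<ge> 11/10 * \<alpha>" using rate_shift_ge[OF \<alpha>] by simp
  then have "L + ln R \<le> exp (- g) + gain \<alpha> g"
    using star_ineq[OF \<alpha> g(2) True] g by linarith
  then have "\<alpha> * (L + ln R) \<le> \<alpha> * (exp (- g) + gain \<alpha> g)" using \<alpha> by (intro mult_left_mono) auto
  with 1 show ?thesis by (simp add: L_def algebra_simps)
qed

section \<open>A Kummer function and its size\<close>

definition kummer_coeff :: "real \<Rightarrow> nat \<Rightarrow> real" where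
  "kummer_coeff a j = a / ((a + real j) * fact j)"

text \<open>Kummer's function \<open>\<^sub>1F\<^sub>1(a; a + 1; b)\<close>. It is used because
  \<open>- exp (-\<tau>) * kummer a (b * exp (-\<tau>/a))\<close> is an antiderivative of \<open>exp (b * exp (-\<tau>/a) - \<tau>)\<close>, which is
  what \<open>kummer_deriv\<close> expresses.\<close>

definition kummer :: "real \<Rightarrow> real \<Rightarrow> real" where
  "kummer a b = (\<Sum>j. kummer_coeff a j * b ^ j)"

lemma summable_kummer:
  assumes "a > 0"
  shows "summable (\<lambda>j. kummer_coeff a j * b ^ j)"
proof (rule summable_comparison_test')
  show "summable (\<lambda>j. \<bar>b\<bar> ^ j / fact j)"
    using summable_exp[of "\<bar>b\<bar>"] by (simp add: divide_inverse mult.commute)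
  show "norm (kummer_coeff a j * b ^ j) \<le> \<bar>b\<bar> ^ j / fact j" if "j \<ge> 0" for j
  proof -
    have "a / (a + real j) \<le> 1" using assms by simp
    then have "a / (a + real j) * (\<bar>b\<bar> ^ j / fact j) \<le> 1 * (\<bar>b\<bar> ^ j / fact j)"
      by (intro mult_right_mono) auto
    then show ?thesis using assms by (simp add: kummer_coeff_def abs_mult power_abs)
  qed
qed

lemma kummer_0 [simp]: "a > 0 \<Longrightarrow> kummer a 0 = 1"
  unfolding kummer_def by (subst powser_zero) (simp add: kummer_coeff_def)

lemma kummer_nonneg:
  assumes "a > 0" "b \<ge> 0" shows "kummer a b \<ge> 0"
  unfolding kummer_def by (intro suminf_nonneg summable_kummer) (use assms in \<open>auto simp: kummer_coeff_def\<close>)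

lemma kummer_deriv:
  assumes a: "a > 0"
  obtains J' where "(kummer a has_real_derivative J') (at b)" "b * J' = a * exp b - a * kummer a b"
proof
  define J' where "J' = (\<Sum>n. diffs (kummer_coeff a) n * b ^ n)"
  show "(kummer a has_real_derivative J') (at b)"
    unfolding kummer_def[abs_def] J'_def by (rule termdiffs_strong_converges_everywhere) (rule summable_kummer[OF a])
  have "summable (\<lambda>n. diffs (kummer_coeff a) n * b ^ n)"
    by (rule termdiff_converges_all) (rule summable_kummer[OF a])
  then have "(\<lambda>n. of_nat n * kummer_coeff a n * b ^ (n - Suc 0)) sums J'"
    unfolding J'_def by (rule diffs_equiv)
  then have "(\<lambda>n. b * (of_nat n * kummer_coeff a n * b ^ (n - Suc 0))) sums (b * J')"
    by (rule sums_mult)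
  moreover have "b * (of_nat n * kummer_coeff a n * b ^ (n - Suc 0)) = of_nat n * (kummer_coeff a n * b ^ n)" for n
    by (cases n) auto
  ultimately have 1: "(\<lambda>n. of_nat n * (kummer_coeff a n * b ^ n)) sums (b * J')" by simp
  have 2: "(\<lambda>n. a * (kummer_coeff a n * b ^ n)) sums (a * kummer a b)"
    unfolding kummer_def by (intro sums_mult summable_sums summable_kummer a)
  have "(\<lambda>n. of_nat n * (kummer_coeff a n * b ^ n) + a * (kummer_coeff a n * b ^ n)) sums (b * J' + a * kummer a b)"
    by (rule sums_add[OF 1 2])
  moreover have "of_nat n * (kummer_coeff a n * b ^ n) + a * (kummer_coeff a n * b ^ n) = a * (b ^ n /\<^sub>R fact n)" for n
  proof -
    have "a + real n \<noteq> 0" using a by linarith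
    then have "a / ((a + real n) * fact n) * (a + real n) = a / fact n"
      by (simp only: divide_simps) simp
    moreover have "of_nat n * (kummer_coeff a n * b ^ n) + a * (kummer_coeff a n * b ^ n)
        = a / ((a + real n) * fact n) * (a + real n) * b ^ n"
      unfolding kummer_coeff_def by (simp only: ring_distribs mult.assoc mult.commute mult.left_commute)
    ultimately show ?thesis by (simp only:) (simp add: divide_inverse)
  qed
  moreover have "(\<lambda>n. a * (b ^ n /\<^sub>R fact n)) sums (a * exp b)"
    by (intro sums_mult exp_converges)
  ultimately have "b * J' + a * kummer a b = a * exp b" by (simp add: sums_unique2)
  then show "b * J' = a * exp b - a * kummer a b" by simp
qed

text \<open>Each inequality is affine in \<open>\<alpha>\<close>. In the second one the endpoint \<open>\<alpha> = 0\<close> is the first Pade bound and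
  \<open>\<alpha> = 1/2\<close> is the second, both for \<open>g = ln (1 + u)\<close>.\<close>

lemma gain_supersolution:
  fixes \<alpha> g :: real
  assumes \<alpha>: "0 < \<alpha>" "\<alpha> \<le> 1/2" and g: "g \<ge> 0"
  defines "u \<equiv> exp g - 1"
  shows "2 * (u - g) \<le> g * u" "(u - g) * (2 + 2 * \<alpha> + 3 * \<alpha> * u) \<le> g * u * (1 + \<alpha> + \<alpha> * u)"
    "2 * \<alpha> * (u - g) \<le> g * (2 + \<alpha> * u)"
proof -
  have u: "u \<ge> 0" using g by (simp add: u_def)
  have gu: "g = ln (1 + u)" by (simp add: u_def)
  have ug: "u \<ge> g" unfolding u_def using exp_ge_add_one_self[of g] by linarith
  show 1: "2 * (u - g) \<le> g * u"
    using ln_add_one_ge_pade11[OF u] u unfolding gu[symmetric] by (simp add: field_simps)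
  have w: "u\<^sup>2 + 6 * u + 6 > 0" using u by (simp add: add_nonneg_pos)
  have pade: "3 * u * (u + 2) \<le> g * (u\<^sup>2 + 6 * u + 6)"
    using ln_add_one_ge_pade22[OF u] w unfolding gu[symmetric] by (simp add: pos_divide_le_eq)
  define P Q where "P = (u - g) * (3 + 3/2 * u)" and "Q = g * u * (3/2 + u/2)"
  have "2 * (Q - P) = g * (u\<^sup>2 + 6 * u + 6) - 3 * u * (u + 2)"
    by (simp add: P_def Q_def field_simps power2_eq_square)
  with pade have "0 \<le> 2 * (Q - P)" by (simp only: diff_ge_0_iff_ge)
  then have "P \<le> Q" by simp
  then have 2: "(u - g) * (3 + 3/2 * u) \<le> g * u * (3/2 + u/2)" by (simp only: P_def Q_def)
  have "(1 - 2*\<alpha>) * (g * u - 2 * (u - g)) + 2 * \<alpha> * (g * u * (3/2 + u/2) - (u - g) * (3 + 3/2 * u)) \<ge> 0"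
    using 1 2 \<alpha> by (intro add_nonneg_nonneg mult_nonneg_nonneg) auto
  then show "(u - g) * (2 + 2 * \<alpha> + 3 * \<alpha> * u) \<le> g * u * (1 + \<alpha> + \<alpha> * u)"
    by (simp add: field_simps)
  have "2 * \<alpha> * (u - g) \<le> \<alpha> * (g * u)" using mult_left_mono[OF 1, of \<alpha>] \<alpha> by simp
  then show "2 * \<alpha> * (u - g) \<le> g * (2 + \<alpha> * u)" using g by (simp add: algebra_simps)
qed

text \<open>An upper bound for the \<open>b\<close> with \<open>exp (-b) * kummer a b = exp (-g)\<close>, where \<open>a = 2\<alpha>/(1 - \<alpha>)\<close>.\<close>

definition kummer_arg_bound :: "real \<Rightarrow> real \<Rightarrow> real" where
  "kummer_arg_bound \<alpha> g = 2 * \<alpha> / (1 - \<alpha>) * (exp g - 1) + (g - \<alpha> * gain \<alpha> g)"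

text \<open>The \<open>b\<close> with \<open>exp (-b) * kummer a b = exp (-g)\<close> satisfies \<open>b' (b - a (exp g - 1)) = b\<close> as a function
  of \<open>g\<close>. The explicit function is a supersolution of this equation.\<close>

lemma kummer_arg_bound_deriv:
  fixes \<alpha> g :: real
  assumes \<alpha>: "0 < \<alpha>" "\<alpha> \<le> 1/2" and g: "g \<ge> 0"
  obtains B' where "(kummer_arg_bound \<alpha> has_real_derivative B') (at g)"
    "B' * (g - \<alpha> * gain \<alpha> g) \<ge> kummer_arg_bound \<alpha> g" "g - \<alpha> * gain \<alpha> g \<ge> 0"
proof
  define u where "u = exp g - 1"
  define w where "w = 2 + \<alpha> * u"
  define E where "E = u - g"
  define a where "a = 2 * \<alpha> / (1 - \<alpha>)"
  define X where "X = g - \<alpha> * gain \<alpha> g"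
  define G' where "G' = (2 * u * w - 2 * E * (\<alpha> * (1 + u))) / w^2"
  have u: "u \<ge> 0" using g by (simp add: u_def)
  have w: "w > 0" using u \<alpha> by (simp add: w_def add_pos_nonneg)
  have a: "a > 0" using \<alpha> by (simp add: a_def)
  have E: "E \<ge> 0" unfolding E_def u_def using exp_ge_add_one_self[of g] by linarith
  note S = gain_supersolution[OF \<alpha> g, folded u_def]
  have gain: "gain \<alpha> g = 2 * E / w" by (simp add: gain_def E_def u_def w_def)
  have Xw: "X * w = g * w - 2 * \<alpha> * E" using w by (simp add: X_def gain field_simps)
  have "X * w \<ge> 0" using S(3) unfolding Xw by (simp add: E_def w_def)
  then show X: "g - \<alpha> * gain \<alpha> g \<ge> 0" using w by (simp add: X_def[symmetric] zero_le_mult_iff)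
  have dG: "(gain \<alpha> has_real_derivative G') (at g)"
    unfolding gain_def[abs_def] G'_def w_def u_def E_def
    using w unfolding w_def u_def by (auto intro!: derivative_eq_intros simp: power2_eq_square algebra_simps)
  show "(kummer_arg_bound \<alpha> has_real_derivative (a * (1 + u) + (1 - \<alpha> * G'))) (at g)"
    unfolding kummer_arg_bound_def[abs_def] a_def
    by (rule derivative_eq_intros dG refl | simp add: u_def)+
  have "G' \<le> 2 * u / w"
  proof -
    have "G' = 2 * u / w - 2 * E * (\<alpha> * (1 + u)) / w^2"
      using w by (simp add: G'_def diff_divide_distrib power2_eq_square)
    moreover have "2 * E * (\<alpha> * (1 + u)) / w^2 \<ge> 0" using E \<alpha> u by simp
    ultimately show ?thesis by simp
  qed
  then have "\<alpha> * G' \<le> \<alpha> * (2 * u / w)" using \<alpha> by (intro mult_left_mono) auto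
  then have 1: "(a * (1 + u) + (1 - \<alpha> * G')) * X \<ge> (a * (1 + u) + (1 - \<alpha> * (2 * u / w))) * X"
    using X by (intro mult_right_mono) (auto simp: X_def)
  have "E * w\<^sup>2 + 2 * \<alpha> * E * w + 2 * \<alpha> * E * u * (1 + \<alpha> + \<alpha> * u) \<le> u * g * w * (1 + \<alpha> + \<alpha> * u)"
  proof -
    have "2 * \<alpha> * E * u * (1 + \<alpha> + \<alpha> * u) \<le> 2 * \<alpha> * E * u * w"
      using \<alpha> E u by (intro mult_left_mono) (auto simp: w_def)
    moreover have "w * (E * (2 + 2 * \<alpha> + 3 * \<alpha> * u)) \<le> w * (g * u * (1 + \<alpha> + \<alpha> * u))"
      using S(2) w unfolding E_def by (intro mult_left_mono) auto
    moreover have "w * (E * (2 + 2 * \<alpha> + 3 * \<alpha> * u)) = E * w\<^sup>2 + 2 * \<alpha> * E * w + 2 * \<alpha> * E * u * w"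
      by (simp add: w_def algebra_simps power2_eq_square)
    ultimately show ?thesis by (simp add: mult.commute mult.left_commute mult.assoc)
  qed
  then have "(w + u * (1 + \<alpha> + \<alpha> * u)) * (X * w) \<ge> u * w\<^sup>2"
    unfolding Xw by (simp add: E_def algebra_simps power2_eq_square)
  moreover have "w + u * (1 + \<alpha> + \<alpha> * u) = (1 + u) * w - (1 - \<alpha>) * u"
    by (simp add: w_def algebra_simps)
  ultimately have "((1 + u) * w - (1 - \<alpha>) * u) * X * w \<ge> u * w * w"
    by (simp add: power2_eq_square mult.assoc)
  then have "((1 + u) * w - (1 - \<alpha>) * u) * X \<ge> u * w" using w by simp
  then have "a / w * (((1 + u) * w - (1 - \<alpha>) * u) * X) \<ge> a / w * (u * w)"
    using a w by (intro mult_left_mono) auto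
  moreover have "a / w * (u * w) = a * u" using w by simp
  moreover have "a / w * (((1 + u) * w - (1 - \<alpha>) * u) * X) = (a * (1 + u) - \<alpha> * (2 * u / w)) * X"
    using w \<alpha> by (simp add: a_def field_simps)
  ultimately have "(a * (1 + u) - \<alpha> * (2 * u / w)) * X \<ge> a * u" by simp
  then have "(a * (1 + u) + (1 - \<alpha> * (2 * u / w))) * X \<ge> a * u + X" by (simp add: algebra_simps)
  with 1 show "(a * (1 + u) + (1 - \<alpha> * G')) * (g - \<alpha> * gain \<alpha> g) \<ge> kummer_arg_bound \<alpha> g"
    by (simp add: kummer_arg_bound_def X_def a_def u_def)
qed

text \<open>The difference \<open>exp (b - g) - kummer a b\<close> along \<open>b = kummer_arg_bound \<alpha> g\<close> vanishes at \<open>g = 0\<close>.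
  Multiplied by the integrating factor \<open>b powr a\<close> it is nondecreasing, precisely because
  \<open>kummer_arg_bound\<close> is a supersolution.\<close>

lemma kummer_at_bound_le:
  fixes \<alpha> g :: real
  assumes \<alpha>: "0 < \<alpha>" "\<alpha> \<le> 1/2" and g: "g \<ge> 0"
  shows "exp (- kummer_arg_bound \<alpha> g) * kummer (2 * \<alpha> / (1 - \<alpha>)) (kummer_arg_bound \<alpha> g) \<le> exp (- g)"
proof (cases "g = 0")
  case True
  then show ?thesis using \<alpha> by (simp add: kummer_arg_bound_def gain_def)
next
  case False
  define a where "a = 2 * \<alpha> / (1 - \<alpha>)"
  define B where "B = kummer_arg_bound \<alpha>"
  have a: "a > 0" using \<alpha> by (simp add: a_def)
  have Bpos: "B x \<ge> a * (exp x - 1)" if "x \<ge> 0" for x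
    using kummer_arg_bound_deriv[OF \<alpha> that] unfolding B_def kummer_arg_bound_def a_def by fastforce
  have cB: "isCont B x" if "x \<ge> 0" for x
    using kummer_arg_bound_deriv[OF \<alpha> that] unfolding B_def by (metis DERIV_isCont)
  have ck: "isCont (kummer a) x" for x using kummer_deriv[OF a] by (metis DERIV_isCont)
  define H where "H = (\<lambda>x. B x powr a * (exp (B x - x) - kummer a (B x)))"
  have "H 0 \<le> H g"
  proof (rule DERIV_nonneg_imp_increasing_open[where f = H])
    show "0 \<le> g" by fact
    have "continuous_on {0..g} B" using cB by (auto intro: continuous_at_imp_continuous_on)
    moreover have "continuous_on {0..g} (\<lambda>x. kummer a (B x))"
      by (intro continuous_at_imp_continuous_on ballI isCont_o2[OF cB ck]) auto
    moreover have "\<forall>x\<in>{0..g}. 0 \<le> B x" 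
      using Bpos a by (auto intro!: order_trans[OF _ Bpos] mult_nonneg_nonneg)
    ultimately show "continuous_on {0..g} H"
      unfolding H_def using a by (intro continuous_on_mult continuous_on_powr' continuous_intros) auto
    fix x assume x: "0 < x" "x < g"
    obtain B' where B': "(B has_real_derivative B') (at x)"
      "B' * (x - \<alpha> * gain \<alpha> x) \<ge> B x"
      using kummer_arg_bound_deriv[OF \<alpha>, of x] x unfolding B_def by (metis less_imp_le)
    obtain J' where J': "(kummer a has_real_derivative J') (at (B x))" "B x * J' = a * exp (B x) - a * kummer a (B x)"
      using kummer_deriv[OF a] by blast
    have "a * (exp x - 1) > 0" using a x by simp
    then have Bx: "B x > 0" using Bpos[of x] x by linarith
    have d: "(H has_real_derivative
      (a * B x powr (a - 1) * B') * (exp (B x - x) - kummer a (B x)) +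
        B x powr a * (exp (B x - x) * (B' - 1) - J' * B')) (at x)" (is "(_ has_real_derivative ?h) _")
      unfolding H_def using Bx DERIV_chain2[OF J'(1) B'(1)] B'(1)
      by (auto intro!: derivative_eq_intros simp: algebra_simps)
    have pw: "B x powr a = B x powr (a - 1) * B x" using Bx by (simp add: powr_diff)
    have "?h = B x powr (a - 1) * (a * B' * (exp (B x - x) - kummer a (B x)) + exp (B x - x) * (B' - 1) * B x - B x * J' * B')"
      unfolding pw by (simp add: algebra_simps)
    also have "a * B' * (exp (B x - x) - kummer a (B x)) + exp (B x - x) * (B' - 1) * B x - B x * J' * B'
      = exp (B x - x) * (a * B' + (B' - 1) * B x - a * B' * exp x)"
    proof -
      have "exp (B x) = exp (B x - x) * exp x" by (simp flip: exp_add)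
      then show ?thesis unfolding J'(2) by (simp only:) (simp add: algebra_simps)
    qed
    also have "a * B' + (B' - 1) * B x - a * B' * exp x = B' * (x - \<alpha> * gain \<alpha> x) - B x"
    proof -
      have "B x = a * (exp x - 1) + (x - \<alpha> * gain \<alpha> x)" by (simp add: B_def kummer_arg_bound_def a_def)
      then show ?thesis by (simp only:) (simp add: algebra_simps)
    qed
    finally have "?h \<ge> 0" using B'(2) by simp
    with d show "\<exists>y. (H has_real_derivative y) (at x) \<and> 0 \<le> y" by blast
  qed
  moreover have "H 0 = 0" using a by (simp add: H_def B_def kummer_arg_bound_def gain_def)
  moreover have "a * (exp g - 1) > 0" using a g False by simp
  then have "B g > 0" using Bpos[OF g] by linarith
  ultimately have "0 \<le> H g" "B g > 0" by simp_all
  then have "kummer a (B g) \<le> exp (B g - g)" by (simp add: H_def zero_le_mult_iff)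
  then have "exp (- B g) * kummer a (B g) \<le> exp (- B g) * exp (B g - g)" by (intro mult_left_mono) auto
  then show ?thesis by (simp add: B_def a_def flip: exp_add)
qed

section \<open>Spectral profiles\<close>

lemma nondecreasing_to_zero_le:
  fixes F :: "real \<Rightarrow> real"
  assumes d: "\<And>t. t \<ge> s \<Longrightarrow> \<exists>y. (F has_real_derivative y) (at t) \<and> y \<ge> 0"
    and b: "\<And>t. t \<ge> s \<Longrightarrow> F t \<le> \<eta> t" and l: "(\<eta> \<longlongrightarrow> 0) at_top"
  shows "F s \<le> 0"
proof (rule tendsto_lowerbound[OF l])
  show "\<forall>\<^sub>F t in at_top. F s \<le> \<eta> t"
    using eventually_ge_at_top[of s]
  proof eventually_elim
    case (elim t)
    have "F s \<le> F t" by (rule DERIV_nonneg_imp_nondecreasing[OF elim]) (use d in auto)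
    with b[OF elim] show ?case by simp
  qed
qed simp

text \<open>Here \<open>q\<close> is the normalised energy profile and \<open>\<eta>\<close> is a function that falls from \<open>1\<close> to \<open>0\<close> no faster
  than \<open>q\<close> allows; it replaces the statement that \<open>q\<close> has integral at least \<open>1\<close> and avoids improper
  integrals. The number \<open>D\<close> in the proof plays the role of a typical frequency divided by \<open>k\<close>.\<close>

lemma spectral_profile_bound:
  fixes q q' \<eta> \<eta>' :: "real \<Rightarrow> real" and \<alpha> R Z :: real
  assumes \<alpha>: "0 < \<alpha>" "\<alpha> \<le> 1/2" and R: "R > 0"
    and qpos: "\<And>t. q t > 0"
    and dq: "\<And>t. (q has_real_derivative q' t) (at t)"
    and sup_bound: "\<And>t. t > 0 \<Longrightarrow> q t \<le> R powr (1 - \<alpha>) * (2 * t) powr (- \<alpha>)"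
    and lsi: "\<And>t. t \<ge> 0 \<Longrightarrow> 2 * \<alpha> / (1 - \<alpha>) * Z \<le> - (2 * \<alpha> / (1 - \<alpha>)) * (q' t / q t) - ln (q t) - t"
    and gap: "\<And>t. t \<ge> 0 \<Longrightarrow> q' t \<le> - q t"
    and d\<eta>: "\<And>t. (\<eta> has_real_derivative \<eta>' t) (at t)"
    and \<eta>q: "\<And>t. t \<ge> 0 \<Longrightarrow> - \<eta>' t \<le> q t"
    and \<eta>0: "\<eta> 0 = 1" and \<eta>lim: "(\<eta> \<longlongrightarrow> 0) at_top"
  shows "2 * \<alpha> / (1 - \<alpha>) * Z + ln R \<le>
     R * (2 * \<alpha> / (1 - \<alpha>) * ((1 - \<alpha>) * (2 * \<alpha>) powr \<alpha>) powr (- 1 / (1 - \<alpha>)) + 1 / exp 1)"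
proof -
  define \<gamma> where "\<gamma> = 1 - \<alpha>"
  define a where "a = 2 * \<alpha> / \<gamma>"
  define m where "m = \<gamma> * (2 * \<alpha>) powr \<alpha>"
  define n where "n = (- ln (1 - \<alpha>) - \<alpha> * ln (2 * \<alpha>)) / (1 - \<alpha>)"
  define D where "D = R * m powr (- 1 / \<gamma>)"
  have \<gamma>: "\<gamma> > 0" "\<gamma> < 1" using \<alpha> by (auto simp: \<gamma>_def)
  have a: "a > 0" using \<alpha> \<gamma> by (simp add: a_def)
  have m: "m > 0" using \<alpha> \<gamma> by (simp add: m_def)
  have Dpos: "D > 0" using R m by (simp add: D_def)
  have lnm: "ln m = ln (1 - \<alpha>) + \<alpha> * ln (2 * \<alpha>)"
    using \<alpha> \<gamma> unfolding m_def by (simp add: ln_mult ln_powr \<gamma>_def)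
  have lnD: "ln D = ln R + n"
    using R m \<gamma> unfolding D_def by (simp add: ln_mult ln_powr lnm n_def \<gamma>_def field_simps)
  have RD: "R powr \<gamma> = m * D powr \<gamma>"
  proof -
    have "D powr \<gamma> = R powr \<gamma> * m powr (- 1 / \<gamma> * \<gamma>)"
      using R m by (simp add: D_def powr_mult powr_powr)
    then show ?thesis using m \<gamma> by (simp add: powr_minus field_simps)
  qed

  \<comment> \<open>Mass before time \<open>s\<close>: integrate the bound of \<open>sup_bound\<close>.\<close>
  have head: "1 - \<eta> s \<le> R powr \<gamma> * 2 powr (- \<alpha>) * s powr \<gamma> / \<gamma>" if s: "s \<ge> 0" for s
  proof -
    define F where "F = (\<lambda>t. R powr \<gamma> * 2 powr (- \<alpha>) * t powr \<gamma> / \<gamma> + \<eta> t)"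
    have "F 0 \<le> F s"
    proof (rule DERIV_nonneg_imp_increasing_open[where f = F, OF s])
      show "continuous_on {0..s} F"
        unfolding F_def using \<gamma> d\<eta>
        by (intro continuous_on_add continuous_on_divide continuous_on_mult continuous_on_powr'
            continuous_on_const continuous_on_id continuous_at_imp_continuous_on ballI)
          (auto intro: DERIV_isCont)
      fix t assume t: "0 < t" "t < s"
      have "(F has_real_derivative R powr \<gamma> * 2 powr (- \<alpha>) * t powr (\<gamma> - 1) + \<eta>' t) (at t)"
        unfolding F_def using t \<gamma> by (auto intro!: derivative_eq_intros d\<eta>)
      moreover have pw: "R powr \<gamma> * (2 * t) powr (- \<alpha>) = R powr \<gamma> * 2 powr (- \<alpha>) * t powr (\<gamma> - 1)"
        using t by (simp add: powr_mult \<gamma>_def)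
      have "q t \<le> R powr \<gamma> * 2 powr (- \<alpha>) * t powr (\<gamma> - 1)"
        using sup_bound[of t] t unfolding pw[symmetric] by (simp add: \<gamma>_def)
      then have "R powr \<gamma> * 2 powr (- \<alpha>) * t powr (\<gamma> - 1) + \<eta>' t \<ge> 0"
        using \<eta>q[of t] t by linarith
      ultimately show "\<exists>y. (F has_real_derivative y) (at t) \<and> 0 \<le> y" by blast
    qed
    then show ?thesis using \<gamma> by (simp add: F_def \<eta>0)
  qed

  \<comment> \<open>Mass after time \<open>s\<close>, from the spectral gap alone: \<open>q * exp t\<close> is nonincreasing.\<close>
  have tail: "\<eta> s \<le> q s" if s: "s \<ge> 0" for s
  proof -
    have "\<eta> s - q s \<le> 0"
    proof (rule nondecreasing_to_zero_le[where F = "\<lambda>t. \<eta> t - q t" and s = s, OF _ _ \<eta>lim])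
      fix t assume t: "t \<ge> s"
      have "((\<lambda>t. \<eta> t - q t) has_real_derivative \<eta>' t - q' t) (at t)"
        by (intro derivative_intros d\<eta> dq)
      moreover have "\<eta>' t - q' t \<ge> 0" using \<eta>q[of t] gap[of t] s t by simp
      ultimately show "\<exists>y. ((\<lambda>t. \<eta> t - q t) has_real_derivative y) (at t) \<and> 0 \<le> y" by blast
      show "\<eta> t - q t \<le> \<eta> t" using qpos[of t] by simp
    qed
    then show ?thesis by simp
  qed

  \<comment> \<open>The time \<open>\<alpha>\<close> minimises the sum of the two mass bounds.\<close>
  have D1: "D \<ge> 1"
  proof -
    have "1 \<le> R powr \<gamma> * 2 powr (- \<alpha>) * \<alpha> powr \<gamma> / \<gamma> + R powr \<gamma> * (2 * \<alpha>) powr (- \<alpha>)"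
      using head[of \<alpha>] tail[of \<alpha>] sup_bound[of \<alpha>] \<alpha> by (simp add: \<gamma>_def)
    also have "\<alpha> powr \<gamma> = \<alpha> powr (- \<alpha>) * \<alpha>" using \<alpha> by (simp add: \<gamma>_def powr_diff powr_minus field_simps)
    also have "R powr \<gamma> * 2 powr (- \<alpha>) * (\<alpha> powr (- \<alpha>) * \<alpha>) / \<gamma> + R powr \<gamma> * (2 * \<alpha>) powr (- \<alpha>)
      = R powr \<gamma> * (2 * \<alpha>) powr (- \<alpha>) * (\<alpha> / \<gamma> + 1)"
      using \<alpha> by (simp add: powr_mult field_simps)
    also have "\<alpha> / \<gamma> + 1 = 1 / \<gamma>" using \<gamma> by (simp add: \<gamma>_def field_simps)
    also have "R powr \<gamma> * (2 * \<alpha>) powr (- \<alpha>) * (1 / \<gamma>) = R powr \<gamma> / m"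
      using \<alpha> by (simp add: m_def powr_minus field_simps)
    also have "\<dots> = D powr \<gamma>" using m by (simp add: RD)
    finally have "1 \<le> D powr \<gamma>" .
    then have "1 powr \<gamma> \<le> D powr \<gamma>" by simp
    then show ?thesis using \<gamma> Dpos powr_less_mono2[of \<gamma> D 1] by force
  qed

  define g where "g = ln D"
  have g: "g \<ge> 0" "exp g = D" using D1 Dpos by (auto simp: g_def)
  \<comment> \<open>At this time the first mass bound equals \<open>\<alpha>\<close>, so mass at least \<open>\<gamma> = 1 - \<alpha>\<close> lies after \<open>s\<close>, while
    \<open>q s \<le> \<gamma> * D\<close>. The tail therefore cannot decay faster than at the average rate \<open>D\<close>.\<close>
  define s where "s = \<alpha> / D"
  have s: "s > 0" using \<alpha> Dpos by (simp add: s_def)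
  have Ds: "D powr \<gamma> * s powr (- \<alpha>) = D * \<alpha> powr (- \<alpha>)"
    using Dpos \<alpha> by (simp add: s_def \<gamma>_def powr_divide powr_minus powr_diff field_simps)
  have qs: "q s \<le> \<gamma> * D"
  proof -
    have "q s \<le> m * D powr \<gamma> * (2 * s) powr (- \<alpha>)" using sup_bound[OF s] by (simp add: RD[unfolded \<gamma>_def] \<gamma>_def)
    also have "\<dots> = m * 2 powr (- \<alpha>) * (D powr \<gamma> * s powr (- \<alpha>))" using s by (simp add: powr_mult)
    also have "\<dots> = \<gamma> * D" using \<alpha> unfolding Ds m_def by (simp add: powr_mult powr_minus field_simps)
    finally show ?thesis .
  qed
  have \<eta>s: "\<eta> s \<ge> \<gamma>"
  proof -
    have "s powr \<gamma> = s powr (- \<alpha>) * s" using s by (simp add: \<gamma>_def powr_diff powr_minus field_simps)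
    then have "R powr \<gamma> * 2 powr (- \<alpha>) * s powr \<gamma> / \<gamma> = m * 2 powr (- \<alpha>) * (D powr \<gamma> * s powr (- \<alpha>)) * s / \<gamma>"
      by (simp add: RD)
    also have "\<dots> = \<alpha>"
      using \<alpha> \<gamma> Dpos unfolding Ds m_def by (simp add: powr_mult powr_minus s_def field_simps)
    finally show ?thesis using head[of s] s by (simp add: \<gamma>_def)
  qed

  \<comment> \<open>The largest possible value at \<open>s\<close> of the function \<open>u\<close> below, for which the differential inequality
    reads \<open>a * u' + u \<le> 0\<close>.\<close>
  define B where "B = ln (\<gamma> * D) + s + a * (Z - 1)"
  have B_le: "B \<le> kummer_arg_bound \<alpha> g"
  proof (rule ccontr)
    assume "\<not> B \<le> kummer_arg_bound \<alpha> g"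
    then have BB: "B > kummer_arg_bound \<alpha> g" by simp
    have arg_bound_ge: "kummer_arg_bound \<alpha> x \<ge> a * x" if "x \<ge> 0" for x
    proof -
      have "kummer_arg_bound \<alpha> x \<ge> a * (exp x - 1)"
        using kummer_arg_bound_deriv[OF \<alpha> that] unfolding kummer_arg_bound_def a_def \<gamma>_def by fastforce
      moreover have "x \<le> exp x - 1" using exp_ge_add_one_self[of x] by linarith
      then have "a * x \<le> a * (exp x - 1)" using a by (intro mult_left_mono) auto
      ultimately show ?thesis by linarith
    qed
    have "B \<ge> 0" using BB arg_bound_ge[OF g(1)] a g(1) by (smt (verit) mult_nonneg_nonneg)
    have "g \<le> B / a" using BB arg_bound_ge[OF g(1)] a by (simp add: field_simps)
    moreover have "B \<le> kummer_arg_bound \<alpha> (B / a)" using arg_bound_ge[of "B / a"] a \<open>B \<ge> 0\<close> by simp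
    moreover have "\<forall>x. g \<le> x \<and> x \<le> B / a \<longrightarrow> isCont (kummer_arg_bound \<alpha>) x"
      using g(1) kummer_arg_bound_deriv[OF \<alpha>] by (metis DERIV_isCont order_trans)
    \<comment> \<open>If \<open>B\<close> were larger, it would be the bound at some \<open>g' > g\<close>, and then the tail would be smaller than
      \<open>\<gamma>\<close> by the factor \<open>exp (g - g')\<close>.\<close>
    ultimately obtain g' where g': "g \<le> g'" "kummer_arg_bound \<alpha> g' = B"
      using IVT[of "kummer_arg_bound \<alpha>" g B "B / a"] BB by auto
    with BB have "g < g'" by (cases "g = g'") auto
    define K where "K = exp (- s - a * (Z - 1))"
    define u where "u = (\<lambda>t. ln (q t) + t + a * (Z - 1))"
    have u_decay: "u (s + \<tau>) \<le> B * exp (- \<tau> / a)" if \<tau>: "\<tau> \<ge> 0" for \<tau>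
    proof -
      define w where "w = (\<lambda>t. u t * exp (t / a))"
      have "w (s + \<tau>) \<le> w s"
      proof (rule DERIV_nonpos_imp_nonincreasing[where f = w])
        show "s \<le> s + \<tau>" using \<tau> by simp
        fix t assume t: "s \<le> t" "t \<le> s + \<tau>"
        have "(w has_real_derivative (q' t / q t + 1) * exp (t / a) + u t * (exp (t / a) * (1 / a))) (at t)"
          unfolding w_def u_def using qpos[of t] a by (auto intro!: derivative_eq_intros dq simp: field_simps)
        moreover have "(q' t / q t + 1) * exp (t / a) + u t * (exp (t / a) * (1 / a))
            = exp (t / a) / a * (a * (q' t / q t) + a + u t)"
          using a by (simp add: field_simps)
        moreover have "a * (q' t / q t) + a + u t \<le> 0"
        proof -
          have "a * Z \<le> - a * (q' t / q t) - ln (q t) - t" using lsi[of t] t s by (simp add: a_def \<gamma>_def)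
          moreover have "u t = ln (q t) + t + (a * Z - a)" by (simp add: u_def right_diff_distrib)
          ultimately show ?thesis by simp
        qed
        then have "exp (t / a) / a * (a * (q' t / q t) + a + u t) \<le> 0"
          using a by (intro mult_nonneg_nonpos) auto
        ultimately show "\<exists>y. (w has_real_derivative y) (at t) \<and> y \<le> 0" by metis
      qed
      then have "u (s + \<tau>) * exp (s / a) * exp (\<tau> / a) \<le> u s * exp (s / a)"
        by (simp add: w_def add_divide_distrib exp_add mult.assoc)
      then have "u (s + \<tau>) * exp (\<tau> / a) \<le> u s" by (simp add: mult.commute mult.left_commute)
      then have "u (s + \<tau>) \<le> u s * exp (- \<tau> / a)" by (simp add: exp_minus field_simps)
      moreover have "ln (q s) \<le> ln (\<gamma> * D)" using qs qpos[of s] by (intro ln_mono) auto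
      then have "u s \<le> B" by (simp add: u_def B_def)
      then have "u s * exp (- \<tau> / a) \<le> B * exp (- \<tau> / a)" by (intro mult_right_mono) auto
      ultimately show ?thesis by linarith
    qed
    define Q where "Q = (\<lambda>\<tau>. K * (exp (- \<tau>) * kummer a (B * exp (- \<tau> / a))))"
    have "\<eta> (s + 0) - Q 0 \<le> 0"
    proof (rule nondecreasing_to_zero_le[where s = 0 and F = "\<lambda>\<tau>. \<eta> (s + \<tau>) - Q \<tau>" and \<eta> = "\<lambda>\<tau>. \<eta> (s + \<tau>)"])
      show "((\<lambda>\<tau>. \<eta> (s + \<tau>)) \<longlongrightarrow> 0) at_top"
        by (rule filterlim_compose[OF \<eta>lim]) (rule filterlim_tendsto_add_at_top[OF tendsto_const filterlim_ident])
      fix \<tau> :: real assume \<tau>: "\<tau> \<ge> 0"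
      have "kummer a (B * exp (- \<tau> / a)) \<ge> 0" using a \<open>B \<ge> 0\<close> by (intro kummer_nonneg) auto
      then show "\<eta> (s + \<tau>) - Q \<tau> \<le> \<eta> (s + \<tau>)" by (simp add: Q_def K_def)
      define b where "b = B * exp (- \<tau> / a)"
      obtain J' where J': "(kummer a has_real_derivative J') (at b)" "b * J' = a * exp b - a * kummer a b"
        using kummer_deriv[OF a] by blast
      have db: "((\<lambda>\<tau>. B * exp (- \<tau> / a)) has_real_derivative - b / a) (at \<tau>)"
        unfolding b_def using a by (auto intro!: derivative_eq_intros simp: field_simps)
      have dJ: "((\<lambda>\<tau>. kummer a (B * exp (- \<tau> / a))) has_real_derivative J' * (- b / a)) (at \<tau>)"
        using DERIV_chain2[OF J'(1)[unfolded b_def] db] by simp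
      have "(Q has_real_derivative K * (- exp (- \<tau>) * kummer a b + exp (- \<tau>) * (J' * (- b / a)))) (at \<tau>)"
      proof -
        have dE: "((\<lambda>\<tau>::real. exp (- \<tau>)) has_real_derivative - exp (- \<tau>)) (at \<tau>)"
          by (auto intro!: derivative_eq_intros)
        show ?thesis
          using DERIV_cmult[OF DERIV_mult[OF dE dJ], of K] unfolding Q_def b_def[symmetric]
          by (simp add: mult.commute)
      qed
      moreover have "- exp (- \<tau>) * kummer a b + exp (- \<tau>) * (J' * (- b / a)) = - exp (- \<tau>) * exp b"
      proof -
        have "J' * (- b / a) = - (b * J') / a" by simp
        also have "\<dots> = kummer a b - exp b" unfolding J'(2) using a by (simp add: field_simps)
        finally show ?thesis by (simp add: algebra_simps)
      qed
      ultimately have dQ: "(Q has_real_derivative - (K * exp (- \<tau>) * exp b)) (at \<tau>)" by (simp add: mult.assoc)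
      have "((\<lambda>\<tau>. \<eta> (s + \<tau>)) has_real_derivative \<eta>' (s + \<tau>) * 1) (at \<tau>)"
        by (rule DERIV_chain2[OF d\<eta>]) (auto intro!: derivative_eq_intros)
      then have "((\<lambda>\<tau>. \<eta> (s + \<tau>) - Q \<tau>) has_real_derivative \<eta>' (s + \<tau>) * 1 - - (K * exp (- \<tau>) * exp b)) (at \<tau>)"
        by (intro DERIV_diff dQ)
      moreover have "q (s + \<tau>) \<le> K * exp (- \<tau>) * exp b"
      proof -
        have "q (s + \<tau>) = exp (u (s + \<tau>) - (s + \<tau>) - a * (Z - 1))"
          using qpos[of "s + \<tau>"] by (simp add: u_def)
        also have "\<dots> \<le> exp (b - (s + \<tau>) - a * (Z - 1))" using u_decay[OF \<tau>] by (simp add: b_def)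
        also have "\<dots> = K * exp (- \<tau>) * exp b" by (simp add: K_def algebra_simps flip: exp_add)
        finally show ?thesis .
      qed
      then have "\<eta>' (s + \<tau>) * 1 - - (K * exp (- \<tau>) * exp b) \<ge> 0"
        using \<eta>q[of "s + \<tau>"] s \<tau> by simp
      ultimately show "\<exists>y. ((\<lambda>\<tau>. \<eta> (s + \<tau>) - Q \<tau>) has_real_derivative y) (at \<tau>) \<and> 0 \<le> y" by blast
    qed
    then have "\<gamma> \<le> K * kummer a B" using \<eta>s by (simp add: Q_def)
    moreover have "K = \<gamma> * D * exp (- B)"
      using \<gamma> Dpos by (simp add: K_def B_def exp_add exp_diff exp_minus field_simps)
    ultimately have "\<gamma> * 1 \<le> \<gamma> * (D * (exp (- B) * kummer a B))" by (simp add: mult.assoc)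
    then have "1 \<le> D * (exp (- B) * kummer a B)" using \<gamma> by simp
    also have "exp (- B) * kummer a B \<le> exp (- g')"
      using kummer_at_bound_le[OF \<alpha>, of g'] g g' by (simp add: a_def \<gamma>_def)
    then have "D * (exp (- B) * kummer a B) \<le> D * exp (- g')" using Dpos by (intro mult_left_mono) auto
    also have "\<dots> = exp (g - g')" by (simp add: exp_diff exp_minus g divide_inverse)
    finally show False using \<open>g < g'\<close> by simp
  qed
  have "ln (\<gamma> * D) = ln (1 - \<alpha>) + g" using \<gamma> Dpos by (simp add: ln_mult g_def \<gamma>_def)
  moreover have "s = \<alpha> * exp (- g)" by (simp add: s_def exp_minus g divide_inverse)
  moreover have "kummer_arg_bound \<alpha> g = a * (D - 1) + (g - \<alpha> * gain \<alpha> g)" by (simp add: kummer_arg_bound_def a_def \<gamma>_def g)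
  ultimately have "a * Z \<le> a * D - \<alpha> * gain \<alpha> g - ln (1 - \<alpha>) - \<alpha> * exp (- g)"
    using B_le by (simp add: B_def algebra_simps)
  moreover have "ln R - ln (1 - \<alpha>) - \<alpha> * exp (- g) - \<alpha> * gain \<alpha> g \<le> R / exp 1"
    by (rule ln_le_of_gain[OF \<alpha> R n_def _ g(1)]) (simp add: g_def lnD)
  ultimately have "a * Z + ln R \<le> a * D + R / exp 1" by linarith
  also have "\<dots> = R * (a * m powr (- 1 / \<gamma>) + 1 / exp 1)" by (simp add: D_def algebra_simps)
  finally show ?thesis by (simp add: a_def m_def \<gamma>_def)
qed

section \<open>The constants M and C\<close>

text \<open>This compares \<open>M p\<close> with the constant that \<open>spectral_profile_bound\<close> yields. For \<open>x \<le> 3/2\<close> the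
  right-hand side is at least \<open>x * exp (- x / e)\<close>, its minimum over all \<open>\<alpha> > 0\<close>; for larger \<open>x\<close> it
  decreases in \<open>\<alpha> \<le> 1/2\<close>, so it is at least \<open>sqrt (x / 2)\<close>.\<close>

lemma one_minus_exp_le_powr:
  fixes \<alpha> x :: real
  assumes \<alpha>: "0 < \<alpha>" "\<alpha> \<le> 1/2" and x: "x > 0"
  shows "1 - exp (- x) \<le> \<alpha> powr \<alpha> * x powr (1 - \<alpha>)"
proof -
  have eq: "\<alpha> powr \<alpha> * x powr (1 - \<alpha>) = exp (\<alpha> * ln \<alpha> + (1 - \<alpha>) * ln x)"
    using \<alpha> x by (simp add: powr_def exp_add)
  show ?thesis
  proof (cases "x \<le> 3/2")
    case True
    have e: "exp 1 \<ge> (8/3 :: real)" using exp_ge_Taylor[of 1 4] by (simp add: numeral_eq_Suc fact_numeral)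
    have "ln (x / (\<alpha> * exp 1)) \<le> x / (\<alpha> * exp 1) - 1" using \<alpha> x by (intro ln_le_minus_one) auto
    then have "ln x - ln \<alpha> \<le> x / (\<alpha> * exp 1)" using \<alpha> x by (simp add: ln_div ln_mult)
    then have "\<alpha> * (ln x - ln \<alpha>) \<le> \<alpha> * (x / (\<alpha> * exp 1))" using \<alpha> by (intro mult_left_mono) auto
    also have "\<dots> = x / exp 1" using \<alpha> by simp
    also have "\<dots> \<le> x / (8/3)" using e x by (intro divide_left_mono) auto
    finally have "\<alpha> * ln \<alpha> + (1 - \<alpha>) * ln x \<ge> ln x - 3/8 * x" by (simp add: algebra_simps)
    then have "exp (ln x - 3/8 * x) \<le> exp (\<alpha> * ln \<alpha> + (1 - \<alpha>) * ln x)" by simp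
    also have "exp (ln x - 3/8 * x) = exp (ln x) * exp (- (3/8 * x))" by (simp flip: exp_add)
    also have "\<dots> = x * exp (- (3/8 * x))" using x by simp
    finally have 1: "x * exp (- (3/8 * x)) \<le> \<alpha> powr \<alpha> * x powr (1 - \<alpha>)" using eq by simp
    have "x * exp (- (3/8 * x)) - 1 + exp (- x) \<ge> 0"
    proof (rule nonneg_of_deriv_nonneg[where x = x and F = "\<lambda>x. x * exp (- (3/8 * x)) - 1 + exp (- x)"
          and F' = "\<lambda>x. exp (- (3/8 * x)) * ((1 - 3/8 * x) - exp (- (5/8 * x)))"])
      fix t :: real assume t: "0 \<le> t" "t \<le> x"
      have "((\<lambda>x. x * exp (- (3/8 * x)) - 1 + exp (- x)) has_real_derivative
         exp (- (3/8 * t)) * (1 - 3/8 * t) - exp (- t)) (at t)"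
        by (rule derivative_eq_intros refl)+ (simp add: right_diff_distrib)
      moreover have "exp (- (3/8 * t)) * exp (- (5/8 * t)) = exp (- t)" by (simp flip: exp_add)
      ultimately show "((\<lambda>x. x * exp (- (3/8 * x)) - 1 + exp (- x)) has_real_derivative
         exp (- (3/8 * t)) * ((1 - 3/8 * t) - exp (- (5/8 * t)))) (at t)"
        by (simp only: right_diff_distrib)
      define y where "y = 5/8 * t"
      have y: "0 \<le> y" "y \<le> 1" using t True by (auto simp: y_def)
      have "(1 - 3/5 * y) * (1 + y + y^2/2) = 1 + y * (4/10 - 1/10 * y - 3/10 * y^2)"
        by (simp add: field_simps power2_eq_square)
      moreover have "y^2 \<le> 1" using y by (simp add: power_le_one)
      then have "4/10 - 1/10 * y - 3/10 * y^2 \<ge> 0" using y by linarith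
      then have "y * (4/10 - 1/10 * y - 3/10 * y^2) \<ge> 0" using y by simp
      ultimately have "1 \<le> (1 - 3/5 * y) * (1 + y + y^2/2)" by linarith
      also have "\<dots> \<le> (1 - 3/5 * y) * exp y"
        using y exp_lower_Taylor_quadratic[of y] by (intro mult_left_mono) auto
      finally have "exp (- y) \<le> 1 - 3/5 * y" by (simp add: exp_minus field_simps)
      then show "exp (- (3/8 * t)) * ((1 - 3/8 * t) - exp (- (5/8 * t))) \<ge> 0" by (simp add: y_def)
    qed (use x in auto)
    with 1 show ?thesis by linarith
  next
    case False
    have e3: "exp 1 \<le> 2 * x" using exp_le False by linarith
    then have "ln (2 * x) \<ge> 1" using x by (simp add: ln_ge_iff)
    then have 0: "(1/2 - \<alpha>) * (ln (2 * x) - 1) \<ge> 0" using \<alpha> by simp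
    have "ln (1 / (2 * \<alpha>)) \<le> 1 / (2 * \<alpha>) - 1" using \<alpha> by (intro ln_le_minus_one) auto
    then have "- ln (2 * \<alpha>) \<le> 1 / (2 * \<alpha>) - 1" using \<alpha> by (simp add: ln_div)
    then have "\<alpha> * (- ln (2 * \<alpha>)) \<le> \<alpha> * (1 / (2 * \<alpha>) - 1)" using \<alpha> by (intro mult_left_mono) auto
    also have "\<dots> = 1/2 - \<alpha>" using \<alpha> by (simp add: field_simps)
    finally have "\<alpha> * ln \<alpha> + (1 - \<alpha>) * ln x \<ge> 1/2 * ln (x / 2)"
      using 0 \<alpha> x by (simp add: ln_mult ln_div algebra_simps)
    then have "exp (1/2 * ln (x / 2)) \<le> \<alpha> powr \<alpha> * x powr (1 - \<alpha>)" unfolding eq by simp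
    moreover have "exp (1/2 * ln (x / 2)) = sqrt (x / 2)" using x by (simp add: powr_def flip: powr_half_sqrt)
    moreover have "1 - exp (- x) \<le> sqrt (x / 2)"
    proof (rule real_le_rsqrt)
      have k: "exp (- (real k / 8)) \<ge> (7/8)^k" for k
      proof -
        have "exp (- (1/8)) \<ge> (7/8 :: real)" using exp_ge_add_one_self[of "- (1/8) :: real"] by simp
        then have "(7/8)^k \<le> exp (- (1/8) :: real) ^ k" by (intro power_mono) auto
        also have "\<dots> = exp (- (real k / 8))" by (simp flip: exp_of_nat_mult)
        finally show ?thesis .
      qed
      have mono: "(1 - exp (- x))\<^sup>2 \<le> (1 - exp (- y))\<^sup>2" if "x \<le> y" for y
        using that x by (intro power_mono) auto
      consider "x \<le> 7/4" | "7/4 < x" "x \<le> 2" | "x > 2" by linarith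
      then show "(1 - exp (- x))\<^sup>2 \<le> x / 2"
      proof cases
        case 1
        have "exp (- (7/4 :: real)) \<ge> (7/8)^14" using k[of 14] by simp
        then have "1 - exp (- (7/4 :: real)) \<le> 1 - (7/8)^14" by simp
        then have "(1 - exp (- (7/4 :: real)))\<^sup>2 \<le> (1 - (7/8)^14)\<^sup>2" by (intro power_mono) auto
        also have "\<dots> \<le> (3/4 :: real)" by (simp add: power_divide power2_eq_square)
        finally show ?thesis using mono[OF 1] False by linarith
      next
        case 2
        have "exp (- (2 :: real)) \<ge> (7/8)^16" using k[of 16] by simp
        then have "1 - exp (- (2 :: real)) \<le> 1 - (7/8)^16" by simp
        then have "(1 - exp (- (2 :: real)))\<^sup>2 \<le> (1 - (7/8)^16)\<^sup>2" by (intro power_mono) auto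
        also have "\<dots> \<le> (7/8 :: real)" by (simp add: power_divide power2_eq_square)
        finally show ?thesis using mono[OF 2(2)] 2 by linarith
      next
        case 3
        have "(1 - exp (- x))\<^sup>2 \<le> 1" using x by (intro power_le_one) auto
        then show ?thesis using 3 by linarith
      qed
    qed
    ultimately show ?thesis by linarith
  qed
qed

text \<open>The quotient is at most \<open>x powr (1 - \<gamma>)\<close> and at most \<open>x powr (- \<gamma>)\<close>, so outside a compact interval
  of positive numbers it stays below its value at \<open>1\<close>.\<close>

lemma Max_ratio_attained:
  fixes \<gamma> :: real
  assumes \<gamma>: "0 < \<gamma>" "\<gamma> < 1"
  obtains x where "x > 0"
    "(GREATEST y. \<exists>x\<ge>0. y = (1 - exp (- x)) / x powr \<gamma>) = (1 - exp (- x)) / x powr \<gamma>"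
    "(1 - exp (- x)) / x powr \<gamma> \<ge> 1 - exp (- 1)"
proof -
  define \<phi> where "\<phi> = (\<lambda>x::real. (1 - exp (- x)) / x powr \<gamma>)"
  define v :: real where "v = 1 - exp (- 1)"
  have v: "0 < v" "v < 1" by (auto simp: v_def)
  define lo where "lo = v powr (1 / (1 - \<gamma>))"
  define hi where "hi = (1 / v) powr (1 / \<gamma>)"
  have lo: "0 < lo" "lo \<le> 1" using v \<gamma> by (auto simp: lo_def intro!: powr_le1)
  have hi: "hi \<ge> 1" using v \<gamma> by (auto simp: hi_def intro!: ge_one_powr_ge_zero)
  have "continuous_on {lo..hi} \<phi>"
    unfolding \<phi>_def using lo by (intro continuous_intros) auto
  then obtain x where x: "x \<in> {lo..hi}" "\<And>y. y \<in> {lo..hi} \<Longrightarrow> \<phi> y \<le> \<phi> x"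
    using continuous_attains_sup[of "{lo..hi}" \<phi>] lo hi by auto
  have v\<phi>: "v \<le> \<phi> x" using x(2)[of 1] lo hi by (simp add: \<phi>_def v_def)
  have le: "\<phi> y \<le> \<phi> x" if y: "y \<ge> 0" for y
  proof -
    consider "y = 0" | "0 < y" "y < lo" | "lo \<le> y" "y \<le> hi" | "y > hi" using y by linarith
    then show ?thesis
    proof cases
      case 1
      then show ?thesis using v v\<phi> by (simp add: \<phi>_def)
    next
      case 2
      have "1 - exp (- y) \<le> y" using exp_ge_add_one_self[of "- y"] by linarith
      then have "\<phi> y \<le> y / y powr \<gamma>" unfolding \<phi>_def by (intro divide_right_mono) auto
      also have "\<dots> = y powr (1 - \<gamma>)" using 2 by (simp add: powr_diff)
      also have "\<dots> \<le> lo powr (1 - \<gamma>)" using 2 \<gamma> by (intro powr_mono2) auto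
      also have "\<dots> = v" using v \<gamma> by (simp add: lo_def powr_powr)
      finally show ?thesis using v\<phi> by simp
    next
      case 3
      then show ?thesis by (intro x(2)) simp
    next
      case 4
      have "y powr \<gamma> \<ge> hi powr \<gamma>" using 4 hi \<gamma> by (intro powr_mono2) auto
      moreover have "hi powr \<gamma> = 1 / v" using v \<gamma> by (simp add: hi_def powr_powr)
      ultimately have "1 / y powr \<gamma> \<le> 1 / (1 / v)"
        using v 4 hi by (intro divide_left_mono mult_pos_pos) auto
      moreover have "\<phi> y \<le> 1 / y powr \<gamma>" unfolding \<phi>_def using 4 hi by (intro divide_right_mono) auto
      ultimately show ?thesis using v\<phi> by simp
    qed
  qed
  have "(GREATEST y. \<exists>x\<ge>0. y = \<phi> x) = \<phi> x"
  proof (rule Greatest_equality)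
    show "\<exists>y\<ge>0. \<phi> x = \<phi> y" using x(1) lo by (intro exI[of _ x]) auto
  qed (use le in auto)
  then show ?thesis using that[of x] x(1) lo v\<phi> by (auto simp: \<phi>_def v_def)
qed

lemma M_bounds:
  assumes p: "1 \<le> p" "p < 2"
  defines "\<alpha> \<equiv> 1 - p / 2"
  shows "M p \<le> (1 - \<alpha>) * (2 * \<alpha>) powr \<alpha>" "M p \<ge> 1/4"
proof -
  have \<alpha>: "0 < \<alpha>" "\<alpha> \<le> 1/2" "p / 2 = 1 - \<alpha>" using p by (auto simp: \<alpha>_def)
  obtain x where x: "x > 0"
    "(GREATEST y. \<exists>x\<ge>0. y = (1 - exp (- x)) / x powr (p / 2)) = (1 - exp (- x)) / x powr (p / 2)"
    "(1 - exp (- x)) / x powr (p / 2) \<ge> 1 - exp (- 1)"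
    using Max_ratio_attained[of "p / 2"] p by auto
  have M: "M p = p * 2 powr (- p / 2) * ((1 - exp (- x)) / x powr (p / 2))" by (simp add: M_def x(2))
  have pos: "p * 2 powr (- p / 2) \<ge> 0" using p by simp
  have "(1 - exp (- x)) / x powr (p / 2) \<le> \<alpha> powr \<alpha>"
    using one_minus_exp_le_powr[OF \<alpha>(1,2) x(1)] x(1) unfolding \<alpha>(3) by (simp add: field_simps)
  then have "M p \<le> p * 2 powr (- p / 2) * \<alpha> powr \<alpha>" unfolding M using pos by (intro mult_left_mono)
  also have "\<dots> = (1 - \<alpha>) * (2 * \<alpha>) powr \<alpha>"
  proof -
    have p2: "p = 2 * (1 - \<alpha>)" by (simp add: \<alpha>_def)
    have "2 powr (- p / 2) = 2 powr (\<alpha> - 1)" by (simp add: \<alpha>_def)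
    also have "\<dots> = 2 powr \<alpha> / 2" by (simp add: powr_diff)
    finally have "2 powr (- p / 2) = 2 powr \<alpha> / 2" .
    then have "p * 2 powr (- p / 2) * \<alpha> powr \<alpha> = p / 2 * (2 powr \<alpha> * \<alpha> powr \<alpha>)" by simp
    also have "p / 2 = 1 - \<alpha>" by (rule \<alpha>(3))
    also have "2 powr \<alpha> * \<alpha> powr \<alpha> = (2 * \<alpha>) powr \<alpha>" using \<alpha> by (simp add: powr_mult)
    finally show ?thesis .
  qed
  finally show "M p \<le> (1 - \<alpha>) * (2 * \<alpha>) powr \<alpha>" .
  have "2 powr (- 1) \<le> 2 powr (- p / 2)" using p by (intro powr_mono) auto
  then have "1 * (1/2) \<le> p * 2 powr (- p / 2)" using p by (intro mult_mono) (auto simp: powr_minus)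
  moreover have "exp 1 \<ge> (2 :: real)" using exp_ge_add_one_self[of 1] by simp
  then have "1/2 \<le> 1 - exp (- 1 :: real)" by (simp add: exp_minus field_simps)
  then have "1/2 \<le> (1 - exp (- x)) / x powr (p / 2)" using x(3) by linarith
  ultimately have "1/2 * (1/2) \<le> p * 2 powr (- p / 2) * ((1 - exp (- x)) / x powr (p / 2))"
    by (intro mult_mono) auto
  then show "M p \<ge> 1/4" by (simp add: M)
qed

text \<open>Near \<open>p = 2\<close> the summand \<open>p / (2 e (2 - p))\<close> dominates, and it enters with an exponent of absolute value
  at most \<open>1\<close>.\<close>

lemma C_ge_linear:
  assumes p: "1 \<le> p" "p < 2"
  shows "C p \<ge> 1/17 * (2 - p)"
proof -
  have M: "M p \<ge> 1/4" by (rule M_bounds) (use p in auto)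
  have "M p powr (- 2 / p) \<le> (1/4) powr (- 2 / p)" using M p by (intro powr_mono2') auto
  also have "\<dots> = 4 powr (2 / p)" by (simp add: powr_divide powr_minus divide_simps)
  also have "\<dots> \<le> 4 powr 2" using p by (intro powr_mono) (auto simp: field_simps)
  also have "\<dots> = (16 :: real)" by simp
  finally have 1: "M p powr (- 2 / p) \<le> 16" .
  have "exp 1 \<ge> (1 :: real)" by simp
  have "p / (2 * exp 1 * (2 - p)) \<le> 1 / (2 - p)"
  proof -
    have "p * 1 \<le> 2 * exp 1" using p \<open>exp 1 \<ge> 1\<close> by (intro mult_mono) auto
    then show ?thesis using p by (simp add: divide_simps)
  qed
  moreover have "16 \<le> 16 / (2 - p)" using p by (simp add: field_simps)
  moreover have "17 / (2 - p) = 16 / (2 - p) + 1 / (2 - p)" by (simp add: add_divide_distrib [symmetric])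
  ultimately have S: "M p powr (- 2 / p) + p / (2 * exp 1 * (2 - p)) \<le> 17 / (2 - p)"
    using 1 by linarith
  have pos: "M p powr (- 2 / p) + p / (2 * exp 1 * (2 - p)) > 0" using M p by (intro add_pos_pos) auto
  have "1/17 * (2 - p) = ((2 - p) / 17) powr 1" using p by simp
  also have "\<dots> \<le> ((2 - p) / 17) powr (p / 2)" using p by (intro powr_mono') auto
  also have "\<dots> = (17 / (2 - p)) powr (- p / 2)" using p by (simp add: powr_divide powr_minus field_simps)
  also have "\<dots> \<le> C p" unfolding C_def using S pos p by (intro powr_mono2') auto
  finally show ?thesis .
qed

section \<open>The logarithmic Sobolev inequality on the cube\<close>

text \<open>The second derivative of the difference is nonnegative, because
  \<open>ln ((1 + s) * (1 - s)) \<le> ln (1 + s\<^sup>2)\<close>.\<close>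

lemma two_point_aux:
  fixes x :: real
  assumes x: "0 \<le> x" "x < 1"
  shows "(1 + x)\<^sup>2 * ln (1 + x) + (1 - x)\<^sup>2 * ln (1 - x) - (1 + x\<^sup>2) * ln (1 + x\<^sup>2) \<le> 2 * x\<^sup>2"
proof -
  define G1 where "G1 = (\<lambda>x::real. 4 * x - 2 * ((1 + x) * ln (1 + x) - (1 - x) * ln (1 - x) - x * ln (1 + x\<^sup>2)))"
  have pos: "1 + t\<^sup>2 > 0" for t :: real by (simp add: add_pos_nonneg)
  have G1: "G1 t \<ge> 0" if t: "0 \<le> t" "t \<le> x" for t
  proof (rule nonneg_of_deriv_nonneg[where F = G1 and x = t
        and F' = "\<lambda>x. 2 * (ln (1 + x\<^sup>2) - ln (1 + x) - ln (1 - x)) + 4 * x\<^sup>2 / (1 + x\<^sup>2)"])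
    fix s :: real assume s: "0 \<le> s" "s \<le> t"
    show "(G1 has_real_derivative 2 * (ln (1 + s\<^sup>2) - ln (1 + s) - ln (1 - s)) + 4 * s\<^sup>2 / (1 + s\<^sup>2)) (at s)"
      unfolding G1_def using s t x pos[of s]
      by (auto intro!: derivative_eq_intros simp: power2_eq_square)
    have "ln (1 + s) + ln (1 - s) = ln ((1 + s) * (1 - s))" using s t x by (simp add: ln_mult)
    also have "\<dots> \<le> ln (1 + s\<^sup>2)"
    proof (rule ln_mono)
      show "(1 + s) * (1 - s) \<le> 1 + s\<^sup>2" by (simp add: algebra_simps power2_eq_square)
      show "(1 + s) * (1 - s) > 0" using s t x by simp
    qed
    finally show "2 * (ln (1 + s\<^sup>2) - ln (1 + s) - ln (1 - s)) + 4 * s\<^sup>2 / (1 + s\<^sup>2) \<ge> 0" by simp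
  qed (use t in \<open>auto simp: G1_def\<close>)
  have "2 * x\<^sup>2 - ((1 + x)\<^sup>2 * ln (1 + x) + (1 - x)\<^sup>2 * ln (1 - x) - (1 + x\<^sup>2) * ln (1 + x\<^sup>2)) \<ge> 0"
  proof (rule nonneg_of_deriv_nonneg[where F' = G1 and x = x and
        F = "\<lambda>x. 2 * x\<^sup>2 - ((1 + x)\<^sup>2 * ln (1 + x) + (1 - x)\<^sup>2 * ln (1 - x) - (1 + x\<^sup>2) * ln (1 + x\<^sup>2))"])
    fix t assume t: "0 \<le> t" "t \<le> x"
    have s1: "(1 + t)\<^sup>2 / (1 + t) = 1 + t" "(1 - t)\<^sup>2 / (1 - t) = 1 - t" using t x
      by (auto simp: power2_eq_square)
    have "((\<lambda>x. 2 * x\<^sup>2 - ((1 + x)\<^sup>2 * ln (1 + x) + (1 - x)\<^sup>2 * ln (1 - x) - (1 + x\<^sup>2) * ln (1 + x\<^sup>2)))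
       has_real_derivative 4 * t - ((2 * (1 + t) * ln (1 + t) + (1 + t)\<^sup>2 / (1 + t)) + (- 2 * (1 - t) * ln (1 - t) - (1 - t)\<^sup>2 / (1 - t))
          - (2 * t * ln (1 + t\<^sup>2) + (1 + t\<^sup>2) * (2 * t / (1 + t\<^sup>2))))) (at t)"
      using t x pos[of t] by (auto intro!: derivative_eq_intros)
    moreover have "(1 + t\<^sup>2) * (2 * t / (1 + t\<^sup>2)) = 2 * t" using pos[of t] by simp
    ultimately show "((\<lambda>x. 2 * x\<^sup>2 - ((1 + x)\<^sup>2 * ln (1 + x) + (1 - x)\<^sup>2 * ln (1 - x) - (1 + x\<^sup>2) * ln (1 + x\<^sup>2)))
       has_real_derivative G1 t) (at t)"
      unfolding s1 by (simp add: G1_def algebra_simps)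
    show "G1 t \<ge> 0" using G1 t by simp
  qed (use x in auto)
  then show ?thesis by simp
qed

text \<open>By homogeneity one may take \<open>u = 1 + x\<close> and \<open>v = 1 - x\<close>.\<close>

lemma two_point_lsi:
  fixes u v :: real
  assumes "u \<ge> 0" "v \<ge> 0"
  shows "(u\<^sup>2 * ln (u\<^sup>2) + v\<^sup>2 * ln (v\<^sup>2)) / 2 - (u\<^sup>2 + v\<^sup>2) / 2 * ln ((u\<^sup>2 + v\<^sup>2) / 2) \<le> (u - v)\<^sup>2 / 2"
  using assms
proof (induction u v rule: linorder_wlog)
  case (sym a b)
  then show ?case by (simp add: add.commute power2_commute)
next
  case (le v u)
  show ?case
  proof (cases "v = 0")
    case True
    have "u\<^sup>2 * ln 2 \<le> u\<^sup>2 * 1" using ln2_le_25_over_36 by (intro mult_left_mono) auto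
    then show ?thesis using True le by (cases "u = 0") (auto simp: ln_div algebra_simps)
  next
    case False
    define m where "m = (u + v) / 2"
    define x where "x = (u - v) / (u + v)"
    have uv: "u > 0" "v > 0" using False le by auto
    have m: "m > 0" using uv by (simp add: m_def)
    have x: "0 \<le> x" "x < 1" using uv le by (auto simp: x_def field_simps)
    have u: "u = m * (1 + x)" and v: "v = m * (1 - x)" using uv by (auto simp: m_def x_def field_simps)
    have p: "1 + x\<^sup>2 > 0" by (simp add: add_pos_nonneg)
    have s: "(v\<^sup>2 + u\<^sup>2) / 2 = m\<^sup>2 * (1 + x\<^sup>2)" unfolding u v by (simp add: field_simps power2_eq_square)
    have lu: "ln (u\<^sup>2) = 2 * ln m + 2 * ln (1 + x)" unfolding u using m x by (simp add: ln_realpow ln_mult power_mult_distrib)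
    have lv: "ln (v\<^sup>2) = 2 * ln m + 2 * ln (1 - x)" unfolding v using m x by (simp add: ln_realpow ln_mult power_mult_distrib)
    have ls: "ln (m\<^sup>2 * (1 + x\<^sup>2)) = 2 * ln m + ln (1 + x\<^sup>2)" using m p by (simp add: ln_realpow ln_mult)
    have "(v\<^sup>2 * ln (v\<^sup>2) + u\<^sup>2 * ln (u\<^sup>2)) / 2 - (v\<^sup>2 + u\<^sup>2) / 2 * ln ((v\<^sup>2 + u\<^sup>2) / 2)
      = m\<^sup>2 * ((1 + x)\<^sup>2 * ln (1 + x) + (1 - x)\<^sup>2 * ln (1 - x) - (1 + x\<^sup>2) * ln (1 + x\<^sup>2))"
      unfolding s lu lv ls unfolding u v by (simp add: field_simps power2_eq_square)
    also have "\<dots> \<le> m\<^sup>2 * (2 * x\<^sup>2)" by (intro mult_left_mono two_point_aux x) auto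
    also have "\<dots> = (v - u)\<^sup>2 / 2" unfolding u v by (simp add: field_simps power2_eq_square)
    finally show ?thesis .
  qed
qed

definition cube_mean :: "nat \<Rightarrow> ((nat \<Rightarrow> real) \<Rightarrow> real) \<Rightarrow> real" where
  "cube_mean n g = (\<Sum>x\<in>cube n. g x) / 2 ^ n"

lemma finite_cube [simp]: "finite (cube n)"
  by (simp add: cube_def finite_PiE)

lemma card_cube: "card (cube n) = 2 ^ n"
proof -
  have "card {-1, 1 :: real} = 2" by simp
  then show ?thesis by (simp only: cube_def card_PiE finite_atLeastAtMost prod_constant card_atLeastAtMost) simp
qed

lemma integral_cube: "(LINT x|cube_measure n. g x) = cube_mean n g"
  by (simp add: integral_uniform_count_measure card_cube cube_mean_def)

lemma cube_mean_add: "cube_mean n (\<lambda>x. f x + g x) = cube_mean n f + cube_mean n g"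
  by (simp add: cube_mean_def sum.distrib add_divide_distrib)

lemma cube_mean_diff: "cube_mean n (\<lambda>x. f x - g x) = cube_mean n f - cube_mean n g"
  by (simp add: cube_mean_def sum_subtractf diff_divide_distrib)

lemma cube_mean_cmult: "cube_mean n (\<lambda>x. c * f x) = c * cube_mean n f"
  by (simp add: cube_mean_def sum_distrib_left[symmetric])

lemma cube_mean_const: "cube_mean n (\<lambda>x. c) = c"
  by (simp add: cube_mean_def card_cube)

lemma cube_mean_sum: "cube_mean n (\<lambda>x. \<Sum>i\<in>I. f i x) = (\<Sum>i\<in>I. cube_mean n (f i))"
  unfolding cube_mean_def by (subst sum.swap) (simp add: sum_divide_distrib)

lemma cube_mean_cong: "(\<And>x. x \<in> cube n \<Longrightarrow> f x = g x) \<Longrightarrow> cube_mean n f = cube_mean n g"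
  by (simp add: cube_mean_def)

lemma cube_mean_mono: "(\<And>x. x \<in> cube n \<Longrightarrow> f x \<le> g x) \<Longrightarrow> cube_mean n f \<le> cube_mean n g"
  by (simp add: cube_mean_def divide_right_mono sum_mono)

lemma cube_mean_nonneg: "(\<And>x. x \<in> cube n \<Longrightarrow> 0 \<le> g x) \<Longrightarrow> 0 \<le> cube_mean n g"
  by (simp add: cube_mean_def sum_nonneg)

lemma cube_mean_nonneg_eq_0:
  assumes "\<And>x. x \<in> cube n \<Longrightarrow> 0 \<le> g x" "cube_mean n g = 0" "x \<in> cube n"
  shows "g x = 0"
  using assms sum_nonneg_eq_0_iff[of "cube n" g] by (simp add: cube_mean_def)

lemma cube_mean_Suc:
  "cube_mean (Suc n) g = (cube_mean n (\<lambda>x. g (x(Suc n := 1))) + cube_mean n (\<lambda>x. g (x(Suc n := - 1)))) / 2"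
proof -
  have eq: "cube (Suc n) = (\<lambda>(y, h). h(Suc n := y)) ` ({-1, 1} \<times> cube n)"
  proof -
    have "{1..Suc n} = insert (Suc n) {1..n}" by auto
    then show ?thesis unfolding cube_def by (simp only: PiE_insert_eq)
  qed
  have inj: "inj_on (\<lambda>(y, h). h(Suc n := y)) ({-1, 1 :: real} \<times> cube n)"
    unfolding cube_def by (rule inj_combinator) simp
  have "(\<Sum>x\<in>cube (Suc n). g x) = (\<Sum>(y, h)\<in>{-1, 1} \<times> cube n. g (h(Suc n := y)))"
    unfolding eq by (subst sum.reindex[OF inj]) (simp add: case_prod_unfold o_def)
  also have "\<dots> = (\<Sum>h\<in>cube n. g (h(Suc n := 1))) + (\<Sum>h\<in>cube n. g (h(Suc n := - 1)))"
    by (subst sum.cartesian_product[symmetric]) simp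
  finally show ?thesis by (simp add: cube_mean_def add_divide_distrib)
qed

lemma cube_mean_Cauchy_Schwarz: "(cube_mean n (\<lambda>x. f x * g x))\<^sup>2 \<le> cube_mean n (\<lambda>x. (f x)\<^sup>2) * cube_mean n (\<lambda>x. (g x)\<^sup>2)"
proof -
  have "(cube_mean n (\<lambda>x. f x * g x))\<^sup>2 = (\<Sum>x\<in>cube n. f x * g x)\<^sup>2 / (2^n)\<^sup>2"
    by (simp add: cube_mean_def power_divide)
  also have "\<dots> \<le> ((\<Sum>x\<in>cube n. (f x)\<^sup>2) * (\<Sum>x\<in>cube n. (g x)\<^sup>2)) / (2^n)\<^sup>2"
    by (intro divide_right_mono Cauchy_Schwarz_ineq_sum) simp
  also have "\<dots> = cube_mean n (\<lambda>x. (f x)\<^sup>2) * cube_mean n (\<lambda>x. (g x)\<^sup>2)"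
    by (simp add: cube_mean_def power2_eq_square)
  finally show ?thesis .
qed

text \<open>Gross's inequality by induction on the dimension. Splitting off the last coordinate writes the entropy as
  the mean of two conditional entropies plus the entropy of a two-point function, whose values are the
  conditional \<open>L\<^sup>2\<close> norms; the difference of these norms is at most the norm of the difference.\<close>

lemma log_sobolev:
  assumes "\<And>x. G x \<ge> 0"
  shows "cube_mean n (\<lambda>x. (G x)\<^sup>2 * ln ((G x)\<^sup>2)) - cube_mean n (\<lambda>x. (G x)\<^sup>2) * ln (cube_mean n (\<lambda>x. (G x)\<^sup>2))
    \<le> 2 * (\<Sum>i\<in>{1..n}. cube_mean n (\<lambda>x. (D i G x)\<^sup>2))"
  using assms
proof (induction n arbitrary: G)
  case 0
  have "cube_mean 0 h = h (\<lambda>_. undefined)" for h by (simp add: cube_mean_def cube_def)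
  then show ?case by simp
next
  case (Suc n)
  define G1 where "G1 = (\<lambda>b x. G (x(Suc n := b)))"
  define A where "A = (\<lambda>b. cube_mean n (\<lambda>x. (G1 b x)\<^sup>2))"
  have G1: "G1 b x \<ge> 0" for b x using Suc.prems by (simp add: G1_def)
  have A: "A b \<ge> 0" for b unfolding A_def by (intro cube_mean_nonneg) simp
  have DG1: "D i G (x(Suc n := b)) = D i (G1 b) x" if "i \<in> {1..n}" for i x b
    using that by (simp add: D_def G1_def fun_upd_twist)
  have DS: "D (Suc n) G (x(Suc n := b)) = (G1 1 x - G1 (-1) x) / 2" for x b
    by (simp add: D_def G1_def)
  have IH: "cube_mean n (\<lambda>x. (G1 b x)\<^sup>2 * ln ((G1 b x)\<^sup>2)) - A b * ln (A b) \<le> 2 * (\<Sum>i\<in>{1..n}. cube_mean n (\<lambda>x. (D i (G1 b) x)\<^sup>2))" for b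
    unfolding A_def by (rule Suc.IH) (rule G1)
  have two: "(A 1 * ln (A 1) + A (-1) * ln (A (-1))) / 2 - (A 1 + A (-1)) / 2 * ln ((A 1 + A (-1)) / 2)
      \<le> (sqrt (A 1) - sqrt (A (-1)))\<^sup>2 / 2"
    using two_point_lsi[of "sqrt (A 1)" "sqrt (A (-1))"] A by simp
  have cs: "(sqrt (A 1) - sqrt (A (-1)))\<^sup>2 \<le> cube_mean n (\<lambda>x. (G1 1 x - G1 (-1) x)\<^sup>2)"
  proof -
    have "(cube_mean n (\<lambda>x. G1 1 x * G1 (-1) x))\<^sup>2 \<le> A 1 * A (-1)"
      unfolding A_def by (rule cube_mean_Cauchy_Schwarz)
    then have "cube_mean n (\<lambda>x. G1 1 x * G1 (-1) x) \<le> sqrt (A 1 * A (-1))" by (rule real_le_rsqrt)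
    moreover have "cube_mean n (\<lambda>x. (G1 1 x - G1 (-1) x)\<^sup>2) = A 1 + A (-1) - 2 * cube_mean n (\<lambda>x. G1 1 x * G1 (-1) x)"
      unfolding A_def by (simp add: power2_diff cube_mean_add cube_mean_diff cube_mean_cmult mult.assoc)
    moreover have "(sqrt (A 1) - sqrt (A (-1)))\<^sup>2 = A 1 + A (-1) - 2 * sqrt (A 1 * A (-1))"
      using A by (simp add: power2_diff real_sqrt_mult)
    ultimately show ?thesis by linarith
  qed
  have S: "(\<Sum>i\<in>{1..Suc n}. cube_mean (Suc n) (\<lambda>x. (D i G x)\<^sup>2)) =
     ((\<Sum>i\<in>{1..n}. cube_mean n (\<lambda>x. (D i (G1 1) x)\<^sup>2)) + (\<Sum>i\<in>{1..n}. cube_mean n (\<lambda>x. (D i (G1 (-1)) x)\<^sup>2))) / 2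
      + cube_mean n (\<lambda>x. (G1 1 x - G1 (-1) x)\<^sup>2) / 4"
  proof -
    have "cube_mean (Suc n) (\<lambda>x. (D (Suc n) G x)\<^sup>2) = cube_mean n (\<lambda>x. 1/4 * (G1 1 x - G1 (-1) x)\<^sup>2)"
      by (simp add: cube_mean_Suc DS power_divide)
    then have "cube_mean (Suc n) (\<lambda>x. (D (Suc n) G x)\<^sup>2) = cube_mean n (\<lambda>x. (G1 1 x - G1 (-1) x)\<^sup>2) / 4"
      unfolding cube_mean_cmult by simp
    moreover have "(\<Sum>i\<in>{1..n}. cube_mean (Suc n) (\<lambda>x. (D i G x)\<^sup>2))
       = (\<Sum>i\<in>{1..n}. (cube_mean n (\<lambda>x. (D i (G1 1) x)\<^sup>2) + cube_mean n (\<lambda>x. (D i (G1 (-1)) x)\<^sup>2)) / 2)"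
      by (intro sum.cong refl) (simp only: cube_mean_Suc DG1)
    moreover have "(\<Sum>i\<in>{1..Suc n}. h i) = (\<Sum>i\<in>{1..n}. h i) + h (Suc n)" for h :: "nat \<Rightarrow> real" by simp
    ultimately show ?thesis by (simp only: sum.distrib sum_divide_distrib[symmetric])
  qed
  have "cube_mean (Suc n) (\<lambda>x. (G x)\<^sup>2) = (A 1 + A (-1)) / 2" by (simp add: cube_mean_Suc A_def G1_def)
  moreover have "cube_mean (Suc n) (\<lambda>x. (G x)\<^sup>2 * ln ((G x)\<^sup>2)) =
     (cube_mean n (\<lambda>x. (G1 1 x)\<^sup>2 * ln ((G1 1 x)\<^sup>2)) + cube_mean n (\<lambda>x. (G1 (-1) x)\<^sup>2 * ln ((G1 (-1) x)\<^sup>2))) / 2"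
    by (simp add: cube_mean_Suc G1_def)
  ultimately show ?case using IH[of 1] IH[of "-1"] two cs S by (simp only:) argo
qed

text \<open>Jensen's inequality for the exponential function and the probability density \<open>G\<^sup>2 / V\<close> compares the
  \<open>p\<close>-th with the second moment at the price of the entropy of \<open>G\<^sup>2\<close>.\<close>

lemma moment_lower_bound:
  assumes G: "\<And>x. G x \<ge> 0" and V: "cube_mean n (\<lambda>x. (G x)\<^sup>2) = V" "V > 0" and p: "1 \<le> p" "p < 2"
  shows "cube_mean n (\<lambda>x. G x powr p) \<ge>
    V powr (p / 2) * exp (- (2 - p) * (\<Sum>i\<in>{1..n}. cube_mean n (\<lambda>x. (D i G x)\<^sup>2)) / V)"
proof -
  define X where "X = (\<Sum>i\<in>{1..n}. cube_mean n (\<lambda>x. (D i G x)\<^sup>2))"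
  define T where "T = cube_mean n (\<lambda>x. (G x)\<^sup>2 * ln ((G x)\<^sup>2))"
  define m where "m = (p / 2 - 1) * T / V"
  have pt: "G x powr p \<ge> exp m * ((1 - m) * (G x)\<^sup>2 + (p / 2 - 1) * ((G x)\<^sup>2 * ln ((G x)\<^sup>2)))" for x
  proof (cases "G x = 0")
    case False
    then have g: "G x > 0" using G[of x] by simp
    have l: "ln ((G x)\<^sup>2) = 2 * ln (G x)" using g by (simp add: ln_realpow)
    have "exp m * (1 + ((p - 2) * ln (G x) - m)) \<le> exp m * exp ((p - 2) * ln (G x) - m)"
      using exp_ge_add_one_self by (intro mult_left_mono) auto
    also have "\<dots> = exp ((p - 2) * ln (G x))" by (simp flip: exp_add)
    finally have "(G x)\<^sup>2 * (exp m * (1 + ((p - 2) * ln (G x) - m))) \<le> (G x)\<^sup>2 * exp ((p - 2) * ln (G x))"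
      by (intro mult_left_mono) auto
    also have "\<dots> = exp (2 * ln (G x)) * exp ((p - 2) * ln (G x))" using g by (simp add: exp_double)
    also have "\<dots> = exp (p * ln (G x))" by (simp add: algebra_simps flip: exp_add)
    also have "\<dots> = G x powr p" using g by (simp add: powr_def)
    finally show ?thesis unfolding l by (simp add: algebra_simps)
  qed simp
  have "exp m * V = cube_mean n (\<lambda>x. exp m * ((1 - m) * (G x)\<^sup>2 + (p / 2 - 1) * ((G x)\<^sup>2 * ln ((G x)\<^sup>2))))"
  proof -
    have "m * V = (p / 2 - 1) * T" using V by (simp add: m_def)
    then have "(1 - m) * V + (p / 2 - 1) * T = V" by (simp add: left_diff_distrib)
    then show ?thesis unfolding cube_mean_cmult cube_mean_add V T_def[symmetric] by (simp only:)
  qed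
  also have "\<dots> \<le> cube_mean n (\<lambda>x. G x powr p)" by (intro cube_mean_mono pt)
  finally have 1: "exp m * V \<le> cube_mean n (\<lambda>x. G x powr p)" .
  have "T - V * ln V \<le> 2 * X"
    using log_sobolev[of G n, OF G] unfolding V T_def X_def .
  then have "(T - V * ln V) / V \<le> 2 * X / V" using V(2) by (intro divide_right_mono) auto
  then have "T / V - ln V \<le> 2 * X / V" using V(2) by (simp add: diff_divide_distrib)
  then have "(1 - p / 2) * (T / V - ln V) \<le> (1 - p / 2) * (2 * X / V)"
    using p by (intro mult_left_mono) auto
  then have "(p / 2) * ln V + (- (2 - p) * X / V) \<le> m + ln V"
    by (simp add: m_def algebra_simps diff_divide_distrib)
  then have "exp ((p / 2) * ln V + (- (2 - p) * X / V)) \<le> exp (m + ln V)" by simp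
  also have "\<dots> = exp m * V" using V by (simp add: exp_add)
  also have "exp ((p / 2) * ln V + (- (2 - p) * X / V)) = V powr (p / 2) * exp (- (2 - p) * X / V)"
    using V by (simp add: powr_def exp_add)
  finally show ?thesis using 1 unfolding X_def by linarith
qed

section \<open>Fourier analysis on the cube\<close>

text \<open>This keeps the index set \<open>{1..n}\<close> from being rewritten to \<open>{Suc 0..n}\<close>.\<close>

declare One_nat_def [simp del]

definition chi :: "nat set \<Rightarrow> (nat \<Rightarrow> real) \<Rightarrow> real" where
  "chi S x = (\<Prod>i\<in>S. x i)"

definition fourier_sum :: "nat \<Rightarrow> (nat set \<Rightarrow> real) \<Rightarrow> (nat \<Rightarrow> real) \<Rightarrow> real" where
  "fourier_sum n c x = (\<Sum>S\<in>Pow {1..n}. c S * chi S x)"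

definition fourier :: "nat \<Rightarrow> ((nat \<Rightarrow> real) \<Rightarrow> real) \<Rightarrow> nat set \<Rightarrow> real" where
  "fourier n f S = cube_mean n (\<lambda>x. f x * chi S x)"

text \<open>Independence of the coordinates.\<close>

lemma cube_mean_prod:
  "cube_mean n (\<lambda>x. \<Prod>i\<in>{1..n}. \<phi> i (x i)) = (\<Prod>i\<in>{1..n}. (\<phi> i 1 + \<phi> i (-1)) / 2)"
proof -
  have "(\<Prod>i\<in>{1..n}. \<Sum>y\<in>{-1, 1 :: real}. \<phi> i y) = (\<Sum>x\<in>cube n. \<Prod>i\<in>{1..n}. \<phi> i (x i))"
    unfolding cube_def by (rule prod_sum_PiE) auto
  moreover have "(\<Prod>i\<in>{1..n}. (\<phi> i 1 + \<phi> i (-1)) / 2) = (\<Prod>i\<in>{1..n}. \<Sum>y\<in>{-1, 1 :: real}. \<phi> i y) / 2 ^ n"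
    by (simp add: prod_dividef add.commute)
  ultimately show ?thesis by (simp add: cube_mean_def)
qed

lemma chi_eq_prod:
  assumes "S \<subseteq> {1..n}" shows "chi S x = (\<Prod>i\<in>{1..n}. if i \<in> S then x i else 1)"
  unfolding chi_def using assms by (simp add: prod.If_cases Int_absorb1)

lemma cube_coord: "x \<in> cube n \<Longrightarrow> i \<in> {1..n} \<Longrightarrow> x i = 1 \<or> x i = -1"
  by (auto simp: cube_def)

lemma cube_upd: "x \<in> cube n \<Longrightarrow> i \<in> {1..n} \<Longrightarrow> b \<in> {-1, 1} \<Longrightarrow> x(i := b) \<in> cube n"
  by (auto simp: cube_def PiE_iff extensional_def)

lemma chi_orthonormal:
  assumes S: "S \<subseteq> {1..n}" and T: "T \<subseteq> {1..n}"
  shows "cube_mean n (\<lambda>x. chi S x * chi T x) = (if S = T then 1 else 0)"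
proof -
  have "cube_mean n (\<lambda>x. chi S x * chi T x) =
      cube_mean n (\<lambda>x. \<Prod>i\<in>{1..n}. (if i \<in> S then x i else 1) * (if i \<in> T then x i else 1))"
    by (simp add: chi_eq_prod[OF S] chi_eq_prod[OF T] prod.distrib)
  also have "\<dots> = (\<Prod>i\<in>{1..n}. if i \<in> S \<longleftrightarrow> i \<in> T then 1 else 0)"
    by (subst cube_mean_prod) (intro prod.cong, auto)
  also have "\<dots> = (if S = T then 1 else 0)"
  proof (cases "S = T")
    case False
    then obtain i where "i \<in> {1..n}" "(i \<in> S) \<noteq> (i \<in> T)" using S T by blast
    then show ?thesis using False by (auto intro!: prod_zero)
  qed simp
  finally show ?thesis .
qed

lemma prod_one_plus_chi:
  "(\<Prod>i\<in>{1..n}. 1 + \<rho> * x i * y i) = (\<Sum>S\<in>Pow {1..n}. \<rho> ^ card S * chi S x * chi S y)"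
proof -
  have "(\<Prod>i\<in>{1..n}. \<rho> * x i * y i + 1) = (\<Sum>S\<in>Pow {1..n}. (\<Prod>i\<in>S. \<rho> * x i * y i) * (\<Prod>i\<in>{1..n} - S. 1))"
    by (rule prod_add) simp
  then show ?thesis by (simp add: add.commute prod.distrib chi_def)
qed

lemma Fourier_expansion:
  assumes x: "x \<in> cube n"
  shows "fourier_sum n (fourier n f) x = f x"
proof -
  have "fourier_sum n (fourier n f) x = cube_mean n (\<lambda>y. f y * (\<Prod>i\<in>{1..n}. 1 + 1 * x i * y i))"
    unfolding fourier_sum_def fourier_def prod_one_plus_chi
    by (simp add: sum_distrib_left cube_mean_sum) (simp add: cube_mean_cmult[symmetric] mult_ac)
  also have "\<dots> = cube_mean n (\<lambda>y. if y = x then f x * 2 ^ n else 0)"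
  proof (rule cube_mean_cong)
    fix y assume y: "y \<in> cube n"
    show "f y * (\<Prod>i\<in>{1..n}. 1 + 1 * x i * y i) = (if y = x then f x * 2 ^ n else 0)"
    proof (cases "y = x")
      case True
      have "(\<Prod>i\<in>{1..n}. 1 + 1 * x i * x i) = (\<Prod>i\<in>{1..n}. 2)"
        using cube_coord[OF x] by (intro prod.cong) force+
      then show ?thesis using True by simp
    next
      case False
      then obtain i where i: "i \<in> {1..n}" "x i \<noteq> y i"
        using x y unfolding cube_def by (metis PiE_ext)
      then have "1 + 1 * x i * y i = 0" using cube_coord[OF x i(1)] cube_coord[OF y i(1)] by auto
      then have "(\<Prod>i\<in>{1..n}. 1 + 1 * x i * y i) = 0" using i(1) by (intro prod_zero) auto
      then show ?thesis using False by simp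
    qed
  qed
  also have "\<dots> = f x" using x by (simp add: cube_mean_def)
  finally show ?thesis .
qed

lemma D_linear: "D i (\<lambda>x. \<Sum>S\<in>A. c S * h S x) = (\<lambda>x. \<Sum>S\<in>A. c S * D i (h S) x)"
  by (rule ext) (simp add: D_def sum_subtractf[symmetric] sum_divide_distrib right_diff_distrib)

lemma D_chi:
  assumes "finite S" shows "D i (chi S) = (if i \<in> S then chi (S - {i}) else (\<lambda>x. 0))"
proof (rule ext)
  fix x
  show "D i (chi S) x = (if i \<in> S then chi (S - {i}) else (\<lambda>x. 0)) x"
  proof (cases "i \<in> S")
    case True
    have "chi S y = y i * chi (S - {i}) y" for y
      unfolding chi_def using assms True by (rule prod.remove)
    moreover have "chi (S - {i}) (x(i := b)) = chi (S - {i}) x" for b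
      unfolding chi_def by (intro prod.cong) auto
    ultimately show ?thesis using True by (simp add: D_def)
  next
    case False
    then have "chi S (x(i := b)) = chi S x" for b
      unfolding chi_def by (intro prod.cong) auto
    then show ?thesis using False by (simp add: D_def)
  qed
qed

text \<open>Sums of characters divided by a common factor \<open>chi J\<close> are closed under derivatives, so that derivatives
  can be iterated without reindexing the coefficients.\<close>

lemma D_partial_sum:
  assumes "finite A" "\<And>S. S \<in> A \<Longrightarrow> finite S"
  shows "D i (\<lambda>x. \<Sum>S\<in>A. c S * chi (S - J) x) = (\<lambda>x. \<Sum>S\<in>{S\<in>A. i \<in> S - J}. c S * chi (S - insert i J) x)"
proof -
  have "D i (\<lambda>x. \<Sum>S\<in>A. c S * chi (S - J) x) = (\<lambda>x. \<Sum>S\<in>A. if i \<in> S - J then c S * chi (S - insert i J) x else 0)"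
    unfolding D_linear
  proof (intro ext sum.cong refl)
    fix x S assume "S \<in> A"
    then have "finite (S - J)" using assms by simp
    moreover have "S - J - {i} = S - insert i J" by auto
    ultimately show "c S * D i (chi (S - J)) x = (if i \<in> S - J then c S * chi (S - insert i J) x else 0)"
      by (simp add: D_chi)
  qed
  also have "\<dots> = (\<lambda>x. \<Sum>S\<in>{S\<in>A. i \<in> S - J}. c S * chi (S - insert i J) x)"
    using assms(1) by (simp only: sum.inter_filter)
  finally show ?thesis .
qed

lemma D_set_fourier_sum:
  assumes "J \<subseteq> {1..n}"
  shows "D_set J (fourier_sum n c) = (\<lambda>x. \<Sum>S\<in>{S. J \<subseteq> S \<and> S \<subseteq> {1..n}}. c S * chi (S - J) x)"
proof -
  have "finite J" using assms finite_subset by blast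
  then show ?thesis using assms
  proof (induction J rule: finite_induct)
    case empty
    have "Pow {1..n} = {S. {} \<subseteq> S \<and> S \<subseteq> {1..n}}" by auto
    then show ?case by (simp add: fourier_sum_def[abs_def])
  next
    case (insert i J)
    define A where "A = {S. J \<subseteq> S \<and> S \<subseteq> {1..n}}"
    have A: "finite A" "\<And>S. S \<in> A \<Longrightarrow> finite S"
      unfolding A_def by (auto intro: finite_subset[of _ "Pow {1..n}"] dest: finite_subset[OF _ finite_atLeastAtMost])
    have "D_set (insert i J) (fourier_sum n c) = D i (\<lambda>x. \<Sum>S\<in>A. c S * chi (S - J) x)"
      using insert by (simp add: A_def)
    also have "\<dots> = (\<lambda>x. \<Sum>S\<in>{S\<in>A. i \<in> S - J}. c S * chi (S - insert i J) x)"
      by (rule D_partial_sum[OF A])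
    also have "{S\<in>A. i \<in> S - J} = {S. insert i J \<subseteq> S \<and> S \<subseteq> {1..n}}"
      using insert.hyps by (auto simp: A_def)
    finally show ?case .
  qed
qed

lemma D_set_cong:
  assumes "J \<subseteq> {1..n}" "\<And>x. x \<in> cube n \<Longrightarrow> f x = g x" "x \<in> cube n"
  shows "D_set J f x = D_set J g x"
proof -
  have "finite J" using assms finite_subset by blast
  then show ?thesis using assms(1,3)
  proof (induction J arbitrary: x rule: finite_induct)
    case empty
    then show ?case using assms(2) by simp
  next
    case (insert i J)
    then show ?case by (simp add: D_def cube_upd)
  qed
qed

lemma cube_mean_partial_sums:
  assumes "finite A" "\<And>S. S \<in> A \<Longrightarrow> J \<subseteq> S \<and> S \<subseteq> {1..n}"
  shows "cube_mean n (\<lambda>x. (\<Sum>S\<in>A. c S * chi (S - J) x) * (\<Sum>S\<in>A. d S * chi (S - J) x)) = (\<Sum>S\<in>A. c S * d S)"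
proof -
  have "cube_mean n (\<lambda>x. (\<Sum>S\<in>A. c S * chi (S - J) x) * (\<Sum>S\<in>A. d S * chi (S - J) x))
     = (\<Sum>S\<in>A. \<Sum>T\<in>A. c S * d T * cube_mean n (\<lambda>x. chi (S - J) x * chi (T - J) x))"
    by (simp add: sum_product cube_mean_sum cube_mean_cmult[symmetric] mult_ac)
  also have "\<dots> = (\<Sum>S\<in>A. \<Sum>T\<in>A. if T = S then c S * d S else 0)"
  proof (intro sum.cong refl)
    fix S T assume "S \<in> A" "T \<in> A"
    then have "cube_mean n (\<lambda>x. chi (S - J) x * chi (T - J) x) = (if S - J = T - J then 1 else 0)"
      using assms(2) by (intro chi_orthonormal) blast+
    moreover have "S - J = T - J \<longleftrightarrow> T = S" using \<open>S \<in> A\<close> \<open>T \<in> A\<close> assms(2) by blast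
    ultimately show "c S * d T * cube_mean n (\<lambda>x. chi (S - J) x * chi (T - J) x) = (if T = S then c S * d S else 0)"
      by auto
  qed
  also have "\<dots> = (\<Sum>S\<in>A. c S * d S)" using assms(1) by simp
  finally show ?thesis .
qed

definition index_sets :: "nat \<Rightarrow> nat \<Rightarrow> nat set set" where
  "index_sets n k = {J. J \<subseteq> {1..n} \<and> card J = k}"

lemma finite_index_sets [simp]: "finite (index_sets n k)"
  by (simp add: index_sets_def)

lemma sum_index_sets_supersets:
  "(\<Sum>J\<in>index_sets n k. \<Sum>S\<in>{S. J \<subseteq> S \<and> S \<subseteq> {1..n}}. h S) = (\<Sum>S\<in>Pow {1..n}. real (card S choose k) * h S)"
proof -
  have "(\<Sum>J\<in>index_sets n k. \<Sum>S\<in>{S. J \<subseteq> S \<and> S \<subseteq> {1..n}}. h S)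
      = (\<Sum>J\<in>index_sets n k. \<Sum>S\<in>{S\<in>Pow {1..n}. J \<subseteq> S}. h S)"
    by (intro sum.cong refl) auto
  also have "\<dots> = (\<Sum>S\<in>Pow {1..n}. \<Sum>J\<in>{J\<in>index_sets n k. J \<subseteq> S}. h S)"
    by (rule sum.swap_restrict) auto
  also have "\<dots> = (\<Sum>S\<in>Pow {1..n}. real (card S choose k) * h S)"
  proof (intro sum.cong refl)
    fix S assume S: "S \<in> Pow {1..n}"
    then have "{J\<in>index_sets n k. J \<subseteq> S} = {J. J \<subseteq> S \<and> card J = k}" by (auto simp: index_sets_def)
    moreover have "finite S" using S finite_subset by blast
    ultimately show "(\<Sum>J\<in>{J\<in>index_sets n k. J \<subseteq> S}. h S) = real (card S choose k) * h S"
      by (simp add: n_subsets)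
  qed
  finally show ?thesis .
qed

lemma finite_supersets: "finite {S. J \<subseteq> S \<and> S \<subseteq> {1..n :: nat}}"
  by (rule finite_subset[of _ "Pow {1..n}"]) auto

lemma grad_inner:
  "(\<Sum>J\<in>index_sets n k. cube_mean n (\<lambda>x. D_set J (fourier_sum n c) x * D_set J (fourier_sum n d) x))
     = (\<Sum>S\<in>Pow {1..n}. real (card S choose k) * (c S * d S))"
  unfolding sum_index_sets_supersets[symmetric]
proof (intro sum.cong refl)
  fix J assume "J \<in> index_sets n k"
  then have "J \<subseteq> {1..n}" by (simp add: index_sets_def)
  then show "cube_mean n (\<lambda>x. D_set J (fourier_sum n c) x * D_set J (fourier_sum n d) x) = (\<Sum>S | J \<subseteq> S \<and> S \<subseteq> {1..n}. c S * d S)"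
    unfolding D_set_fourier_sum[OF \<open>J \<subseteq> {1..n}\<close>] by (intro cube_mean_partial_sums finite_supersets) auto
qed

text \<open>The factor \<open>card S - k\<close> counts the coordinates left in \<open>S - J\<close>, each of which contributes one
  further derivative.\<close>

lemma grad_dirichlet:
  "(\<Sum>i\<in>{1..n}. \<Sum>J\<in>index_sets n k. cube_mean n (\<lambda>x. (D i (D_set J (fourier_sum n c)) x)\<^sup>2))
     = (\<Sum>S\<in>Pow {1..n}. real (card S choose k) * ((real (card S) - real k) * (c S)\<^sup>2))"
proof -
  have "(\<Sum>i\<in>{1..n}. \<Sum>J\<in>index_sets n k. cube_mean n (\<lambda>x. (D i (D_set J (fourier_sum n c)) x)\<^sup>2))
    = (\<Sum>J\<in>index_sets n k. \<Sum>i\<in>{1..n}. cube_mean n (\<lambda>x. (D i (D_set J (fourier_sum n c)) x)\<^sup>2))"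
    by (rule sum.swap)
  also have "\<dots> = (\<Sum>J\<in>index_sets n k. \<Sum>S\<in>{S. J \<subseteq> S \<and> S \<subseteq> {1..n}}. (real (card S) - real k) * (c S)\<^sup>2)"
  proof (intro sum.cong refl)
    fix J assume "J \<in> index_sets n k"
    then have J: "J \<subseteq> {1..n}" "card J = k" "finite J" by (auto simp: index_sets_def intro: finite_subset)
    define A where "A = {S. J \<subseteq> S \<and> S \<subseteq> {1..n}}"
    have A: "finite A" "\<And>S. S \<in> A \<Longrightarrow> finite S"
      unfolding A_def by (auto intro: finite_subset[of _ "Pow {1..n}"] dest: finite_subset[OF _ finite_atLeastAtMost])
    have "cube_mean n (\<lambda>x. (D i (D_set J (fourier_sum n c)) x)\<^sup>2) = (\<Sum>S\<in>{S\<in>A. i \<in> S - J}. (c S)\<^sup>2)" if "i \<in> {1..n}" for i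
    proof -
      have "D i (D_set J (fourier_sum n c)) = (\<lambda>x. \<Sum>S\<in>{S\<in>A. i \<in> S - J}. c S * chi (S - insert i J) x)"
        unfolding D_set_fourier_sum[OF J(1)] A_def[symmetric] by (rule D_partial_sum[OF A])
      then have "cube_mean n (\<lambda>x. (D i (D_set J (fourier_sum n c)) x)\<^sup>2) = (\<Sum>S\<in>{S\<in>A. i \<in> S - J}. c S * c S)"
        using A that by (simp add: power2_eq_square) (subst cube_mean_partial_sums, auto simp: A_def)
      then show ?thesis by (simp add: power2_eq_square)
    qed
    then have "(\<Sum>i\<in>{1..n}. cube_mean n (\<lambda>x. (D i (D_set J (fourier_sum n c)) x)\<^sup>2)) = (\<Sum>i\<in>{1..n}. \<Sum>S\<in>{S\<in>A. i \<in> S - J}. (c S)\<^sup>2)"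
      by (rule sum.cong[OF refl])
    also have "\<dots> = (\<Sum>S\<in>A. \<Sum>i\<in>{i\<in>{1..n}. i \<in> S - J}. (c S)\<^sup>2)"
      by (rule sum.swap_restrict) (use A in auto)
    also have "\<dots> = (\<Sum>S\<in>A. (real (card S) - real k) * (c S)\<^sup>2)"
    proof (intro sum.cong refl)
      fix S assume S: "S \<in> A"
      then have "{i\<in>{1..n}. i \<in> S - J} = S - J" by (auto simp: A_def)
      moreover have "card (S - J) = card S - k" using S J A(2) by (simp add: card_Diff_subset A_def)
      moreover have "k \<le> card S" using S J A(2)[OF S] by (auto simp: A_def intro: card_mono)
      ultimately show "(\<Sum>i\<in>{i\<in>{1..n}. i \<in> S - J}. (c S)\<^sup>2) = (real (card S) - real k) * (c S)\<^sup>2"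
        by (simp add: of_nat_diff)
    qed
    finally show "(\<Sum>i\<in>{1..n}. cube_mean n (\<lambda>x. (D i (D_set J (fourier_sum n c)) x)\<^sup>2))
       = (\<Sum>S | J \<subseteq> S \<and> S \<subseteq> {1..n}. (real (card S) - real k) * (c S)\<^sup>2)" by (simp add: A_def)
  qed
  also have "\<dots> = (\<Sum>S\<in>Pow {1..n}. real (card S choose k) * ((real (card S) - real k) * (c S)\<^sup>2))"
    by (rule sum_index_sets_supersets)
  finally show ?thesis .
qed

section \<open>The noise operator\<close>

text \<open>On coefficients, the noise operator multiplies by a power of \<open>\<rho>\<close>; in the semigroup \<open>\<rho> = exp (- t)\<close>.\<close>

definition noise :: "real \<Rightarrow> (nat set \<Rightarrow> real) \<Rightarrow> nat set \<Rightarrow> real" where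
  "noise \<rho> c S = \<rho> ^ card S * c S"

text \<open>The density, with respect to the uniform measure, of a point whose coordinates agree with those of \<open>x\<close>
  independently with probability \<open>(1 + \<rho>)/2\<close>.\<close>

definition noise_kernel :: "nat \<Rightarrow> real \<Rightarrow> (nat \<Rightarrow> real) \<Rightarrow> (nat \<Rightarrow> real) \<Rightarrow> real" where
  "noise_kernel n \<rho> x y = (\<Prod>i\<in>{1..n}. 1 + \<rho> * x i * y i)"

lemma noise_kernel_commute: "noise_kernel n \<rho> x y = noise_kernel n \<rho> y x"
  by (simp add: noise_kernel_def mult_ac)

lemma noise_kernel_pos:
  assumes "x \<in> cube n" "y \<in> cube n" "0 \<le> \<rho>" "\<rho> < 1"
  shows "noise_kernel n \<rho> x y > 0"
  unfolding noise_kernel_def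
proof (rule prod_pos)
  fix i assume "i \<in> {1..n}"
  then show "1 + \<rho> * x i * y i > 0"
    using cube_coord[OF assms(1), of i] cube_coord[OF assms(2), of i] assms(3,4) by auto
qed

lemma cube_mean_noise_kernel_chi:
  assumes "S \<subseteq> {1..n}"
  shows "cube_mean n (\<lambda>y. noise_kernel n \<rho> x y * chi S y) = \<rho> ^ card S * chi S x"
proof -
  have "cube_mean n (\<lambda>y. noise_kernel n \<rho> x y * chi S y) = cube_mean n (\<lambda>y. \<Sum>T\<in>Pow {1..n}. (\<rho> ^ card T * chi T x) * (chi T y * chi S y))"
    unfolding noise_kernel_def prod_one_plus_chi sum_distrib_right by (simp only: mult.assoc)
  also have "\<dots> = (\<Sum>T\<in>Pow {1..n}. (\<rho> ^ card T * chi T x) * cube_mean n (\<lambda>y. chi T y * chi S y))"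
    by (simp add: cube_mean_sum cube_mean_cmult)
  also have "\<dots> = (\<Sum>T\<in>Pow {1..n}. if T = S then \<rho> ^ card S * chi S x else 0)"
    using assms by (intro sum.cong refl) (auto simp: chi_orthonormal)
  finally show ?thesis using assms by simp
qed

lemma cube_mean_noise_kernel: "cube_mean n (noise_kernel n \<rho> x) = 1"
  using cube_mean_noise_kernel_chi[of "{}" n \<rho> x] by (simp add: chi_def)

text \<open>Derivatives and noise commute up to the factor \<open>\<rho> ^ k\<close>, since each derivative removes one coordinate
  from the character.\<close>

lemma D_set_noise_kernel:
  assumes "J \<subseteq> {1..n}" "card J = k"
  shows "D_set J (fourier_sum n (noise \<rho> c)) x = \<rho> ^ k * cube_mean n (\<lambda>y. noise_kernel n \<rho> x y * D_set J (fourier_sum n c) y)"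
proof -
  have "cube_mean n (\<lambda>y. noise_kernel n \<rho> x y * D_set J (fourier_sum n c) y)
     = cube_mean n (\<lambda>y. \<Sum>S\<in>{S. J \<subseteq> S \<and> S \<subseteq> {1..n}}. c S * (noise_kernel n \<rho> x y * chi (S - J) y))"
    by (simp add: D_set_fourier_sum[OF assms(1)] sum_distrib_left mult_ac)
  also have "\<dots> = (\<Sum>S\<in>{S. J \<subseteq> S \<and> S \<subseteq> {1..n}}. c S * (\<rho> ^ card (S - J) * chi (S - J) x))"
    unfolding cube_mean_sum cube_mean_cmult by (intro sum.cong refl, subst cube_mean_noise_kernel_chi) auto
  finally have "\<rho> ^ k * cube_mean n (\<lambda>y. noise_kernel n \<rho> x y * D_set J (fourier_sum n c) y)
    = (\<Sum>S\<in>{S. J \<subseteq> S \<and> S \<subseteq> {1..n}}. \<rho> ^ k * (c S * (\<rho> ^ card (S - J) * chi (S - J) x)))"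
    by (simp add: sum_distrib_left)
  also have "\<dots> = D_set J (fourier_sum n (noise \<rho> c)) x"
    unfolding D_set_fourier_sum[OF assms(1)]
  proof (intro sum.cong refl)
    fix S assume S: "S \<in> {S. J \<subseteq> S \<and> S \<subseteq> {1..n}}"
    then have "finite S" using finite_subset by blast
    then have "card S = k + card (S - J)"
      using S assms card_mono[of S J] by (simp add: card_Diff_subset finite_subset[of J S])
    then show "\<rho> ^ k * (c S * (\<rho> ^ card (S - J) * chi (S - J) x)) = noise \<rho> c S * chi (S - J) x"
      by (simp add: noise_def power_add)
  qed
  finally show ?thesis by simp
qed

lemma grad_abs_L2: "grad_abs n k f x = L2_set (\<lambda>J. D_set J f x) (index_sets n k)"
  by (simp add: grad_abs_def L2_set_def index_sets_def)

lemma grad_abs_nonneg: "grad_abs n k f x \<ge> 0"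
  by (simp add: grad_abs_L2)

lemma grad_abs_sq: "(grad_abs n k f x)\<^sup>2 = (\<Sum>J\<in>index_sets n k. (D_set J f x)\<^sup>2)"
  by (simp add: grad_abs_L2 L2_set_def sum_nonneg)

lemma grad_abs_cong:
  assumes "\<And>x. x \<in> cube n \<Longrightarrow> f x = g x" "x \<in> cube n"
  shows "grad_abs n k f x = grad_abs n k g x"
  unfolding grad_abs_L2
  by (rule L2_set_cong) (auto simp: index_sets_def intro!: D_set_cong[where n = n] assms)

text \<open>Young's inequality with the conjugate exponent eliminated, so that it makes sense for \<open>p = 1\<close> too.\<close>

lemma powr_Young:
  fixes h m p :: real
  assumes "p \<ge> 1" "h \<ge> 0" "m \<ge> 0"
  shows "h * m powr (p - 1) \<le> h powr p / p + (1 - 1 / p) * m powr p"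
proof (cases "p = 1")
  case True
  then show ?thesis using assms by (cases "m = 0") auto
next
  case False
  then have p: "p > 1" using assms by simp
  have "h * m powr (p - 1) \<le> h powr p / p + (m powr (p - 1)) powr (p / (p - 1)) / (p / (p - 1))"
    by (rule Youngs_inequality) (use p assms in \<open>auto simp: field_simps\<close>)
  also have "(m powr (p - 1)) powr (p / (p - 1)) = m powr p" using p by (simp add: powr_powr)
  finally show ?thesis using p by (simp add: field_simps)
qed

lemma noise_kernel_Jensen:
  assumes "x \<in> cube n" "0 \<le> \<rho>" "\<rho> < 1" "p \<ge> 1" "\<And>y. h y \<ge> 0"
  shows "(cube_mean n (\<lambda>y. noise_kernel n \<rho> x y * h y)) powr p \<le> cube_mean n (\<lambda>y. noise_kernel n \<rho> x y * h y powr p)"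
proof -
  define m where "m = cube_mean n (\<lambda>y. noise_kernel n \<rho> x y * h y)"
  have K: "noise_kernel n \<rho> x y \<ge> 0" if "y \<in> cube n" for y
    using noise_kernel_pos[OF assms(1) that assms(2,3)] by simp
  have m: "m \<ge> 0" unfolding m_def by (intro cube_mean_nonneg mult_nonneg_nonneg K assms)
  have "cube_mean n (\<lambda>y. m powr (p - 1) * (noise_kernel n \<rho> x y * h y))
      \<le> cube_mean n (\<lambda>y. 1 / p * (noise_kernel n \<rho> x y * h y powr p) + ((1 - 1 / p) * m powr p) * noise_kernel n \<rho> x y)"
  proof (rule cube_mean_mono)
    fix y assume y: "y \<in> cube n"
    have "noise_kernel n \<rho> x y * (h y * m powr (p - 1)) \<le> noise_kernel n \<rho> x y * (h y powr p / p + (1 - 1 / p) * m powr p)"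
      by (intro mult_left_mono powr_Young K y assms m)
    then show "m powr (p - 1) * (noise_kernel n \<rho> x y * h y)
        \<le> 1 / p * (noise_kernel n \<rho> x y * h y powr p) + ((1 - 1 / p) * m powr p) * noise_kernel n \<rho> x y"
      by (simp add: algebra_simps)
  qed
  then have "m powr (p - 1) * m \<le> 1 / p * cube_mean n (\<lambda>y. noise_kernel n \<rho> x y * h y powr p) + (1 - 1 / p) * m powr p"
    by (simp only: cube_mean_add cube_mean_cmult cube_mean_noise_kernel mult_1_right m_def[symmetric])
  moreover have "m powr (p - 1) * m = m powr p"
  proof (cases "m = 0")
    case False
    then show ?thesis using m by (simp add: powr_diff)
  qed simp
  ultimately have "1 / p * m powr p \<le> 1 / p * cube_mean n (\<lambda>y. noise_kernel n \<rho> x y * h y powr p)"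
    by (simp add: algebra_simps)
  then show ?thesis using assms(4) by (simp add: m_def divide_right_mono_neg field_simps)
qed

text \<open>Minkowski's inequality for the vector of all derivatives: an average of vectors is no longer than the average
  length.\<close>

lemma grad_abs_noise_le:
  assumes x: "x \<in> cube n" and \<rho>: "0 \<le> \<rho>" "\<rho> < 1"
  shows "grad_abs n k (fourier_sum n (noise \<rho> c)) x
    \<le> \<rho> ^ k * cube_mean n (\<lambda>y. noise_kernel n \<rho> x y * grad_abs n k (fourier_sum n c) y)"
proof -
  define u where "u = (\<lambda>J. D_set J (fourier_sum n (noise \<rho> c)) x)"
  define v where "v = (\<lambda>J y. D_set J (fourier_sum n c) y)"
  define N where "N = grad_abs n k (fourier_sum n (noise \<rho> c)) x"
  define Q where "Q = \<rho> ^ k * cube_mean n (\<lambda>y. noise_kernel n \<rho> x y * grad_abs n k (fourier_sum n c) y)"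
  have K: "noise_kernel n \<rho> x y \<ge> 0" if "y \<in> cube n" for y
    using noise_kernel_pos[OF x that \<rho>] by simp
  have Q: "Q \<ge> 0" unfolding Q_def using \<rho> by (intro mult_nonneg_nonneg cube_mean_nonneg K grad_abs_nonneg) auto
  have u: "u J = \<rho> ^ k * cube_mean n (\<lambda>y. noise_kernel n \<rho> x y * v J y)" if "J \<in> index_sets n k" for J
    unfolding u_def v_def using that by (intro D_set_noise_kernel) (auto simp: index_sets_def)
  have "N\<^sup>2 = (\<Sum>J\<in>index_sets n k. u J * u J)" unfolding N_def grad_abs_sq by (simp add: u_def power2_eq_square)
  also have "\<dots> = (\<Sum>J\<in>index_sets n k. u J * (\<rho> ^ k * cube_mean n (\<lambda>y. noise_kernel n \<rho> x y * v J y)))"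
    using u by (intro sum.cong) auto
  also have "\<dots> = \<rho> ^ k * cube_mean n (\<lambda>y. noise_kernel n \<rho> x y * (\<Sum>J\<in>index_sets n k. u J * v J y))"
    by (simp add: sum_distrib_left cube_mean_sum) (simp add: cube_mean_cmult[symmetric] mult_ac)
  also have "\<dots> \<le> \<rho> ^ k * cube_mean n (\<lambda>y. noise_kernel n \<rho> x y * (N * grad_abs n k (fourier_sum n c) y))"
  proof (intro mult_left_mono cube_mean_mono K)
    fix y
    have "(\<Sum>J\<in>index_sets n k. u J * v J y) \<le> (\<Sum>J\<in>index_sets n k. \<bar>u J\<bar> * \<bar>v J y\<bar>)"
      by (intro sum_mono) (metis abs_ge_self abs_mult)
    also have "\<dots> \<le> L2_set u (index_sets n k) * L2_set (\<lambda>J. v J y) (index_sets n k)" by (rule L2_set_mult_ineq)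
    finally show "(\<Sum>J\<in>index_sets n k. u J * v J y) \<le> N * grad_abs n k (fourier_sum n c) y"
      by (simp add: N_def grad_abs_L2 u_def v_def)
  qed (use \<rho> in auto)
  also have "\<dots> = \<rho> ^ k * cube_mean n (\<lambda>y. N * (noise_kernel n \<rho> x y * grad_abs n k (fourier_sum n c) y))"
    by (simp add: mult.left_commute)
  also have "\<dots> = N * Q" unfolding cube_mean_cmult Q_def by simp
  finally have "N * N \<le> N * Q" by (simp add: power2_eq_square)
  moreover have "N \<ge> 0" by (simp add: N_def grad_abs_nonneg)
  ultimately have "N \<le> Q" using Q by (cases "N = 0") auto
  then show ?thesis by (simp add: N_def Q_def)
qed

lemma grad_abs_noise_moment:
  assumes \<rho>: "0 \<le> \<rho>" "\<rho> < 1" and p: "p \<ge> 1"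
  shows "cube_mean n (\<lambda>x. grad_abs n k (fourier_sum n (noise \<rho> c)) x powr p)
    \<le> (\<rho> ^ k) powr p * cube_mean n (\<lambda>x. grad_abs n k (fourier_sum n c) x powr p)"
proof -
  define h where "h = grad_abs n k (fourier_sum n c)"
  have h: "h y \<ge> 0" for y by (simp add: h_def grad_abs_nonneg)
  have "cube_mean n (\<lambda>x. grad_abs n k (fourier_sum n (noise \<rho> c)) x powr p)
     \<le> cube_mean n (\<lambda>x. (\<rho> ^ k) powr p * cube_mean n (\<lambda>y. noise_kernel n \<rho> x y * h y powr p))"
  proof (rule cube_mean_mono)
    fix x assume x: "x \<in> cube n"
    have mean_nonneg: "cube_mean n (\<lambda>y. noise_kernel n \<rho> x y * h y) \<ge> 0"
      using noise_kernel_pos[OF x _ \<rho>] by (intro cube_mean_nonneg mult_nonneg_nonneg h) (auto intro: less_imp_le)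
    have "grad_abs n k (fourier_sum n (noise \<rho> c)) x powr p \<le> (\<rho> ^ k * cube_mean n (\<lambda>y. noise_kernel n \<rho> x y * h y)) powr p"
      unfolding h_def using p by (intro powr_mono2 grad_abs_noise_le x \<rho> grad_abs_nonneg) auto
    also have "\<dots> = (\<rho> ^ k) powr p * (cube_mean n (\<lambda>y. noise_kernel n \<rho> x y * h y)) powr p"
      using \<rho> mean_nonneg by (simp add: powr_mult)
    also have "\<dots> \<le> (\<rho> ^ k) powr p * cube_mean n (\<lambda>y. noise_kernel n \<rho> x y * h y powr p)"
      by (intro mult_left_mono noise_kernel_Jensen x \<rho> p h) auto
    finally show "grad_abs n k (fourier_sum n (noise \<rho> c)) x powr p \<le> (\<rho> ^ k) powr p * cube_mean n (\<lambda>y. noise_kernel n \<rho> x y * h y powr p)" .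
  qed
  also have "\<dots> = (\<rho> ^ k) powr p * cube_mean n (\<lambda>x. cube_mean n (\<lambda>y. noise_kernel n \<rho> x y * h y powr p))"
    by (rule cube_mean_cmult)
  also have "cube_mean n (\<lambda>x. cube_mean n (\<lambda>y. noise_kernel n \<rho> x y * h y powr p)) = cube_mean n (\<lambda>y. cube_mean n (\<lambda>x. noise_kernel n \<rho> x y * h y powr p))"
    by (simp add: cube_mean_def sum_divide_distrib[symmetric]) (rule sum.swap)
  also have "\<dots> = cube_mean n (\<lambda>y. h y powr p * cube_mean n (noise_kernel n \<rho> y))"
    by (rule arg_cong[where f = "cube_mean n"], rule ext)
       (simp add: cube_mean_cmult[symmetric] noise_kernel_commute[of n \<rho> _ "_"] mult.commute)
  finally show ?thesis by (simp add: cube_mean_noise_kernel h_def)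
qed

text \<open>The derivative of \<open>noise_kernel n \<rho> x y\<close> in the coordinates \<open>x i\<close>, \<open>i \<in> J\<close>.\<close>

definition kernel_deriv :: "nat \<Rightarrow> real \<Rightarrow> (nat \<Rightarrow> real) \<Rightarrow> nat set \<Rightarrow> (nat \<Rightarrow> real) \<Rightarrow> real" where
  "kernel_deriv n \<rho> x J y = (\<Prod>i\<in>{1..n}. if i \<in> J then \<rho> * y i else 1 + \<rho> * x i * y i)"

lemma cube_mean_kernel_deriv_chi:
  assumes J: "J \<subseteq> {1..n}" and S: "S \<subseteq> {1..n}"
  shows "cube_mean n (\<lambda>y. kernel_deriv n \<rho> x J y * chi S y) = (if J \<subseteq> S then \<rho> ^ card S * chi (S - J) x else 0)"
proof -
  have "cube_mean n (\<lambda>y. kernel_deriv n \<rho> x J y * chi S y) =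
     cube_mean n (\<lambda>y. \<Prod>i\<in>{1..n}. (if i \<in> J then \<rho> * y i else 1 + \<rho> * x i * y i) * (if i \<in> S then y i else 1))"
    by (simp add: kernel_deriv_def chi_eq_prod[OF S] prod.distrib)
  also have "\<dots> = (\<Prod>i\<in>{1..n}. if i \<in> J then (if i \<in> S then \<rho> else 0) else (if i \<in> S then \<rho> * x i else 1))"
    by (subst cube_mean_prod) (intro prod.cong, auto simp: field_simps)
  also have "\<dots> = (if J \<subseteq> S then \<rho> ^ card S * chi (S - J) x else 0)"
  proof (cases "J \<subseteq> S")
    case True
    have "(\<Prod>i\<in>{1..n}. if i \<in> J then (if i \<in> S then \<rho> else 0) else (if i \<in> S then \<rho> * x i else 1))
       = (\<Prod>i\<in>{1..n}. (if i \<in> S then \<rho> else 1) * (if i \<in> S - J then x i else 1))"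
      using True by (intro prod.cong) auto
    also have "\<dots> = (\<Prod>i\<in>{1..n}. if i \<in> S then \<rho> else 1) * chi (S - J) x"
      using S by (subst chi_eq_prod[of "S - J" n]) (auto simp: prod.distrib)
    also have "(\<Prod>i\<in>{1..n}. if i \<in> S then \<rho> else 1) = \<rho> ^ card S"
      using S by (simp add: prod.If_cases Int_absorb1)
    finally show ?thesis using True by simp
  next
    case False
    then obtain i where "i \<in> J" "i \<notin> S" by blast
    then have "(\<Prod>i\<in>{1..n}. if i \<in> J then (if i \<in> S then \<rho> else 0) else (if i \<in> S then \<rho> * x i else 1)) = 0"
      using J by (intro prod_zero) auto
    then show ?thesis using False by simp
  qed
  finally show ?thesis .
qed

lemma D_set_kernel_deriv:
  assumes J: "J \<subseteq> {1..n}"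
  shows "D_set J (fourier_sum n (noise \<rho> c)) x = cube_mean n (\<lambda>y. kernel_deriv n \<rho> x J y * fourier_sum n c y)"
proof -
  have "cube_mean n (\<lambda>y. kernel_deriv n \<rho> x J y * fourier_sum n c y)
     = cube_mean n (\<lambda>y. \<Sum>S\<in>Pow {1..n}. c S * (kernel_deriv n \<rho> x J y * chi S y))"
    by (simp add: fourier_sum_def sum_distrib_left mult_ac)
  also have "\<dots> = (\<Sum>S\<in>Pow {1..n}. if J \<subseteq> S then c S * (\<rho> ^ card S * chi (S - J) x) else 0)"
    unfolding cube_mean_sum cube_mean_cmult using J by (intro sum.cong refl) (simp add: cube_mean_kernel_deriv_chi)
  also have "\<dots> = (\<Sum>S\<in>{S\<in>Pow {1..n}. J \<subseteq> S}. c S * (\<rho> ^ card S * chi (S - J) x))"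
    by (simp only: sum.inter_filter finite_Pow_iff finite_atLeastAtMost)
  also have "{S\<in>Pow {1..n}. J \<subseteq> S} = {S. J \<subseteq> S \<and> S \<subseteq> {1..n}}" by auto
  finally show ?thesis by (simp add: D_set_fourier_sum[OF J] noise_def mult_ac)
qed

text \<open>Divided by the kernel, its derivatives are products of the variables \<open>\<rho> y\<^sub>i / (1 + \<rho> x\<^sub>i y\<^sub>i)\<close>, which
  are independent and centred under the density \<open>noise_kernel n \<rho> x\<close>. Hence they are orthogonal for
  different \<open>J\<close>.\<close>

lemma kernel_deriv_orthogonal:
  assumes x: "x \<in> cube n" and \<rho>: "0 \<le> \<rho>" "\<rho> < 1" and J: "J \<in> index_sets n k" "J' \<in> index_sets n k"
  shows "cube_mean n (\<lambda>y. kernel_deriv n \<rho> x J y * kernel_deriv n \<rho> x J' y / noise_kernel n \<rho> x y)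
    = (if J = J' then (\<rho>\<^sup>2 / (1 - \<rho>\<^sup>2)) ^ k else 0)"
proof -
  have JJ: "J \<subseteq> {1..n}" "J' \<subseteq> {1..n}" "card J = k" using J by (auto simp: index_sets_def)
  define \<phi> where "\<phi> = (\<lambda>i b. (if i \<in> J then \<rho> * b else 1 + \<rho> * x i * b) * (if i \<in> J' then \<rho> * b else 1 + \<rho> * x i * b) / (1 + \<rho> * x i * b))"
  have "\<rho>\<^sup>2 < 1" using \<rho> by (simp add: power_less_one_iff abs_square_less_1)
  have "cube_mean n (\<lambda>y. kernel_deriv n \<rho> x J y * kernel_deriv n \<rho> x J' y / noise_kernel n \<rho> x y) = cube_mean n (\<lambda>y. \<Prod>i\<in>{1..n}. \<phi> i (y i))"
    by (simp add: kernel_deriv_def noise_kernel_def \<phi>_def prod.distrib prod_dividef)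
  also have "\<dots> = (\<Prod>i\<in>{1..n}. (\<phi> i 1 + \<phi> i (-1)) / 2)" by (rule cube_mean_prod)
  also have "\<dots> = (\<Prod>i\<in>{1..n}. if i \<in> J then (if i \<in> J' then \<rho>\<^sup>2 / (1 - \<rho>\<^sup>2) else 0) else (if i \<in> J' then 0 else 1))"
  proof (intro prod.cong refl)
    fix i assume i: "i \<in> {1..n}"
    have nz: "1 + \<rho> \<noteq> 0" "1 - \<rho> \<noteq> 0" "1 - \<rho>\<^sup>2 \<noteq> 0" using \<rho> \<open>\<rho>\<^sup>2 < 1\<close> by auto
    have sq: "1 - \<rho>\<^sup>2 = (1 + \<rho>) * (1 - \<rho>)" by (simp add: algebra_simps power2_eq_square)
    have "(\<rho>\<^sup>2 / (1 + \<rho>) + \<rho>\<^sup>2 / (1 - \<rho>)) / 2 = \<rho>\<^sup>2 / (1 - \<rho>\<^sup>2)"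
      using nz unfolding sq by (simp add: divide_simps) (simp add: algebra_simps)
    then show "(\<phi> i 1 + \<phi> i (-1)) / 2 = (if i \<in> J then (if i \<in> J' then \<rho>\<^sup>2 / (1 - \<rho>\<^sup>2) else 0) else (if i \<in> J' then 0 else 1))"
      using cube_coord[OF x i] nz by (auto simp: \<phi>_def power2_eq_square add.commute)
  qed
  also have "\<dots> = (if J = J' then (\<rho>\<^sup>2 / (1 - \<rho>\<^sup>2)) ^ k else 0)"
  proof (cases "J = J'")
    case True
    then have "(\<Prod>i\<in>{1..n}. if i \<in> J then (if i \<in> J' then \<rho>\<^sup>2 / (1 - \<rho>\<^sup>2) else 0) else (if i \<in> J' then 0 else 1))
       = (\<Prod>i\<in>{1..n}. if i \<in> J then \<rho>\<^sup>2 / (1 - \<rho>\<^sup>2) else 1)" by (intro prod.cong) auto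
    also have "\<dots> = (\<rho>\<^sup>2 / (1 - \<rho>\<^sup>2)) ^ k" using JJ by (simp add: prod.If_cases Int_absorb1)
    finally show ?thesis using True by simp
  next
    case False
    then obtain i where "i \<in> {1..n}" "(i \<in> J) \<noteq> (i \<in> J')" using JJ by blast
    then have "(\<Prod>i\<in>{1..n}. if i \<in> J then (if i \<in> J' then \<rho>\<^sup>2 / (1 - \<rho>\<^sup>2) else 0) else (if i \<in> J' then 0 else 1)) = 0"
      by (intro prod_zero) auto
    then show ?thesis using False by simp
  qed
  finally show ?thesis .
qed

text \<open>Bessel's inequality for the orthogonal system of \<open>kernel_deriv_orthogonal\<close>, applied to a function bounded
  by \<open>1\<close>.\<close>

lemma grad_abs_noise_sup:
  assumes x: "x \<in> cube n" and \<rho>: "0 \<le> \<rho>" "\<rho> < 1"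
    and f: "\<And>y. y \<in> cube n \<Longrightarrow> \<bar>fourier_sum n c y\<bar> \<le> 1"
  shows "(grad_abs n k (fourier_sum n (noise \<rho> c)) x)\<^sup>2 \<le> (\<rho>\<^sup>2 / (1 - \<rho>\<^sup>2)) ^ k"
proof -
  define F where "F = fourier_sum n c"
  define K where "K = noise_kernel n \<rho> x"
  define u where "u = (\<lambda>J. D_set J (fourier_sum n (noise \<rho> c)) x)"
  define H where "H = (\<lambda>y. \<Sum>J\<in>index_sets n k. u J * kernel_deriv n \<rho> x J y)"
  define N where "N = (\<Sum>J\<in>index_sets n k. (u J)\<^sup>2)"
  define \<beta> where "\<beta> = (\<rho>\<^sup>2 / (1 - \<rho>\<^sup>2)) ^ k"
  have K: "K y > 0" if "y \<in> cube n" for y unfolding K_def by (rule noise_kernel_pos[OF x that \<rho>])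
  have u: "u J = cube_mean n (\<lambda>y. kernel_deriv n \<rho> x J y * F y)" if "J \<in> index_sets n k" for J
    unfolding u_def F_def using that by (intro D_set_kernel_deriv) (auto simp: index_sets_def)
  have "\<rho>\<^sup>2 < 1" using \<rho> by (simp add: abs_square_less_1)
  then have \<beta>: "\<beta> \<ge> 0" unfolding \<beta>_def by simp
  have N: "N = cube_mean n (\<lambda>y. F y * H y)"
  proof -
    have "N = (\<Sum>J\<in>index_sets n k. u J * cube_mean n (\<lambda>y. kernel_deriv n \<rho> x J y * F y))"
      unfolding N_def by (intro sum.cong refl) (simp add: power2_eq_square u)
    then show ?thesis
      unfolding H_def sum_distrib_left cube_mean_sum by (simp add: cube_mean_cmult[symmetric] mult_ac)
  qed
  have HH: "cube_mean n (\<lambda>y. (H y)\<^sup>2 / K y) = \<beta> * N"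
  proof -
    have "cube_mean n (\<lambda>y. (H y)\<^sup>2 / K y) = (\<Sum>J\<in>index_sets n k. \<Sum>J'\<in>index_sets n k.
        u J * u J' * cube_mean n (\<lambda>y. kernel_deriv n \<rho> x J y * kernel_deriv n \<rho> x J' y / K y))"
      unfolding H_def power2_eq_square sum_product sum_divide_distrib cube_mean_sum
      by (intro sum.cong refl) (simp add: cube_mean_cmult[symmetric] mult_ac)
    also have "\<dots> = (\<Sum>J\<in>index_sets n k. \<Sum>J'\<in>index_sets n k. if J = J' then \<beta> * (u J)\<^sup>2 else 0)"
      unfolding K_def
      by (intro sum.cong refl, subst kernel_deriv_orthogonal[OF x \<rho>]) (auto simp: \<beta>_def power2_eq_square)
    also have "\<dots> = \<beta> * N" by (simp add: N_def sum_distrib_left)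
    finally show ?thesis .
  qed
  have "N\<^sup>2 = (cube_mean n (\<lambda>y. (F y * sqrt (K y)) * (H y / sqrt (K y))))\<^sup>2"
    unfolding N using K by (intro arg_cong[where f = "\<lambda>z. z\<^sup>2"] cube_mean_cong) (auto simp: less_imp_neq[symmetric])
  also have "\<dots> \<le> cube_mean n (\<lambda>y. (F y * sqrt (K y))\<^sup>2) * cube_mean n (\<lambda>y. (H y / sqrt (K y))\<^sup>2)"
    by (rule cube_mean_Cauchy_Schwarz)
  also have "cube_mean n (\<lambda>y. (H y / sqrt (K y))\<^sup>2) = \<beta> * N"
    unfolding HH[symmetric] using K by (intro cube_mean_cong) (auto simp: power_divide less_imp_le)
  also have "cube_mean n (\<lambda>y. (F y * sqrt (K y))\<^sup>2) \<le> cube_mean n K"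
  proof (rule cube_mean_mono)
    fix y assume y: "y \<in> cube n"
    have "(F y)\<^sup>2 \<le> 1" using f[OF y] by (simp add: F_def abs_square_le_1)
    then have "(F y)\<^sup>2 * K y \<le> 1 * K y" using K[OF y] by (intro mult_right_mono) auto
    then show "(F y * sqrt (K y))\<^sup>2 \<le> K y" using K[OF y] by (simp add: power_mult_distrib)
  qed
  also have "cube_mean n K = 1" unfolding K_def by (rule cube_mean_noise_kernel)
  finally have "N * N \<le> \<beta> * N"
    using \<beta> by (simp add: power2_eq_square mult_right_mono N_def sum_nonneg)
  moreover have "N \<ge> 0" by (simp add: N_def sum_nonneg)
  ultimately have "N \<le> \<beta>" using \<beta> by (cases "N = 0") auto
  then show ?thesis by (simp add: grad_abs_sq N_def u_def \<beta>_def)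
qed

section \<open>Orthogonality to the null space, and the energy of the gradient\<close>

lemma fourier_diff: "fourier n (\<lambda>x. f x - g x) S = fourier n f S - fourier n g S"
  by (simp add: fourier_def left_diff_distrib cube_mean_diff)

lemma fourier_fourier_sum:
  assumes "S \<subseteq> {1..n}" shows "fourier n (fourier_sum n c) S = c S"
proof -
  have "fourier n (fourier_sum n c) S = (\<Sum>T\<in>Pow {1..n}. c T * cube_mean n (\<lambda>x. chi T x * chi S x))"
    unfolding fourier_def fourier_sum_def sum_distrib_right cube_mean_sum by (simp add: cube_mean_cmult[symmetric] mult.assoc)
  also have "\<dots> = (\<Sum>T\<in>Pow {1..n}. if T = S then c S else 0)"
    using assms by (intro sum.cong refl) (auto simp: chi_orthonormal)
  finally show ?thesis using assms by simp
qed

lemma Parseval: "cube_mean n (\<lambda>x. fourier_sum n c x * fourier_sum n d x) = (\<Sum>S\<in>Pow {1..n}. c S * d S)"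
  using cube_mean_partial_sums[of "Pow {1..n}" "{}" n c d] by (auto simp: fourier_sum_def)

lemma D_set_fourier:
  assumes "J \<subseteq> {1..n}" "x \<in> cube n"
  shows "D_set J h x = (\<Sum>S\<in>{S. J \<subseteq> S \<and> S \<subseteq> {1..n}}. fourier n h S * chi (S - J) x)"
proof -
  have "D_set J h x = D_set J (fourier_sum n (fourier n h)) x"
    by (rule D_set_cong[OF assms(1) _ assms(2)]) (simp add: Fourier_expansion)
  then show ?thesis by (simp add: D_set_fourier_sum[OF assms(1)])
qed

text \<open>If \<open>k \<le> card S\<close>, then some \<open>J \<subseteq> S\<close> of size \<open>k\<close> has \<open>D_set J h = 0\<close>, and the coefficient at \<open>S\<close> is a
  coefficient of this derivative.\<close>

lemma grad_null_iff:
  "h \<in> grad_null n k \<longleftrightarrow> (\<forall>S\<subseteq>{1..n}. k \<le> card S \<longrightarrow> fourier n h S = 0)"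
proof
  assume h: "h \<in> grad_null n k"
  show "\<forall>S\<subseteq>{1..n}. k \<le> card S \<longrightarrow> fourier n h S = 0"
  proof (intro allI impI)
    fix S assume S: "S \<subseteq> {1..n}" "k \<le> card S"
    obtain J where J: "J \<subseteq> S" "card J = k" using S(2) by (meson obtain_subset_with_card_n)
    define A where "A = {S. J \<subseteq> S \<and> S \<subseteq> {1..n}}"
    have A: "finite A" unfolding A_def by (rule finite_supersets)
    have Jn: "J \<subseteq> {1..n}" using J S by blast
    have "(\<Sum>S\<in>A. fourier n h S * fourier n h S) =
       cube_mean n (\<lambda>x. (\<Sum>S\<in>A. fourier n h S * chi (S - J) x) * (\<Sum>S\<in>A. fourier n h S * chi (S - J) x))"
      by (rule cube_mean_partial_sums[symmetric]) (use A in \<open>auto simp: A_def\<close>)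
    also have "\<dots> = cube_mean n (\<lambda>x. D_set J h x * D_set J h x)"
      by (rule cube_mean_cong) (simp add: D_set_fourier[OF Jn] A_def)
    also have "\<dots> = cube_mean n (\<lambda>x. 0)"
      using h Jn J(2) by (intro cube_mean_cong) (auto simp: grad_null_def)
    finally have "(\<Sum>S\<in>A. fourier n h S * fourier n h S) = 0" by (simp add: cube_mean_const)
    then have "\<forall>S\<in>A. fourier n h S * fourier n h S = 0" using A by (subst (asm) sum_nonneg_eq_0_iff) auto
    then show "fourier n h S = 0" using J S by (simp add: A_def)
  qed
next
  assume h: "\<forall>S\<subseteq>{1..n}. k \<le> card S \<longrightarrow> fourier n h S = 0"
  show "h \<in> grad_null n k"
    unfolding grad_null_def
  proof (intro CollectI allI impI ballI)
    fix J x assume J: "J \<subseteq> {1..n}" "card J = k" and x: "x \<in> cube n"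
    have "fourier n h S = 0" if "J \<subseteq> S" "S \<subseteq> {1..n}" for S
    proof -
      have "finite S" using that finite_subset by blast
      then have "k \<le> card S" using that J card_mono by blast
      then show ?thesis using h that by blast
    qed
    then show "D_set J h x = 0" by (simp add: D_set_fourier[OF J(1) x])
  qed
qed

definition upper_fourier :: "nat \<Rightarrow> nat \<Rightarrow> ((nat \<Rightarrow> real) \<Rightarrow> real) \<Rightarrow> nat set \<Rightarrow> real" where
  "upper_fourier n k f S = (if k \<le> card S then fourier n f S else 0)"

text \<open>The null space is spanned by the characters of degree less than \<open>k\<close>, so the orthogonal complement keeps
  exactly the other coefficients.\<close>

lemma upper_part_eq: "upper_part n k f = restrict (fourier_sum n (upper_fourier n k f)) (cube n)"
proof -
  define g0 where "g0 = restrict (fourier_sum n (upper_fourier n k f)) (cube n)"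
  have hat0: "fourier n g0 S = upper_fourier n k f S" if "S \<subseteq> {1..n}" for S
  proof -
    have "fourier n g0 S = fourier n (fourier_sum n (upper_fourier n k f)) S"
      unfolding fourier_def by (rule cube_mean_cong) (simp add: g0_def)
    then show ?thesis using that by (simp add: fourier_fourier_sum)
  qed
  have null0: "(\<lambda>x. f x - g0 x) \<in> grad_null n k"
    unfolding grad_null_iff by (simp add: fourier_diff hat0 upper_fourier_def)
  have orth0: "cube_inner n g0 h = 0" if "h \<in> grad_null n k" for h
  proof -
    have "cube_inner n g0 h = cube_mean n (\<lambda>x. fourier_sum n (upper_fourier n k f) x * fourier_sum n (fourier n h) x)"
      unfolding cube_inner_def integral_cube by (rule cube_mean_cong) (simp add: g0_def Fourier_expansion)
    also have "\<dots> = 0"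
      unfolding Parseval using that by (intro sum.neutral) (auto simp: grad_null_iff upper_fourier_def)
    finally show ?thesis .
  qed
  show ?thesis
    unfolding upper_part_def g0_def[symmetric]
  proof (rule the_equality, intro conjI ballI)
    show "g0 \<in> extensional (cube n)" by (simp add: g0_def)
    show "(\<lambda>x. f x - g0 x) \<in> grad_null n k" by (rule null0)
    show "cube_inner n g0 h = 0" if "h \<in> grad_null n k" for h by (rule orth0[OF that])
  next
    fix g
    assume g: "g \<in> extensional (cube n) \<and> (\<lambda>x. f x - g x) \<in> grad_null n k \<and> (\<forall>h\<in>grad_null n k. cube_inner n g h = 0)"
    define d where "d = (\<lambda>x. g x - g0 x)"
    have "fourier n d S = 0" if "S \<subseteq> {1..n}" "k \<le> card S" for S
    proof -
      have "fourier n f S - fourier n g S = 0" "fourier n f S - fourier n g0 S = 0"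
        using g null0 that unfolding grad_null_iff fourier_diff by blast+
      then show ?thesis by (simp add: d_def fourier_diff)
    qed
    then have d: "d \<in> grad_null n k" by (simp add: grad_null_iff)
    have "cube_inner n g d - cube_inner n g0 d = 0" using g d orth0 by simp
    then have "cube_mean n (\<lambda>x. d x * d x) = 0"
      unfolding cube_inner_def integral_cube by (simp add: d_def left_diff_distrib cube_mean_diff)
    then have "d x = 0" if "x \<in> cube n" for x
      using cube_mean_nonneg_eq_0[of n "\<lambda>x. d x * d x" x] that by simp
    then show "g = g0"
      using g by (intro extensionalityI[of _ "cube n"]) (auto simp: d_def g0_def)
  qed
qed

lemma cube_norm_powr:
  assumes "p \<ge> 1"
  shows "cube_norm n p g powr p = cube_mean n (\<lambda>x. \<bar>g x\<bar> powr p)"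
proof -
  have "cube_mean n (\<lambda>x. \<bar>g x\<bar> powr p) \<ge> 0" by (rule cube_mean_nonneg) simp
  then show ?thesis using assms by (simp add: cube_norm_def integral_cube powr_powr)
qed

lemma W_eq: "W n k f = (\<Sum>S\<in>{S\<in>Pow {1..n}. k \<le> card S}. (fourier n f S)\<^sup>2)"
proof -
  have nn: "cube_norm n 2 g \<ge> 0" for g by (simp add: cube_norm_def)
  have "W n k f = cube_norm n 2 (upper_part n k f) powr 2"
    using nn[of "upper_part n k f"] by (simp add: W_def)
  also have "\<dots> = cube_mean n (\<lambda>x. \<bar>upper_part n k f x\<bar> powr 2)" by (rule cube_norm_powr) simp
  also have "\<dots> = cube_mean n (\<lambda>x. fourier_sum n (upper_fourier n k f) x * fourier_sum n (upper_fourier n k f) x)"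
    by (rule cube_mean_cong) (simp add: upper_part_eq power2_eq_square)
  also have "\<dots> = (\<Sum>S\<in>Pow {1..n}. if k \<le> card S then (fourier n f S)\<^sup>2 else 0)"
    unfolding Parseval by (intro sum.cong refl) (simp add: upper_fourier_def power2_eq_square)
  also have "\<dots> = (\<Sum>S\<in>{S\<in>Pow {1..n}. k \<le> card S}. (fourier n f S)\<^sup>2)"
    by (simp only: sum.inter_filter finite_Pow_iff finite_atLeastAtMost)
  finally show ?thesis .
qed

lemma W_nonneg: "W n k f \<ge> 0"
  by (simp add: W_def)

lemma W_le: "W n k f \<le> cube_mean n (\<lambda>x. (f x)\<^sup>2)"
proof -
  have "W n k f \<le> (\<Sum>S\<in>Pow {1..n}. (fourier n f S)\<^sup>2)"
    unfolding W_eq by (rule sum_mono2) auto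
  also have "\<dots> = cube_mean n (\<lambda>x. fourier_sum n (fourier n f) x * fourier_sum n (fourier n f) x)"
    unfolding Parseval by (simp add: power2_eq_square)
  also have "\<dots> = cube_mean n (\<lambda>x. (f x)\<^sup>2)"
    by (rule cube_mean_cong) (simp add: Fourier_expansion power2_eq_square)
  finally show ?thesis .
qed

definition energy :: "nat \<Rightarrow> nat \<Rightarrow> (nat set \<Rightarrow> real) \<Rightarrow> real \<Rightarrow> real" where
  "energy n k c t = (\<Sum>S\<in>Pow {1..n}. real (card S choose k) * (c S)\<^sup>2 * exp (- t * real (card S)))"

definition energy' :: "nat \<Rightarrow> nat \<Rightarrow> (nat set \<Rightarrow> real) \<Rightarrow> real \<Rightarrow> real" where
  "energy' n k c t = (\<Sum>S\<in>Pow {1..n}. - real (card S) * (real (card S choose k) * (c S)\<^sup>2 * exp (- t * real (card S))))"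

lemma energy_deriv: "(energy n k c has_real_derivative energy' n k c t) (at t)"
  unfolding energy_def[abs_def] energy'_def
  by (auto intro!: derivative_eq_intros sum.cong simp: mult_ac)

lemma energy'_le: "energy' n k c t \<le> - real k * energy n k c t"
  unfolding energy_def energy'_def sum_distrib_left
proof (rule sum_mono)
  fix S :: "nat set"
  show "- real (card S) * (real (card S choose k) * (c S)\<^sup>2 * exp (- t * real (card S)))
    \<le> - real k * (real (card S choose k) * (c S)\<^sup>2 * exp (- t * real (card S)))"
  proof (cases "card S < k")
    case False
    then show ?thesis by (intro mult_right_mono) auto
  qed (simp add: binomial_eq_0)
qed

text \<open>The energy is the inner product of the gradient with the gradient after noise. The latter is bounded
  pointwise by \<open>b\<close>, and its \<open>p\<close>-th moment is no larger than that of the former, so Young's inequality applied to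
  \<open>g * h \<le> b powr (2 - p) * (g * h powr (p - 1))\<close> gives the claim.\<close>

lemma energy_le_moment:
  assumes t: "t > 0" and p: "1 \<le> p" "p < 2"
    and f: "\<And>y. y \<in> cube n \<Longrightarrow> \<bar>fourier_sum n c y\<bar> \<le> 1"
  shows "energy n k c t \<le> ((2 * t) powr (- (1 - p / 2))) ^ k * cube_mean n (\<lambda>x. grad_abs n k (fourier_sum n c) x powr p)"
proof -
  define \<rho> where "\<rho> = exp (- t)"
  define g where "g = grad_abs n k (fourier_sum n c)"
  define h where "h = grad_abs n k (fourier_sum n (noise \<rho> c))"
  define b where "b = sqrt ((\<rho>\<^sup>2 / (1 - \<rho>\<^sup>2)) ^ k)"
  have \<rho>: "0 < \<rho>" "\<rho> < 1" using t by (auto simp: \<rho>_def)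
  have gh: "g x \<ge> 0" "h x \<ge> 0" for x by (simp_all add: g_def h_def grad_abs_nonneg)
  have hb: "h x \<le> b" if "x \<in> cube n" for x
    unfolding b_def h_def using \<rho> f that by (intro real_le_rsqrt grad_abs_noise_sup) auto
  have "energy n k c t = (\<Sum>S\<in>Pow {1..n}. real (card S choose k) * (c S * noise \<rho> c S))"
    unfolding energy_def
  proof (intro sum.cong refl)
    fix S :: "nat set"
    have "exp (- t * real (card S)) = \<rho> ^ card S"
      by (simp add: \<rho>_def mult.commute flip: exp_of_nat_mult)
    then show "real (card S choose k) * (c S)\<^sup>2 * exp (- t * real (card S)) = real (card S choose k) * (c S * noise \<rho> c S)"
      by (simp add: noise_def power2_eq_square)
  qed
  also have "\<dots> = cube_mean n (\<lambda>x. \<Sum>J\<in>index_sets n k. D_set J (fourier_sum n c) x * D_set J (fourier_sum n (noise \<rho> c)) x)"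
    unfolding cube_mean_sum by (rule grad_inner[symmetric])
  also have "\<dots> \<le> cube_mean n (\<lambda>x. b powr (2 - p) * (1 / p * g x powr p + (1 - 1 / p) * h x powr p))"
  proof (rule cube_mean_mono)
    fix x assume x: "x \<in> cube n"
    have "(\<Sum>J\<in>index_sets n k. D_set J (fourier_sum n c) x * D_set J (fourier_sum n (noise \<rho> c)) x)
       \<le> (\<Sum>J\<in>index_sets n k. \<bar>D_set J (fourier_sum n c) x\<bar> * \<bar>D_set J (fourier_sum n (noise \<rho> c)) x\<bar>)"
      by (intro sum_mono) (metis abs_ge_self abs_mult)
    also have "\<dots> \<le> g x * h x" unfolding g_def h_def grad_abs_L2 by (rule L2_set_mult_ineq)
    also have "h x = h x powr (2 - p) * h x powr (p - 1)"
      using gh(2)[of x] by (cases "h x = 0") (auto simp flip: powr_add)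
    also have "g x * (h x powr (2 - p) * h x powr (p - 1)) = h x powr (2 - p) * (g x * h x powr (p - 1))" by simp
    also have "\<dots> \<le> b powr (2 - p) * (g x powr p / p + (1 - 1 / p) * h x powr p)"
      using p gh hb[OF x] by (intro mult_mono powr_mono2 powr_Young) auto
    finally show "(\<Sum>J\<in>index_sets n k. D_set J (fourier_sum n c) x * D_set J (fourier_sum n (noise \<rho> c)) x)
      \<le> b powr (2 - p) * (1 / p * g x powr p + (1 - 1 / p) * h x powr p)" by simp
  qed
  also have "\<dots> = b powr (2 - p) * (1 / p * cube_mean n (\<lambda>x. g x powr p) + (1 - 1 / p) * cube_mean n (\<lambda>x. h x powr p))"
    by (simp only: cube_mean_cmult cube_mean_add)
  also have "\<dots> \<le> b powr (2 - p) * (1 / p * cube_mean n (\<lambda>x. g x powr p) + (1 - 1 / p) * cube_mean n (\<lambda>x. g x powr p))"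
  proof -
    have "cube_mean n (\<lambda>x. h x powr p) \<le> (\<rho> ^ k) powr p * cube_mean n (\<lambda>x. g x powr p)"
      unfolding g_def h_def using \<rho> p by (intro grad_abs_noise_moment) auto
    also have "\<dots> \<le> 1 * cube_mean n (\<lambda>x. g x powr p)"
      using \<rho> p by (intro mult_right_mono powr_le1 cube_mean_nonneg) (auto simp: power_le_one)
    finally have "cube_mean n (\<lambda>x. h x powr p) \<le> cube_mean n (\<lambda>x. g x powr p)" by simp
    then show ?thesis using p by (intro mult_left_mono add_left_mono) auto
  qed
  also have "\<dots> = b powr (2 - p) * cube_mean n (\<lambda>x. g x powr p)" by (simp add: left_diff_distrib)
  also have "\<dots> \<le> ((2 * t) powr (- (1 - p / 2))) ^ k * cube_mean n (\<lambda>x. g x powr p)"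
  proof (intro mult_right_mono cube_mean_nonneg)
    define \<beta> where "\<beta> = \<rho>\<^sup>2 / (1 - \<rho>\<^sup>2)"
    have \<rho>2: "\<rho>\<^sup>2 = exp (- (2 * t))" by (simp add: \<rho>_def flip: exp_double)
    have lt: "\<rho>\<^sup>2 < 1" unfolding \<rho>2 using t by simp
    have \<beta>: "\<beta> > 0" using \<rho> lt by (simp add: \<beta>_def)
    have "2 * t \<le> exp (2 * t) - 1" using exp_ge_add_one_self[of "2 * t"] by linarith
    also have "\<dots> = 1 / \<beta>" using lt by (simp add: \<beta>_def \<rho>2 exp_minus field_simps)
    finally have "\<beta> \<le> 1 / (2 * t)" using \<beta> t by (simp add: field_simps)
    have "b powr (2 - p) = (\<beta> ^ k) powr (1 / 2 * (2 - p))"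
      using \<beta> by (simp add: b_def \<beta>_def[symmetric] powr_half_sqrt[symmetric] powr_powr)
    also have "\<dots> = (\<beta> powr (1 - p / 2)) ^ k"
      using \<beta> by (simp add: powr_powr mult.commute diff_divide_distrib flip: powr_realpow)
    also have "\<dots> \<le> ((1 / (2 * t)) powr (1 - p / 2)) ^ k"
      using \<beta> p \<open>\<beta> \<le> 1 / (2 * t)\<close> by (intro power_mono powr_mono2) auto
    also have "(1 / (2 * t)) powr (1 - p / 2) = (2 * t) powr (- (1 - p / 2))"
      using t by (simp only: powr_minus powr_divide powr_one_eq_one inverse_eq_divide)
    finally show "b powr (2 - p) \<le> ((2 * t) powr (- (1 - p / 2))) ^ k" .
  qed simp
  finally show ?thesis by (simp add: g_def)
qed

text \<open>The length of a vector is a contraction.\<close>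

lemma D_grad_abs_sq_le:
  "(D i (grad_abs n k F) x)\<^sup>2 \<le> (\<Sum>J\<in>index_sets n k. (D i (D_set J F) x)\<^sup>2)"
proof -
  define u where "u = (\<lambda>J. D_set J F (x(i := 1)))"
  define w where "w = (\<lambda>J. D_set J F (x(i := - 1)))"
  have 1: "L2_set u (index_sets n k) \<le> L2_set (\<lambda>J. u J - w J) (index_sets n k) + L2_set w (index_sets n k)"
    using L2_set_triangle_ineq[of "\<lambda>J. u J - w J" w "index_sets n k"] by simp
  have 2: "L2_set w (index_sets n k) \<le> L2_set (\<lambda>J. u J - w J) (index_sets n k) + L2_set u (index_sets n k)"
    using L2_set_triangle_ineq[of "\<lambda>J. w J - u J" u "index_sets n k"]
    by (simp add: L2_set_def power2_commute)
  have "(L2_set u (index_sets n k) - L2_set w (index_sets n k))\<^sup>2 \<le> (L2_set (\<lambda>J. u J - w J) (index_sets n k))\<^sup>2"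
    using 1 2 by (intro abs_le_square_iff[THEN iffD1]) (auto simp: abs_le_iff)
  also have "\<dots> = (\<Sum>J\<in>index_sets n k. (u J - w J)\<^sup>2)" by (simp add: L2_set_def sum_nonneg)
  finally show ?thesis
    by (simp add: D_def grad_abs_L2 u_def w_def power_divide sum_divide_distrib[symmetric] divide_right_mono)
qed

text \<open>The noise with parameter \<open>exp (- t / 2)\<close> makes \<open>energy n k c t\<close> the second moment of the gradient, and
  the Dirichlet form of its length is at most \<open>- energy' - k * energy\<close>.\<close>

lemma moment_ge_energy:
  assumes t: "t \<ge> 0" and p: "1 \<le> p" "p < 2" and V: "energy n k c t > 0"
  shows "exp (- t * real k * p / 2) * cube_mean n (\<lambda>x. grad_abs n k (fourier_sum n c) x powr p)
     \<ge> energy n k c t powr (p / 2) *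
        exp ((2 - p) * (energy' n k c t / energy n k c t + real k))"
proof -
  define \<rho> where "\<rho> = exp (- t / 2)"
  define G where "G = grad_abs n k (fourier_sum n (noise \<rho> c))"
  define V where "V = energy n k c t"
  define X where "X = (\<Sum>i\<in>{1..n}. cube_mean n (\<lambda>x. (D i G x)\<^sup>2))"
  have Vpos: "V > 0" using assms(4) by (simp add: V_def)
  have \<rho>: "0 < \<rho>" "\<rho> \<le> 1" using t by (auto simp: \<rho>_def)
  have pw: "(\<rho> ^ m)\<^sup>2 = exp (- t * real m)" for m
  proof -
    have "(\<rho> ^ m)\<^sup>2 = (\<rho>\<^sup>2) ^ m" by (simp add: power_even_eq[symmetric] mult.commute power_mult[symmetric])
    also have "\<rho>\<^sup>2 = exp (- t)" by (simp add: \<rho>_def flip: exp_double)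
    finally show ?thesis by (simp add: mult.commute flip: exp_of_nat_mult)
  qed
  have noise: "(noise \<rho> c S)\<^sup>2 = (c S)\<^sup>2 * exp (- t * real (card S))" for S
    by (simp add: noise_def power_mult_distrib pw mult.commute)
  have EG: "cube_mean n (\<lambda>x. (G x)\<^sup>2) = V"
  proof -
    have "cube_mean n (\<lambda>x. (G x)\<^sup>2) = (\<Sum>S\<in>Pow {1..n}. real (card S choose k) * (noise \<rho> c S * noise \<rho> c S))"
      unfolding G_def grad_abs_sq cube_mean_sum grad_inner[symmetric] by (simp add: power2_eq_square)
    then show ?thesis unfolding V_def energy_def by (simp add: noise power2_eq_square[symmetric] mult.assoc)
  qed
  have "X \<le> (\<Sum>i\<in>{1..n}. \<Sum>J\<in>index_sets n k. cube_mean n (\<lambda>x. (D i (D_set J (fourier_sum n (noise \<rho> c))) x)\<^sup>2))"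
    unfolding X_def cube_mean_sum[symmetric] by (intro sum_mono cube_mean_mono) (simp add: G_def D_grad_abs_sq_le)
  also have "\<dots> = (\<Sum>S\<in>Pow {1..n}. real (card S choose k) * ((real (card S) - real k) * (noise \<rho> c S)\<^sup>2))"
    by (rule grad_dirichlet)
  also have "\<dots> = - energy' n k c t - real k * V"
    unfolding V_def energy_def energy'_def noise sum_distrib_left sum_negf[symmetric] sum_subtractf[symmetric]
    by (intro sum.cong refl) (simp add: algebra_simps)
  finally have "X / V \<le> (- energy' n k c t - real k * V) / V" using Vpos by (intro divide_right_mono) auto
  also have "\<dots> = - (energy' n k c t / V + real k)" using Vpos by (simp add: field_simps)
  finally have "(2 - p) * (X / V) \<le> (2 - p) * (- (energy' n k c t / V + real k))"
    using p by (intro mult_left_mono) auto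
  moreover have "- (2 - p) * X / V = - ((2 - p) * (X / V))"
    by (simp add: algebra_simps diff_divide_distrib)
  ultimately have "(2 - p) * (energy' n k c t / V + real k) \<le> - (2 - p) * X / V"
    by (simp only: mult_minus_right le_minus_iff)
  then have "V powr (p / 2) * exp ((2 - p) * (energy' n k c t / V + real k)) \<le> V powr (p / 2) * exp (- (2 - p) * X / V)"
    by (intro mult_left_mono) auto
  also have "\<dots> \<le> cube_mean n (\<lambda>x. G x powr p)"
    unfolding X_def by (rule moment_lower_bound[OF _ EG Vpos p]) (simp add: G_def grad_abs_nonneg)
  also have "\<dots> \<le> (\<rho> ^ k) powr p * cube_mean n (\<lambda>x. grad_abs n k (fourier_sum n c) x powr p)"
  proof (cases "\<rho> = 1")
    case True
    then have "noise \<rho> c = c" by (simp add: noise_def[abs_def])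
    then show ?thesis using True by (simp add: G_def)
  next
    case False
    then show ?thesis unfolding G_def using \<rho> p by (intro grad_abs_noise_moment) auto
  qed
  also have "(\<rho> ^ k) powr p = exp (- t * real k * p / 2)"
  proof -
    have "(\<rho> ^ k) powr p = exp (p * ln (\<rho> ^ k))" using \<rho> by (simp add: powr_def)
    also have "ln (\<rho> ^ k) = real k * (- t / 2)" using \<rho> by (simp add: ln_realpow \<rho>_def)
    finally show ?thesis by (simp add: mult_ac)
  qed
  finally show ?thesis by (simp add: V_def)
qed

section \<open>Proof of the theorem\<close>

text \<open>Used with \<open>X S = d/k * exp (- t d/k)\<close> and \<open>Y S = (d choose k) * exp (- t d)\<close> for \<open>d = card S\<close>. It bounds the
  energy from below by its analogue for \<open>k = 1\<close> with frequencies \<open>d/k\<close>.\<close>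

lemma power_mean_profile:
  fixes w :: "'a \<Rightarrow> real" and A :: "'a set"
  assumes A: "finite A" "A \<noteq> {}" and w: "\<And>S. S \<in> A \<Longrightarrow> w S \<ge> 0" "(\<Sum>S\<in>A. w S) = 1"
    and k: "k \<ge> 1" and X: "\<And>S. S \<in> A \<Longrightarrow> X S \<ge> (0 :: real)"
    and Y: "\<And>S. S \<in> A \<Longrightarrow> X S ^ k \<le> Y S"
  shows "(\<Sum>S\<in>A. w S * X S) \<le> (\<Sum>S\<in>A. w S * Y S) powr (1 / real k)"
proof -
  have conv: "convex_on {0::real..} (\<lambda>x. x ^ k)"
    using convex_power_odd[of k] convex_on_subset[OF convex_power_even[of k]] by (cases "even k") auto
  have "(\<Sum>S\<in>A. w S *\<^sub>R X S) ^ k \<le> (\<Sum>S\<in>A. w S * X S ^ k)"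
    by (rule convex_on_sum[OF A conv w(2) w(1)]) (use X in auto)
  also have "\<dots> \<le> (\<Sum>S\<in>A. w S * Y S)" by (intro sum_mono mult_left_mono Y w)
  finally have 1: "(\<Sum>S\<in>A. w S * X S) ^ k \<le> (\<Sum>S\<in>A. w S * Y S)" by simp
  have nn: "(\<Sum>S\<in>A. w S * X S) \<ge> 0" by (intro sum_nonneg mult_nonneg_nonneg w X)
  have "(\<Sum>S\<in>A. w S * X S) = ((\<Sum>S\<in>A. w S * X S) ^ k) powr (1 / real k)"
  proof (cases "(\<Sum>S\<in>A. w S * X S) = 0")
    case False
    then show ?thesis using nn k by (simp add: powr_powr flip: powr_realpow)
  qed (use k in simp)
  also have "\<dots> \<le> (\<Sum>S\<in>A. w S * Y S) powr (1 / real k)"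
    using 1 nn by (intro powr_mono2) auto
  finally show ?thesis .
qed

text \<open>The normalised energy is fed into \<open>spectral_profile_bound\<close>. The letter \<open>Z\<close> there is chosen so that
  \<open>a * Z + ln R = a * (1 + \<zeta>)\<close>, which is how \<open>\<zeta>\<close> enters the differential inequality.\<close>

lemma gradient_moment_bound:
  assumes k: "1 \<le> k" and f: "f \<in> cube n \<rightarrow> {-1..1}" and p: "1 \<le> p" "p < 2"
    and Wpos: "W n k f > 0"
  shows "cube_mean n (\<lambda>x. grad_abs n k f x powr p)
     \<ge> C p ^ k * W n k f * (1 + 1 / (2 * real k) * ln (1 / W n k f)) powr (real k * p / 2)"
proof -
  define c where "c = fourier n f"
  define \<alpha> where "\<alpha> = 1 - p / 2"
  define \<gamma> where "\<gamma> = p / 2"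
  define a where "a = 2 * \<alpha> / (1 - \<alpha>)"
  define w where "w = W n k f"
  define V where "V = energy n k c"
  define V' where "V' = energy' n k c"
  define A where "A = cube_mean n (\<lambda>x. grad_abs n k (fourier_sum n c) x powr p)"
  define R where "R = (A / w) powr (1 / (real k * \<gamma>))"
  define \<zeta> where "\<zeta> = 1 / (2 * real k) * ln (1 / w)"
  define Z where "Z = 1 + \<zeta> - ln R / a"
  define Sk where "Sk = {S\<in>Pow {1..n}. k \<le> card S}"
  define q where "q = (\<lambda>t. (V t / w) powr (1 / real k))"
  define q' where "q' = (\<lambda>t. q t * (V' t / (real k * V t)))"
  define \<eta> where "\<eta> = (\<lambda>t. \<Sum>S\<in>Sk. (c S)\<^sup>2 / w * exp (- t * (real (card S) / real k)))"
  define \<eta>' where "\<eta>' = (\<lambda>t. \<Sum>S\<in>Sk. (c S)\<^sup>2 / w * (- (real (card S) / real k) * exp (- t * (real (card S) / real k))))"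
  have \<alpha>: "0 < \<alpha>" "\<alpha> \<le> 1/2" and \<alpha>\<gamma>: "1 - \<alpha> = \<gamma>" "2 - p = 2 * \<alpha>" and \<gamma>: "\<gamma> > 0"
    using p by (auto simp: \<alpha>_def \<gamma>_def)
  have a: "a > 0" using \<alpha> by (simp add: a_def)
  have kpos: "real k > 0" using k by simp
  have w: "w > 0" using Wpos by (simp add: w_def)
  have w_eq: "w = (\<Sum>S\<in>Sk. (c S)\<^sup>2)" by (simp add: w_def W_eq c_def Sk_def)
  have Sk: "finite Sk" by (simp add: Sk_def)
  have F: "fourier_sum n c x = f x" if "x \<in> cube n" for x
    unfolding c_def using that by (rule Fourier_expansion)
  have A_eq: "cube_mean n (\<lambda>x. grad_abs n k f x powr p) = A"
    unfolding A_def by (intro cube_mean_cong) (simp add: grad_abs_cong[of n "fourier_sum n c" f] F)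
  have f1: "\<bar>fourier_sum n c x\<bar> \<le> 1" if "x \<in> cube n" for x
    using f that by (auto simp: F abs_le_iff)

  obtain S0 where S0: "S0 \<in> Sk" "c S0 \<noteq> 0"
    using w unfolding w_eq by (metis (no_types, lifting) less_irrefl sum.neutral zero_power2)
  have V_Sk: "V t = (\<Sum>S\<in>Sk. real (card S choose k) * (c S)\<^sup>2 * exp (- t * real (card S)))" for t
    unfolding V_def energy_def Sk_def by (rule sum.mono_neutral_right) (auto simp: binomial_eq_0)
  have Vpos: "V t > 0" for t
    unfolding V_Sk
  proof (rule sum_pos2[OF Sk S0(1)])
    show "0 < real (card S0 choose k) * (c S0)\<^sup>2 * exp (- t * real (card S0))"
      using S0 by (auto simp: Sk_def)
  qed simp
  have dV: "(V has_real_derivative V' t) (at t)" for t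
    unfolding V_def V'_def by (rule energy_deriv)
  have qpos: "q t > 0" for t using Vpos[of t] w by (simp add: q_def)
  have lnq: "ln (q t) = (ln (V t) - ln w) / real k" for t
    using Vpos[of t] w by (simp add: q_def ln_powr ln_div)
  have dq: "(q has_real_derivative q' t) (at t)" for t
  proof -
    have "(q has_real_derivative 1 / real k * (V t / w) powr (1 / real k - 1) * (V' t / w)) (at t)"
      unfolding q_def using Vpos[of t] w by (auto intro!: derivative_eq_intros dV)
    moreover have "(V t / w) powr (1 / real k - 1) = q t / (V t / w)"
      using Vpos[of t] w by (simp add: q_def powr_diff)
    then have "1 / real k * (V t / w) powr (1 / real k - 1) * (V' t / w) = q' t"
      using Vpos[of t] w kpos unfolding q'_def by simp
    ultimately show ?thesis by simp
  qed
  have gap: "q' t \<le> - q t" for t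
  proof -
    have "V' t \<le> - (real k * V t)" using energy'_le[of n k c t] by (simp add: V_def V'_def)
    then have "V' t / (real k * V t) \<le> - 1" using Vpos[of t] kpos by (simp add: divide_le_eq)
    then have "q t * (V' t / (real k * V t)) \<le> q t * (- 1)" using qpos[of t] by (intro mult_left_mono) auto
    then show ?thesis by (simp add: q'_def)
  qed

  have Apos: "A > 0"
  proof -
    have "0 < V 0 powr (p / 2) * exp ((2 - p) * (V' 0 / V 0 + real k))" using Vpos[of 0] by simp
    also have "\<dots> \<le> A"
      using moment_ge_energy[of 0 p n k c] Vpos[of 0] p by (simp add: V_def V'_def A_def)
    finally show ?thesis .
  qed
  have R: "R > 0" using Apos w by (simp add: R_def)
  have lnR: "ln R = (ln A - ln w) / (real k * \<gamma>)" using Apos w by (simp add: R_def ln_powr ln_div)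

  have sup_bound: "q t \<le> R powr (1 - \<alpha>) * (2 * t) powr (- \<alpha>)" if t: "t > 0" for t
  proof -
    have "V t \<le> ((2 * t) powr (- \<alpha>)) ^ k * A"
      unfolding V_def A_def \<alpha>_def by (rule energy_le_moment[OF t p f1])
    then have "V t / w \<le> ((2 * t) powr (- \<alpha>)) ^ k * (A / w)" using w by (simp add: field_simps)
    then have "q t \<le> (((2 * t) powr (- \<alpha>)) ^ k * (A / w)) powr (1 / real k)"
      unfolding q_def using Vpos[of t] w by (intro powr_mono2) auto
    also have "\<dots> = (((2 * t) powr (- \<alpha>)) ^ k) powr (1 / real k) * (A / w) powr (1 / real k)"
      by (rule powr_mult)
    also have "(((2 * t) powr (- \<alpha>)) ^ k) powr (1 / real k) = (2 * t) powr (- \<alpha>)"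
      using t kpos by (simp add: powr_powr flip: powr_realpow)
    also have "(A / w) powr (1 / real k) = R powr (1 - \<alpha>)"
      using kpos \<gamma> by (simp add: R_def powr_powr \<alpha>\<gamma>)
    finally show ?thesis by (simp add: mult.commute)
  qed

  have lsi: "2 * \<alpha> / (1 - \<alpha>) * Z \<le> - (2 * \<alpha> / (1 - \<alpha>)) * (q' t / q t) - ln (q t) - t" if t: "t \<ge> 0" for t
  proof -
    have "V t powr (p / 2) * exp ((2 - p) * (V' t / V t + real k)) \<le> exp (- t * real k * p / 2) * A"
      using moment_ge_energy[OF t p, of n k c] Vpos[of t] by (simp add: V_def V'_def A_def)
    then have "ln (V t powr (p / 2) * exp ((2 - p) * (V' t / V t + real k))) \<le> ln (exp (- t * real k * p / 2) * A)"
      using Vpos[of t] by (intro ln_mono) auto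
    then have "\<gamma> * ln (V t) + 2 * \<alpha> * (V' t / V t + real k) \<le> ln A - t * (real k * \<gamma>)"
      using Vpos[of t] Apos by (simp add: ln_mult ln_powr \<alpha>\<gamma> \<gamma>_def)
    then have "(\<gamma> * ln (V t) + 2 * \<alpha> * (V' t / V t + real k)) / (real k * \<gamma>) \<le> (ln A - t * (real k * \<gamma>)) / (real k * \<gamma>)"
      using kpos \<gamma> by (intro divide_right_mono) auto
    then have 1: "ln (V t) / real k + a * (V' t / (real k * V t)) + a \<le> ln A / (real k * \<gamma>) - t"
      using kpos \<gamma> by (simp add: a_def \<alpha>\<gamma> add_divide_distrib diff_divide_distrib distrib_left mult_ac)
    have "a * Z = a + a * \<zeta> - ln R" using a by (simp add: Z_def right_diff_distrib distrib_left)
    moreover have "a * \<zeta> = - (\<alpha> / \<gamma>) * (ln w / real k)"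
      using w by (simp add: \<zeta>_def a_def \<alpha>\<gamma> ln_div)
    moreover have "- (\<alpha> / \<gamma>) * (ln w / real k) + ln w / (real k * \<gamma>) = ln w / real k"
    proof -
      have "\<alpha> = 1 - \<gamma>" using \<alpha>\<gamma> by simp
      then show ?thesis using \<gamma> kpos by (simp add: divide_simps) (simp add: algebra_simps)
    qed
    moreover have "q' t / q t = V' t / (real k * V t)" using qpos[of t] by (simp add: q'_def)
    ultimately have "a * Z \<le> - a * (q' t / q t) - ln (q t) - t"
      using 1 unfolding lnR lnq by (simp add: diff_divide_distrib)
    then show ?thesis by (simp add: a_def)
  qed

  have d\<eta>: "(\<eta> has_real_derivative \<eta>' t) (at t)" for t
    unfolding \<eta>_def \<eta>'_def using kpos w by (auto intro!: derivative_eq_intros sum.cong simp: mult_ac)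
  have \<eta>0: "\<eta> 0 = 1" using w unfolding \<eta>_def by (simp add: sum_divide_distrib[symmetric] w_eq[symmetric])
  have \<eta>lim: "(\<eta> \<longlongrightarrow> 0) at_top"
    unfolding \<eta>_def
  proof (rule tendsto_null_sum)
    fix S assume "S \<in> Sk"
    then have "real (card S) / real k > 0" using kpos k by (auto simp: Sk_def)
    then have "filterlim (\<lambda>t. t * (real (card S) / real k)) at_top at_top"
      by (intro filterlim_at_top_mult_tendsto_pos[OF tendsto_const] filterlim_ident)
    then have "filterlim (\<lambda>t. - t * (real (card S) / real k)) at_bot at_top"
      by (simp add: filterlim_uminus_at_bot)
    then have "((\<lambda>t. exp (- t * (real (card S) / real k))) \<longlongrightarrow> 0) at_top"
      by (rule filterlim_compose[OF exp_at_bot])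
    then show "((\<lambda>t. (c S)\<^sup>2 / w * exp (- t * (real (card S) / real k))) \<longlongrightarrow> 0) at_top"
      by (rule tendsto_mult_right_zero)
  qed
  have \<eta>q: "- \<eta>' t \<le> q t" if "t \<ge> 0" for t
  proof -
    define X where "X = (\<lambda>S :: nat set. real (card S) / real k * exp (- t * (real (card S) / real k)))"
    define Y where "Y = (\<lambda>S :: nat set. real (card S choose k) * exp (- t * real (card S)))"
    have "- \<eta>' t = (\<Sum>S\<in>Sk. (c S)\<^sup>2 / w * X S)"
      by (simp add: \<eta>'_def X_def sum_negf[symmetric])
    also have "\<dots> \<le> (\<Sum>S\<in>Sk. (c S)\<^sup>2 / w * Y S) powr (1 / real k)"
    proof (rule power_mean_profile[OF Sk _ _ _ k])
      show "Sk \<noteq> {}" using S0 by auto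
      show "(\<Sum>S\<in>Sk. (c S)\<^sup>2 / w) = 1" using w by (simp add: sum_divide_distrib[symmetric] w_eq[symmetric])
      fix S assume S: "S \<in> Sk"
      show "(c S)\<^sup>2 / w \<ge> 0" using w by simp
      show "X S \<ge> 0" by (simp add: X_def)
      have "exp (- t * (real (card S) / real k)) ^ k = exp (real k * (- t * (real (card S) / real k)))"
        by (rule exp_of_nat_mult[symmetric])
      also have "real k * (- t * (real (card S) / real k)) = - t * real (card S)" using kpos by simp
      finally have "X S ^ k = (real (card S) / real k) ^ k * exp (- t * real (card S))"
        unfolding X_def by (simp only: power_mult_distrib)
      also have "\<dots> \<le> Y S"
        unfolding Y_def using S by (intro mult_right_mono binomial_ge_n_over_k_pow_k) (auto simp: Sk_def)
      finally show "X S ^ k \<le> Y S" .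
    qed
    also have "(\<Sum>S\<in>Sk. (c S)\<^sup>2 / w * Y S) = V t / w"
      unfolding V_Sk Y_def sum_divide_distrib by (intro sum.cong refl) simp
    finally show ?thesis by (simp add: q_def)
  qed

  have "2 * \<alpha> / (1 - \<alpha>) * Z + ln R \<le>
     R * (2 * \<alpha> / (1 - \<alpha>) * ((1 - \<alpha>) * (2 * \<alpha>) powr \<alpha>) powr (- 1 / (1 - \<alpha>)) + 1 / exp 1)"
    by (rule spectral_profile_bound[OF \<alpha> R qpos dq sup_bound lsi gap d\<eta> \<eta>q \<eta>0 \<eta>lim])
  moreover have "2 * \<alpha> / (1 - \<alpha>) * Z + ln R = a * (1 + \<zeta>)"
    using a by (simp add: Z_def a_def[symmetric] right_diff_distrib)
  ultimately have core: "a * (1 + \<zeta>) \<le> R * (a * (\<gamma> * (2 * \<alpha>) powr \<alpha>) powr (- 1 / \<gamma>) + 1 / exp 1)"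
    by (simp add: a_def \<alpha>\<gamma>)
  define Ci where "Ci = M p powr (- 2 / p) + p / (2 * exp 1 * (2 - p))"
  have M: "M p \<le> \<gamma> * (2 * \<alpha>) powr \<alpha>" "M p \<ge> 1/4"
    using M_bounds[OF p] by (simp_all add: \<alpha>_def[symmetric] \<alpha>\<gamma>)
  have Cipos: "Ci > 0" unfolding Ci_def using M(2) p by (intro add_pos_pos) auto
  have "(\<gamma> * (2 * \<alpha>) powr \<alpha>) powr (- 1 / \<gamma>) \<le> M p powr (- 1 / \<gamma>)"
    using M \<gamma> by (intro powr_mono2') auto
  also have "- 1 / \<gamma> = - 2 / p" by (simp add: \<gamma>_def)
  finally have "a * (\<gamma> * (2 * \<alpha>) powr \<alpha>) powr (- 1 / \<gamma>) \<le> a * M p powr (- 2 / p)"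
    using a by (intro mult_left_mono) (auto simp: \<gamma>_def)
  then have "R * (a * (\<gamma> * (2 * \<alpha>) powr \<alpha>) powr (- 1 / \<gamma>) + 1 / exp 1) \<le> R * (a * M p powr (- 2 / p) + 1 / exp 1)"
    using R by (intro mult_left_mono) auto
  also have "a * M p powr (- 2 / p) + 1 / exp 1 = a * Ci"
  proof -
    have "a = 2 * (2 - p) / p" by (simp add: a_def \<alpha>_def)
    then have "a * (p / (2 * exp 1 * (2 - p))) = 1 / exp 1" using p by (simp add: divide_simps)
    then show ?thesis by (simp add: Ci_def distrib_left)
  qed
  finally have "a * (1 + \<zeta>) \<le> a * (R * Ci)" using core by (simp add: mult_ac)
  then have main: "1 + \<zeta> \<le> R * Ci" using a by simp

  have "w \<le> 1"
  proof -
    have "w \<le> cube_mean n (\<lambda>x. (f x)\<^sup>2)" unfolding w_def by (rule W_le)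
    also have "\<dots> \<le> cube_mean n (\<lambda>x. 1)" using f by (intro cube_mean_mono) (auto simp: abs_square_le_1 abs_le_iff)
    finally show ?thesis by (simp add: cube_mean_const)
  qed
  then have "\<zeta> \<ge> 0" using w kpos by (simp add: \<zeta>_def)
  then have "(1 + \<zeta>) powr (real k * \<gamma>) \<le> (R * Ci) powr (real k * \<gamma>)"
    using main kpos \<gamma> by (intro powr_mono2) auto
  also have "\<dots> = R powr (real k * \<gamma>) * Ci powr (real k * \<gamma>)" using R Cipos by (simp add: powr_mult)
  also have "R powr (real k * \<gamma>) = A / w" using kpos \<gamma> Apos w by (simp add: R_def powr_powr)
  finally have fin: "(1 + \<zeta>) powr (real k * \<gamma>) \<le> A / w * Ci powr (real k * \<gamma>)" .
  have Ck: "C p ^ k = Ci powr (- (real k * \<gamma>))"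
  proof -
    have "C p = Ci powr (- \<gamma>)" by (simp add: C_def Ci_def \<gamma>_def)
    then have "C p ^ k = (Ci powr (- \<gamma>)) powr real k"
      using Cipos by (simp only: powr_realpow powr_gt_zero)
    then show ?thesis by (simp add: powr_powr mult.commute)
  qed
  have "C p ^ k * w * (1 + \<zeta>) powr (real k * \<gamma>) \<le> C p ^ k * w * (A / w * Ci powr (real k * \<gamma>))"
    unfolding Ck using w by (intro mult_left_mono fin) auto
  also have "\<dots> = A * (Ci powr (- (real k * \<gamma>)) * Ci powr (real k * \<gamma>))" unfolding Ck using w by simp
  also have "\<dots> = A" using Cipos by (simp flip: powr_add)
  finally show ?thesis by (simp add: A_eq w_def \<zeta>_def \<gamma>_def)
qed

theorem theorem1p6:
  shows "(\<forall>n\<ge>1. \<forall>k\<le>n. \<forall>f \<in> cube n \<rightarrow> {-1..1}. \<forall>p\<in>{1..<2}.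
            cube_norm n p (grad_abs n k f) powr p
              \<ge> C p ^ k * W n k f *
                 (1 + 1 / (2 * real k) * ln (1 / W n k f)) powr (real k * p / 2))
       \<and> (\<exists>c>0. \<forall>p\<in>{1..<2}. C p \<ge> c * (2 - p))"
proof (intro conjI allI impI ballI)
  fix n k :: nat and f :: "(nat \<Rightarrow> real) \<Rightarrow> real" and p :: real
  assume n: "n \<ge> 1" and k: "k \<le> n" and f: "f \<in> cube n \<rightarrow> {-1..1}" and "p \<in> {1..<2}"
  then have p: "1 \<le> p" "p < 2" by auto
  have nrm: "cube_norm n p (grad_abs n k f) powr p = cube_mean n (\<lambda>x. grad_abs n k f x powr p)"
    using p by (simp add: cube_norm_powr grad_abs_nonneg)
  consider "W n k f = 0" | "k = 0" | "k \<ge> 1" "W n k f > 0"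
    using W_nonneg[of n k f] by fastforce
  then show "C p ^ k * W n k f * (1 + 1 / (2 * real k) * ln (1 / W n k f)) powr (real k * p / 2)
      \<le> cube_norm n p (grad_abs n k f) powr p"
  proof cases
    case 1
    then show ?thesis by simp
  next
    case 2
    have "W n 0 f \<le> cube_mean n (\<lambda>x. (f x)\<^sup>2)" by (rule W_le)
    also have "\<dots> \<le> cube_mean n (\<lambda>x. grad_abs n 0 f x powr p)"
    proof (rule cube_mean_mono)
      fix x assume "x \<in> cube n"
      then have fx: "\<bar>f x\<bar> \<le> 1" using f by (auto simp: abs_le_iff)
      have "{J. J \<subseteq> {1..n} \<and> card J = 0} = {{}}" by (auto dest: finite_subset[OF _ finite_atLeastAtMost])
      then have "grad_abs n 0 f x = \<bar>f x\<bar>" by (simp add: grad_abs_def)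
      moreover have "(f x)\<^sup>2 = \<bar>f x\<bar> powr 2" by simp
      moreover have "\<bar>f x\<bar> powr 2 \<le> \<bar>f x\<bar> powr p" using p fx by (intro powr_mono') auto
      ultimately show "(f x)\<^sup>2 \<le> grad_abs n 0 f x powr p" by simp
    qed
    finally show ?thesis unfolding nrm using 2 by simp
  next
    case 3
    then show ?thesis unfolding nrm using gradient_moment_bound[OF _ f p] by simp
  qed
next
  show "\<exists>c>0. \<forall>p\<in>{1..<2}. C p \<ge> c * (2 - p)"
  proof (intro exI conjI ballI)
    fix p :: real assume "p \<in> {1..<2}"
    then show "1 / 17 * (2 - p) \<le> C p" by (intro C_ge_linear) auto
  qed simp
qed

end
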